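(* There exists $\kappa>0$ such that if $|\beta|\sqrt N<1/\kappa$, then the Hamiltonian $H_\beta$ is uniformly convex on $\Omega_N$. Furthermore, $\nu_{\beta,N,M}$ satisfies the logarithmic Sobolev inequality $$\int_{\Omega_N}F(u)^2\log\Bigl(F(u)^2\Big/\int F^2\,d\nu_{\beta,N,M}\Bigr)\,\nu_{\beta,N,M}(du)\le\frac{2}{\alpha}\int_{\Omega_N}\|\nabla F(u)\|_{L^2}^2\,\nu_{\beta,N,M}(du),$$ where $\alpha=1-\kappa|\beta|\sqrt N$ and $\nabla F$ is the Fréchet derivative of $F\in C^1(\Omega_N;\mathbb R)$.
   Context: $\mathbb T=\mathbb R/2\pi\mathbb Z$; $\beta\in\mathbb R$, $N>0$, $M\in\mathbb N$; $L^2$ norms are with respect to $dx/(2\pi)$. A function in $L^2(\mathbb T;\mathbb R)$ is identified with its Fourier coefficients via $f(x)=\frac{a_0}{2}+\sum_{j\ge1}(a_j\cos jx+b_j\sin jx)$. $\Omega_N=\{f\in L^2(\mathbb T;\mathbb R):\int_{\mathbb T}f^2\,\frac{dx}{2\pi}\le N\}$. $\mathcal H$ is the Hilbert transform $e^{inx}\mapsto -i\,\mathrm{sgn}(n)e^{inx}$ ($\mathrm{sgn}(0)=0$). The Hamiltonian is $$H_\beta(u)=\frac12\int_{\mathbb T}\bigl(\mathcal H\tfrac{\partial u}{\partial x}\bigr)u\,\frac{dx}{2\pi}+\frac\beta3\int_{\mathbb T}u^3\,\frac{dx}{2\pi},$$ regarded as a densely defined function on $\Omega_N$; uniform convexity means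 that its Hessian, as a quadratic form, is bounded below by a positive constant multiple of $\|\cdot\|_{L^2}^2$. The Gibbs measure $\nu_{\beta,N,M}$ is the probability measure on $L^2(\mathbb T;\mathbb R)$ given in terms of the Fourier coefficients $(a_j,b_j)_{j=1}^M$ by $$\nu_{\beta,N,M}(df)=\frac1{Z_{\beta,N,M}}\mathbf I_{\Omega_N}(f)\exp\Bigl(-\beta\int_{\mathbb T}\Bigl(\sum_{j=1}^M a_j\cos jx+b_j\sin jx\Bigr)^3\frac{dx}{2\pi}\Bigr)\prod_{j=1}^M e^{-j(a_j^2+b_j^2)/2}\,\frac{da_j\,db_j}{2\pi j},$$ where $\mathbf I_{\Omega_N}$ is the indicator function of $\Omega_N$ and $Z_{\beta,N,M}>0$ is the normalising constant. In Fourier coordinates, $\nabla F=(\partial F/\partial a_j,\partial F/\partial b_j)_{j\ge1}$.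
   Formalization: Uniform convexity of the Hamiltonian is proved for the Hessian in mean-zero directions only (base point in Ω_N of any mean): in the constant direction h = 1 the Hessian at u = 0 is 0 for every β, N, so the claim over all of L² is false. *)

theory Defs
  imports "HOL-Analysis.Analysis"
begin

section \<open>The Hilbert space of real square-integrable functions on the circle\<close>

text \<open>The circle is modelled by one period with normalised measure \<open>dx / (2\<pi>)\<close>.  Values of a
  representative outside \<open>[0, 2\<pi>)\<close> are irrelevant.\<close>

definition circle :: "real measure" where
  "circle = uniform_measure lborel {0..<2*pi}"

definition square_integrable :: "(real \<Rightarrow> real) \<Rightarrow> bool" where
  "square_integrable f \<longleftrightarrow> f \<in> borel_measurable borel \<and> integrable circle (\<lambda>x. (f x)\<^sup>2)"

definition L2_rel :: "(real \<Rightarrow> real) \<Rightarrow> (real \<Rightarrow> real) \<Rightarrow> bool" where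
  "L2_rel f g \<longleftrightarrow> square_integrable f \<and> square_integrable g \<and> (AE x in circle. f x = g x)"

lemma space_circle [simp]: "space circle = UNIV"
  and sets_circle [simp, measurable_cong]: "sets circle = sets borel"
  by (auto simp: circle_def)

lemma emeasure_circle_UNIV: "emeasure circle UNIV = 1"
  unfolding circle_def by (subst emeasure_uniform_measure) (auto simp: ennreal_divide_self)

lemma finite_measure_circle: "finite_measure circle"
  by (rule finite_measureI) (simp add: emeasure_circle_UNIV)

lemma square_integrable_measurable [measurable_dest]:
  "square_integrable f \<Longrightarrow> f \<in> borel_measurable borel"
  by (simp add: square_integrable_def)

lemma square_integrable_mult:
  assumes "square_integrable f" "square_integrable g"
  shows "integrable circle (\<lambda>x. f x * g x)"
proof (rule Bochner_Integration.integrable_bound)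
  show "integrable circle (\<lambda>x. (f x)\<^sup>2 + (g x)\<^sup>2)"
    using assms by (auto simp: square_integrable_def)
  have [measurable]: "f \<in> borel_measurable borel" "g \<in> borel_measurable borel"
    using assms by (auto simp: square_integrable_def)
  show "(\<lambda>x. f x * g x) \<in> borel_measurable circle" by measurable
  have "\<bar>a * b\<bar> \<le> a\<^sup>2 + b\<^sup>2" for a b :: real
  proof -
    have "2 * (\<bar>a\<bar> * \<bar>b\<bar>) \<le> a\<^sup>2 + b\<^sup>2"
      using sum_squares_bound[of "\<bar>a\<bar>" "\<bar>b\<bar>"] by simp
    moreover have "0 \<le> \<bar>a\<bar> * \<bar>b\<bar>" by simp
    ultimately show ?thesis unfolding abs_mult by linarith
  qed
  then show "AE x in circle. norm (f x * g x) \<le> norm ((f x)\<^sup>2 + (g x)\<^sup>2)"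
    by auto
qed

lemma square_integrable_zero: "square_integrable (\<lambda>x. 0)"
  by (simp add: square_integrable_def)

lemma square_integrable_add:
  assumes "square_integrable f" "square_integrable g"
  shows "square_integrable (\<lambda>x. f x + g x)"
proof -
  have "integrable circle (\<lambda>x. (f x)\<^sup>2 + (g x)\<^sup>2 + 2 * (f x * g x))"
    using assms square_integrable_mult[OF assms] by (auto simp: square_integrable_def)
  then show ?thesis
    using assms by (auto simp: square_integrable_def power2_sum algebra_simps)
qed

lemma square_integrable_scaleR:
  "square_integrable f \<Longrightarrow> square_integrable (\<lambda>x. c * f x)"
  by (auto simp: square_integrable_def power_mult_distrib)

lemma square_integrable_bounded:
  assumes [measurable]: "f \<in> borel_measurable borel" and "\<And>x. \<bar>f x\<bar> \<le> B"
  shows "square_integrable f"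
  unfolding square_integrable_def
proof
  show "integrable circle (\<lambda>x. (f x)\<^sup>2)"
    using assms(2)
    by (intro finite_measure.integrable_const_bound[OF finite_measure_circle, of _ "B\<^sup>2"])
       (auto intro!: AE_I2 abs_le_square_iff[THEN iffD1] order_trans[OF assms(2) abs_ge_self])
qed fact

quotient_type L2 = "real \<Rightarrow> real" / partial: L2_rel
proof (rule part_equivpI)
  show "\<exists>f. L2_rel f f"
    using square_integrable_zero by (auto simp: L2_rel_def)
  show "symp L2_rel"
    by (rule sympI) (auto simp: L2_rel_def)
  show "transp L2_rel"
    by (rule transpI) (auto simp: L2_rel_def)
qed

instantiation L2 :: real_vector
begin

lift_definition zero_L2 :: L2 is "\<lambda>x. 0"
  by (simp add: L2_rel_def square_integrable_zero)

lift_definition plus_L2 :: "L2 \<Rightarrow> L2 \<Rightarrow> L2" is "\<lambda>f g x. f x + g x"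
  by (auto simp: L2_rel_def square_integrable_add)

lift_definition scaleR_L2 :: "real \<Rightarrow> L2 \<Rightarrow> L2" is "\<lambda>c f x. c * f x"
  by (auto simp: L2_rel_def square_integrable_scaleR)

definition uminus_L2 :: "L2 \<Rightarrow> L2" where "uminus_L2 f = (-1) *\<^sub>R f"

definition minus_L2 :: "L2 \<Rightarrow> L2 \<Rightarrow> L2" where "minus_L2 f g = f + - g"

instance
proof
  fix f g h :: L2 and a b :: real
  show "f + g + h = f + (g + h)"
    by transfer (auto simp: L2_rel_def add.assoc intro!: square_integrable_add)
  show "f + g = g + f"
    by transfer (auto simp: L2_rel_def add.commute intro!: square_integrable_add)
  show "0 + f = f"
    by transfer (auto simp: L2_rel_def)
  show "- f + f = 0"
    unfolding uminus_L2_def by transfer (auto simp: L2_rel_def square_integrable_zero)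
  show "f - g = f + - g"
    by (simp add: minus_L2_def)
  show "a *\<^sub>R (f + g) = a *\<^sub>R f + a *\<^sub>R g"
    by transfer (auto simp: L2_rel_def distrib_left
        intro!: square_integrable_add square_integrable_scaleR)
  show "(a + b) *\<^sub>R f = a *\<^sub>R f + b *\<^sub>R f"
    by transfer (auto simp: L2_rel_def distrib_right
        intro!: square_integrable_add square_integrable_scaleR)
  show "a *\<^sub>R b *\<^sub>R f = (a * b) *\<^sub>R f"
    by transfer (auto simp: L2_rel_def mult.assoc intro!: square_integrable_scaleR)
  show "1 *\<^sub>R f = f"
    by transfer (auto simp: L2_rel_def)
qed

end

instantiation L2 :: real_inner
begin

lift_definition inner_L2 :: "L2 \<Rightarrow> L2 \<Rightarrow> real" is "\<lambda>f g. LINT x|circle. f x * g x"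
  by (rule integral_cong_AE) (auto simp: L2_rel_def square_integrable_def)

definition norm_L2 :: "L2 \<Rightarrow> real" where "norm_L2 f = sqrt (inner f f)"

definition sgn_L2 :: "L2 \<Rightarrow> L2" where "sgn_L2 f = f /\<^sub>R norm f"

definition dist_L2 :: "L2 \<Rightarrow> L2 \<Rightarrow> real" where "dist_L2 f g = norm (f - g)"

definition uniformity_L2 :: "(L2 \<times> L2) filter" where
  "uniformity_L2 = (INF e\<in>{0<..}. principal {(f, g). dist f g < e})"

definition open_L2 :: "L2 set \<Rightarrow> bool" where
  "open_L2 U \<longleftrightarrow> (\<forall>x\<in>U. \<forall>\<^sub>F (x', y) in uniformity. x' = x \<longrightarrow> y \<in> U)"

instance
proof
  fix f g h :: L2 and a :: real and U :: "L2 set"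
  show "dist f g = norm (f - g)"
    by (simp add: dist_L2_def)
  show "sgn f = f /\<^sub>R norm f"
    by (simp add: sgn_L2_def)
  show "uniformity = (INF e\<in>{0<..}. principal {(x, y :: L2). dist x y < e})"
    by (simp add: uniformity_L2_def)
  show "open U = (\<forall>x\<in>U. \<forall>\<^sub>F (x', y) in uniformity. x' = x \<longrightarrow> y \<in> U)"
    by (simp add: open_L2_def)
  show "inner f g = inner g f"
    by transfer (simp add: mult.commute)
  show "inner (f + g) h = inner f h + inner g h"
    by transfer (simp add: L2_rel_def distrib_right square_integrable_mult)
  show "inner (a *\<^sub>R f) g = a * inner f g"
    by transfer (simp add: mult.assoc)
  show "0 \<le> inner f f"
    by transfer simp
  show "inner f f = 0 \<longleftrightarrow> f = 0"
  proof (transfer)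
    fix f assume "L2_rel f f"
    then have "square_integrable f" by (simp add: L2_rel_def)
    then have "(LINT x|circle. f x * f x) = 0 \<longleftrightarrow> (AE x in circle. f x * f x = 0)"
      by (intro integral_nonneg_eq_0_iff_AE square_integrable_mult) auto
    then show "(LINT x|circle. f x * f x) = 0 \<longleftrightarrow> L2_rel f (\<lambda>x. 0)"
      using \<open>square_integrable f\<close> by (simp add: L2_rel_def square_integrable_zero)
  qed
  show "norm f = sqrt (inner f f)"
    by (simp add: norm_L2_def)
qed

end

section \<open>Fourier coefficients, the Hilbert transform and the Hamiltonian\<close>

lift_definition fourier :: "L2 \<Rightarrow> int \<Rightarrow> complex" is
  "\<lambda>f n. LINT x|circle. complex_of_real (f x) * cis (- of_int n * x)"
  by (rule ext, rule integral_cong_AE)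
     (auto simp: L2_rel_def square_integrable_def cis_conv_exp)

lift_definition cos_mode :: "nat \<Rightarrow> L2" is "\<lambda>j x. cos (real j * x)"
  by (auto simp: L2_rel_def intro!: square_integrable_bounded[of _ 1])

lift_definition sin_mode :: "nat \<Rightarrow> L2" is "\<lambda>j x. sin (real j * x)"
  by (auto simp: L2_rel_def intro!: square_integrable_bounded[of _ 1])

text \<open>The integral of \<open>u\<^sup>3\<close> over the circle (by the convention for \<^const>\<open>lebesgue_integral\<close> it is
  \<open>0\<close> if \<open>u\<^sup>3\<close> is not integrable, which does not happen below: \<open>u\<close> is in the
  Sobolev space \<open>H\<^sup>1\<close> or a trigonometric polynomial).\<close>

lift_definition cubic_integral :: "L2 \<Rightarrow> real" is "\<lambda>f. LINT x|circle. (f x) ^ 3"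
  by (rule integral_cong_AE) (auto simp: L2_rel_def square_integrable_def)

definition is_multiplier :: "(int \<Rightarrow> complex) \<Rightarrow> L2 \<Rightarrow> L2 \<Rightarrow> bool" where
  "is_multiplier m u v \<longleftrightarrow> (\<forall>n. fourier v n = m n * fourier u n)"

text \<open>Both operators are Fourier multipliers; an element of \<^typ>\<open>L2\<close> is determined by its Fourier
  coefficients.  The Hilbert transform is everywhere defined, the derivative only on \<open>H\<^sup>1\<close>.\<close>

definition hilbert_transform :: "L2 \<Rightarrow> L2" where
  "hilbert_transform u = (THE v. is_multiplier (\<lambda>n. - \<i> * of_int (sgn n)) u v)"

definition H1 :: "L2 set" where
  "H1 = {u. \<exists>v. is_multiplier (\<lambda>n. \<i> * of_int n) u v}"

definition derivative :: "L2 \<Rightarrow> L2" where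
  "derivative u = (THE v. is_multiplier (\<lambda>n. \<i> * of_int n) u v)"

definition hamiltonian :: "real \<Rightarrow> L2 \<Rightarrow> real" where
  "hamiltonian \<beta> u = 1/2 * inner (hilbert_transform (derivative u)) u + \<beta>/3 * cubic_integral u"

definition Omega :: "real \<Rightarrow> L2 set" where
  "Omega N = {u. (norm u)\<^sup>2 \<le> N}"

section \<open>Uniform convexity\<close>

text \<open>\<open>has_hessian_value \<Phi> u h q\<close>: the function \<open>t \<mapsto> \<Phi> (u + t h)\<close> is differentiable and its
  derivative is differentiable at \<open>0\<close> with value \<open>q\<close>, i.e. the quadratic form given by the
  Hessian of \<open>\<Phi>\<close> at \<open>u\<close> takes the value \<open>q\<close> at \<open>h\<close>.\<close>

definition has_hessian_value :: "(L2 \<Rightarrow> real) \<Rightarrow> L2 \<Rightarrow> L2 \<Rightarrow> real \<Rightarrow> bool" where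
  "has_hessian_value \<Phi> u h q \<longleftrightarrow>
     (\<exists>g. (\<forall>t. ((\<lambda>s. \<Phi> (u + s *\<^sub>R h)) has_real_derivative g t) (at t)) \<and>
          (g has_real_derivative q) (at 0))"

text \<open>The coordinates are \<open>(a\<^sub>j, b\<^sub>j)\<close> with \<open>j \<ge> 1\<close>, so the Hessian is tested on
  directions \<open>h\<close> of mean zero.  (In the direction of the constants the quadratic part of the
  Hamiltonian vanishes, and no convexity can hold there.)  The base point \<open>u\<close> may have any mean.\<close>

definition uniformly_convex_on :: "L2 set \<Rightarrow> (L2 \<Rightarrow> real) \<Rightarrow> bool" where
  "uniformly_convex_on \<Omega> \<Phi> \<longleftrightarrow>
     (\<exists>c>0. \<forall>u \<in> \<Omega> \<inter> H1. \<forall>h \<in> H1. fourier h 0 = 0 \<longrightarrow>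
        (\<exists>q. has_hessian_value \<Phi> u h q \<and> c * (norm h)\<^sup>2 \<le> q))"

section \<open>The Gibbs measure\<close>

text \<open>A point \<open>c\<close> of the coordinate space has \<open>c j = (a\<^sub>j, b\<^sub>j)\<close> for \<open>1 \<le> j \<le> M\<close>.\<close>

definition trig_poly :: "nat \<Rightarrow> (nat \<Rightarrow> real \<times> real) \<Rightarrow> L2" where
  "trig_poly M c = (\<Sum>j=1..M. fst (c j) *\<^sub>R cos_mode j + snd (c j) *\<^sub>R sin_mode j)"

definition coordinate_measure :: "nat \<Rightarrow> (nat \<Rightarrow> real \<times> real) measure" where
  "coordinate_measure M = Pi\<^sub>M {1..M} (\<lambda>_. lborel)"

definition gibbs_weight :: "real \<Rightarrow> real \<Rightarrow> nat \<Rightarrow> (nat \<Rightarrow> real \<times> real) \<Rightarrow> real" where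
  "gibbs_weight \<beta> N M c =
     indicator (Omega N) (trig_poly M c) * exp (- \<beta> * cubic_integral (trig_poly M c)) *
     (\<Prod>j=1..M. exp (- real j * ((fst (c j))\<^sup>2 + (snd (c j))\<^sup>2) / 2) / (2 * pi * real j))"

definition gibbs_normaliser :: "real \<Rightarrow> real \<Rightarrow> nat \<Rightarrow> real" where
  "gibbs_normaliser \<beta> N M = (LINT c|coordinate_measure M. gibbs_weight \<beta> N M c)"

definition gibbs :: "real \<Rightarrow> real \<Rightarrow> nat \<Rightarrow> L2 measure" where
  "gibbs \<beta> N M =
     distr (density (coordinate_measure M)
              (\<lambda>c. ennreal (gibbs_weight \<beta> N M c / gibbs_normaliser \<beta> N M)))
       borel (trig_poly M)"

section \<open>Continuously differentiable functionals\<close>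

definition C1_on :: "L2 set \<Rightarrow> (L2 \<Rightarrow> real) \<Rightarrow> (L2 \<Rightarrow> L2 \<Rightarrow>\<^sub>L real) \<Rightarrow> bool" where
  "C1_on \<Omega> F F' \<longleftrightarrow>
     (\<forall>u\<in>\<Omega>. (F has_derivative blinfun_apply (F' u)) (at u within \<Omega>)) \<and> continuous_on \<Omega> F'"

text \<open>The squared norm of \<open>(\<partial>F/\<partial>a\<^sub>j, \<partial>F/\<partial>b\<^sub>j)\<close>, \<open>j \<ge> 1\<close>; the partial derivatives are the values of
  the Frechet derivative at \<open>cos jx\<close> and \<open>sin jx\<close>.  This is the Euclidean norm in the
  coordinates, which are those of the Gibbs measure; it is half of the squared norm of the
  (mean-zero part of the) Riesz representative of \<open>D\<close> in \<^typ>\<open>L2\<close>.\<close>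

definition gradient_norm_sq :: "(L2 \<Rightarrow>\<^sub>L real) \<Rightarrow> real" where
  "gradient_norm_sq D =
     (\<Sum>i. (blinfun_apply D (cos_mode (Suc i)))\<^sup>2 + (blinfun_apply D (sin_mode (Suc i)))\<^sup>2)"

end

theory Submission
  imports Defs
begin

text \<open>The constant is \<open>\<kappa> = 6\<close>. Everything rests on the bound
  \<open>\<bar>\<integral> u h\<^sup>2\<bar> \<le> 2 \<parallel>u\<parallel> \<Sum>\<^sub>n \<bar>n\<bar> \<bar>h\<^sub>n\<bar>\<^sup>2\<close> for \<open>h\<close> of mean zero with Fourier coefficients \<open>h\<^sub>n\<close>, which follows by
  estimating the coefficients of \<open>h\<^sup>2\<close>, a convolution, with Cauchy--Schwarz. It shows
  that the cubic term changes the Hessian of the Hamiltonian by at most \<open>4 \<bar>\<beta>\<bar> \<surd>N\<close> times the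
  energy, and, applied to differences, that in Fourier coordinates the density \<open>W\<close> of the Gibbs measure is
  strongly log-concave with constant \<open>\<alpha>\<close>. The logarithmic Sobolev inequality is then
  obtained by the argument of Bobkov and Ledoux: for \<open>G = ln (F\<^sup>2 + \<delta>)\<close> and \<open>s = 1 - t\<close>, apply the
  Prekopa--Leindler inequality to \<open>exp (G / t) W\<close> and \<open>W\<close> with weights \<open>t\<close> and \<open>s\<close>, compare
  the first-order terms as \<open>s \<rightarrow> 0\<close>, and let \<open>\<delta> \<rightarrow> 0\<close>.\<close>


section \<open>The Prekopa--Leindler inequality\<close>

text \<open>Two obstacles shape the argument. With \<open>u\<close> only in \<open>L2\<close>, the
  integral of \<open>u h^2\<close> is not controlled by the norm of \<open>u\<close> times the
  squared norm of \<open>h\<close>; it has to be absorbed by the energy of \<open>h\<close>, and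
  only afterwards is the energy traded for a norm, using that every nonzero frequency is at least 1.
  That lowest frequency is the leading 1 in \<alpha>. Second, the indicator of
  \<open>Omega N\<close> cuts the Gibbs density off sharply. Prekopa--Leindler compares only values
  of the density at \<open>x\<close>, \<open>y\<close> and an intermediate point, so a convex cutoff
  costs nothing, and neither boundary terms nor derivatives of \<open>W\<close> appear. The constant
  6 comes from the Gibbs weight. Let \<open>E\<close> be the energy and \<open>Q\<close> the cubic
  integral. The Hamiltonian is \<open>E/2 + \<beta>/3 * Q\<close>, whose Hessian loses the fraction
  \<open>4 |\<beta>| sqrt N\<close> of the energy. The Gibbs exponent is minus
  \<open>E + \<beta> * Q\<close>, where the cubic term weighs 3/2 times as much relative to the
  energy, which turns 4 into 6.\<close>

text \<open>Encodes \<open>a^t * b^(1-t) \<le> c\<close> for extended values through strictly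
  smaller positive reals. This avoids powers of infinity, is vacuous when \<open>a\<close> or
  \<open>b\<close> is 0, and passes to suprema of \<open>a\<close> and \<open>b\<close> at
  once.\<close>

definition powr_mean_le :: "real \<Rightarrow> ennreal \<Rightarrow> ennreal \<Rightarrow> ennreal \<Rightarrow> bool" where
  "powr_mean_le t a b c \<longleftrightarrow>
     (\<forall>p>0. \<forall>q>0. ennreal p < a \<longrightarrow> ennreal q < b \<longrightarrow> ennreal (p powr t * q powr (1 - t)) \<le> c)"

text \<open>Measure and combination map are parameters, so that the property can be passed from the
  line to pairs and finite products.\<close>

definition prekopa_leindler :: "real \<Rightarrow> 'a measure \<Rightarrow> ('a \<Rightarrow> 'a \<Rightarrow> 'a) \<Rightarrow> bool" where
  "prekopa_leindler t M comb \<longleftrightarrow>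
     (\<forall>u\<in>borel_measurable M. \<forall>v\<in>borel_measurable M. \<forall>w\<in>borel_measurable M.
        (\<forall>x\<in>space M. \<forall>y\<in>space M. powr_mean_le t (u x) (v y) (w (comb x y))) \<longrightarrow>
        powr_mean_le t (integral\<^sup>N M u) (integral\<^sup>N M v) (integral\<^sup>N M w))"

lemma prekopa_leindlerD:
  assumes "prekopa_leindler t M comb"
    and "u \<in> borel_measurable M" "v \<in> borel_measurable M" "w \<in> borel_measurable M"
    and "\<And>x y. x \<in> space M \<Longrightarrow> y \<in> space M \<Longrightarrow> powr_mean_le t (u x) (v y) (w (comb x y))"
  shows "powr_mean_le t (integral\<^sup>N M u) (integral\<^sup>N M v) (integral\<^sup>N M w)"
  using assms unfolding prekopa_leindler_def by blast

section \<open>The inequality on the real line, by level sets\<close>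

lemma emeasure_affine_vimage:
  fixes A :: "real set"
  assumes "0 < t" and [measurable]: "A \<in> sets borel"
  shows "emeasure lborel {x. (x - d) / t \<in> A} = ennreal t * emeasure lborel A"
proof -
  have "emeasure lborel {x. (x - d) / t \<in> A} = (\<integral>\<^sup>+x. indicator {x. (x - d) / t \<in> A} x \<partial>lborel)"
    by (subst nn_integral_indicator) auto
  also have "\<dots> = ennreal \<bar>t\<bar> * (\<integral>\<^sup>+x. indicator {x. (x - d) / t \<in> A} (d + t * x) \<partial>lborel)"
    by (rule nn_integral_real_affine) (use assms in auto)
  also have "(\<lambda>x. indicator {x. (x - d) / t \<in> A} (d + t * x) :: ennreal) = indicator A"
    using assms by (auto simp: fun_eq_iff indicator_def)
  finally show ?thesis using assms by simp
qed

text \<open>One summand contracted to a point near its supremum and the other to a point near its infimum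
  give two affine copies inside \<open>C\<close> that hardly overlap.\<close>

lemma brunn_minkowski_line:
  fixes A B C :: "real set"
  assumes t: "0 < t" "t < 1"
    and [measurable]: "A \<in> sets borel" "B \<in> sets borel" "C \<in> sets borel"
    and ne: "A \<noteq> {}" "B \<noteq> {}" and bd: "bdd_above A" "bdd_below B"
    and sub: "\<And>a b. a \<in> A \<Longrightarrow> b \<in> B \<Longrightarrow> t * a + (1 - t) * b \<in> C"
  shows "ennreal t * emeasure lborel A + ennreal (1 - t) * emeasure lborel B \<le> emeasure lborel C"
proof (rule ennreal_le_epsilon)
  fix e :: real assume e: "0 < e"
  obtain a where a: "a \<in> A" "Sup A - e < a"
    using less_cSup_iff[OF ne(1) bd(1), of "Sup A - e"] e by auto
  obtain b where b: "b \<in> B" "b < Inf B + e"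
    using cInf_less_iff[OF ne(2) bd(2), of "Inf B + e"] e by auto
  define A1 where "A1 = {x. (x - (1 - t) * b) / t \<in> A}"
  define B1 where "B1 = {x. (x - t * a) / (1 - t) \<in> B}"
  have [measurable]: "A1 \<in> sets borel" "B1 \<in> sets borel"
    unfolding A1_def B1_def by measurable
  have "A1 \<subseteq> C"
  proof
    fix x assume "x \<in> A1"
    from sub[OF this[unfolded A1_def mem_Collect_eq] b(1)] show "x \<in> C" using t by simp
  qed
  moreover have "B1 \<subseteq> C"
  proof
    fix x assume "x \<in> B1"
    from sub[OF a(1) this[unfolded B1_def mem_Collect_eq]] show "x \<in> C" using t by simp
  qed
  ultimately have un: "emeasure lborel (A1 \<union> B1) \<le> emeasure lborel C"
    by (intro emeasure_mono) auto
  have "A1 \<inter> B1 \<subseteq> {t * a + (1 - t) * Inf B .. t * Sup A + (1 - t) * b}"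
  proof
    fix x assume x: "x \<in> A1 \<inter> B1"
    have "(x - (1 - t) * b) / t \<le> Sup A" using x bd by (auto simp: A1_def intro: cSup_upper)
    moreover have "Inf B \<le> (x - t * a) / (1 - t)" using x bd by (auto simp: B1_def intro: cInf_lower)
    ultimately show "x \<in> {t * a + (1 - t) * Inf B .. t * Sup A + (1 - t) * b}"
      using t by (auto simp: field_simps)
  qed
  then have "emeasure lborel (A1 \<inter> B1)
      \<le> emeasure lborel {t * a + (1 - t) * Inf B .. t * Sup A + (1 - t) * b}"
    by (intro emeasure_mono) auto
  also have "\<dots> \<le> ennreal e"
  proof -
    have "t * (Sup A - a) \<le> t * e" "(1 - t) * (b - Inf B) \<le> (1 - t) * e"
      using a b t by (auto intro!: mult_left_mono)
    then have "t * Sup A + (1 - t) * b - (t * a + (1 - t) * Inf B) \<le> e"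
      by (simp add: algebra_simps)
    then show ?thesis by (auto simp: emeasure_lborel_Icc_eq intro!: ennreal_leI)
  qed
  finally have int: "emeasure lborel (A1 \<inter> B1) \<le> ennreal e" .
  have "ennreal t * emeasure lborel A + ennreal (1 - t) * emeasure lborel B
      = emeasure lborel A1 + emeasure lborel B1"
    unfolding A1_def B1_def using t by (simp add: emeasure_affine_vimage)
  also have "\<dots> = emeasure lborel (A1 \<union> B1) + emeasure lborel (A1 \<inter> B1)"
    by (rule emeasure_Un_Int) auto
  also have "\<dots> \<le> emeasure lborel C + ennreal e"
    by (rule add_mono[OF un int])
  finally show "ennreal t * emeasure lborel A + ennreal (1 - t) * emeasure lborel B
      \<le> emeasure lborel C + ennreal e" .
qed

text \<open>Tonelli for superlevel sets. Levels run over \<open>(0,1)\<close> because the functions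
  will be normalised by their suprema; below level 1 their superlevel sets are nonempty.\<close>

lemma nn_integral_emeasure_levels:
  fixes P :: "real \<Rightarrow> real \<Rightarrow> bool"
  assumes [measurable]: "Measurable.pred (lborel \<Otimes>\<^sub>M lborel) (\<lambda>(l, x). P l x)"
  shows "(\<integral>\<^sup>+l\<in>{0<..<1}. emeasure lborel {x. P l x} \<partial>lborel)
    = (\<integral>\<^sup>+x. (\<integral>\<^sup>+l. (if 0 < l \<and> l < 1 \<and> P l x then 1 else 0) \<partial>lborel) \<partial>lborel)"
proof -
  have [measurable]: "Measurable.pred lborel (P l)" for l
    using measurable_compose[OF measurable_Pair1' assms, of l] by simp
  have "(\<integral>\<^sup>+l\<in>{0<..<1}. emeasure lborel {x. P l x} \<partial>lborel)
      = (\<integral>\<^sup>+l. (\<integral>\<^sup>+x. (if 0 < l \<and> l < 1 \<and> P l x then 1 else 0) \<partial>lborel) \<partial>lborel)"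
  proof (rule nn_integral_cong)
    fix l :: real
    have "emeasure lborel {x. P l x} * indicator {0<..<1} l
       = (\<integral>\<^sup>+x. indicator {x. P l x} x * indicator {0<..<1} l \<partial>lborel)"
      by (subst nn_integral_multc) auto
    also have "\<dots> = (\<integral>\<^sup>+x. (if 0 < l \<and> l < 1 \<and> P l x then 1 else 0) \<partial>lborel)"
      by (intro nn_integral_cong) (auto simp: indicator_def)
    finally show "emeasure lborel {x. P l x} * indicator {0<..<1} l
      = (\<integral>\<^sup>+x. (if 0 < l \<and> l < 1 \<and> P l x then 1 else 0) \<partial>lborel)" .
  qed
  also have "\<dots> = (\<integral>\<^sup>+x. (\<integral>\<^sup>+l. (if 0 < l \<and> l < 1 \<and> P l x then 1 else 0) \<partial>lborel) \<partial>lborel)"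
    by (rule lborel_pair.Fubini') measurable
  finally show ?thesis .
qed

lemma layer_cake:
  fixes f :: "real \<Rightarrow> real"
  assumes [measurable]: "f \<in> borel_measurable borel" and "0 < a" "\<And>x. 0 \<le> f x" "\<And>x. f x \<le> a"
  shows "(\<integral>\<^sup>+x. f x \<partial>lborel)
    = ennreal a * (\<integral>\<^sup>+l\<in>{0<..<1}. emeasure lborel {x. a * l < f x} \<partial>lborel)"
proof -
  have "(\<integral>\<^sup>+l. (if 0 < l \<and> l < 1 \<and> a * l < f x then 1 else 0) \<partial>lborel) = ennreal (f x / a)" for x
  proof -
    have "(\<integral>\<^sup>+l. (if 0 < l \<and> l < 1 \<and> a * l < f x then 1 else 0) \<partial>lborel)
       = (\<integral>\<^sup>+l. indicator {0<..<f x / a} l \<partial>lborel)"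
    proof (intro nn_integral_cong)
      fix l :: real
      have "l < 1" if "l < f x / a" using that assms(2) assms(4)[of x] by (smt (verit) divide_le_eq_1)
      moreover have "a * l < f x \<longleftrightarrow> l < f x / a" using assms(2) by (simp add: field_simps)
      ultimately show "(if 0 < l \<and> l < 1 \<and> a * l < f x then 1 else 0) = (indicator {0<..<f x / a} l :: ennreal)"
        by (auto simp: indicator_def)
    qed
    also have "\<dots> = ennreal (f x / a)"
      using assms(2) assms(3)[of x] by simp
    finally show ?thesis .
  qed
  then have "ennreal a * (\<integral>\<^sup>+l\<in>{0<..<1}. emeasure lborel {x. a * l < f x} \<partial>lborel)
     = (\<integral>\<^sup>+x. ennreal a * ennreal (f x / a) \<partial>lborel)"
    by (subst nn_integral_emeasure_levels) (auto simp: nn_integral_cmult)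
  also have "\<dots> = (\<integral>\<^sup>+x. f x \<partial>lborel)"
    using assms(2,3) by (intro nn_integral_cong) (simp add: ennreal_mult'[symmetric])
  finally show ?thesis by simp
qed

text \<open>Only one direction, because \<open>w\<close> may exceed \<open>a\<close>: the levels
  above \<open>a\<close> are discarded. The superlevel sets are non-strict since
  \<open>powr_mean_le\<close> delivers a non-strict lower bound for \<open>w\<close>.\<close>

lemma layer_cake_le:
  fixes w :: "real \<Rightarrow> ennreal"
  assumes [measurable]: "w \<in> borel_measurable borel" and "0 < a"
  shows "ennreal a * (\<integral>\<^sup>+l\<in>{0<..<1}. emeasure lborel {x. ennreal (a * l) \<le> w x} \<partial>lborel)
    \<le> (\<integral>\<^sup>+x. w x \<partial>lborel)"
proof -
  let ?I = "\<lambda>x. \<integral>\<^sup>+l. (if 0 < l \<and> l < 1 \<and> ennreal (a * l) \<le> w x then 1 else 0) \<partial>lborel"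
  have "ennreal a * (\<integral>\<^sup>+l\<in>{0<..<1}. emeasure lborel {x. ennreal (a * l) \<le> w x} \<partial>lborel)
      = (\<integral>\<^sup>+x. ennreal a * ?I x \<partial>lborel)"
    by (subst nn_integral_emeasure_levels, measurable, subst nn_integral_cmult) auto
  also have "\<dots> \<le> (\<integral>\<^sup>+x. w x \<partial>lborel)"
  proof (rule nn_integral_mono)
    fix x
    show "ennreal a * ?I x \<le> w x"
    proof (cases "w x")
      case (real r)
      have "?I x \<le> (\<integral>\<^sup>+l. indicator {0..r / a} l \<partial>lborel)"
        using real assms(2) by (intro nn_integral_mono) (auto simp: indicator_def field_simps)
      also have "\<dots> = ennreal (r / a)" using real assms(2) by simp
      finally have "ennreal a * ?I x \<le> ennreal a * ennreal (r / a)" by (intro mult_left_mono) auto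
      also have "\<dots> = w x" using real assms(2) by (simp add: ennreal_mult'[symmetric])
      finally show ?thesis .
    qed simp
  qed
  finally show ?thesis .
qed

text \<open>Normalise by the suprema \<open>a\<close> and \<open>b\<close>. Since
  \<open>l^t * l^(1-t) = l\<close>, the combination of the level sets of \<open>u\<close> at
  \<open>a * l\<close> and of \<open>v\<close> at \<open>b * l\<close> lies in the level set of
  \<open>w\<close> at \<open>K * l\<close>, where \<open>K = a^t * b^(1-t)\<close>. Apply
  \<open>brunn_minkowski_line\<close> at each level, integrate over \<open>l\<close>, and return
  from the arithmetic to the geometric mean with Young's inequality. The bound \<open>k\<close>
  keeps suprema finite and level sets bounded.\<close>

lemma prekopa_leindler_line_bounded:
  fixes u v :: "real \<Rightarrow> real" and w :: "real \<Rightarrow> ennreal"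
  assumes t: "0 < t" "t < 1"
    and [measurable]: "u \<in> borel_measurable borel" "v \<in> borel_measurable borel" "w \<in> borel_measurable borel"
    and u: "\<And>x. 0 \<le> u x" "\<And>x. u x \<le> k" "\<And>x. k < \<bar>x\<bar> \<Longrightarrow> u x = 0"
    and v: "\<And>x. 0 \<le> v x" "\<And>x. v x \<le> k" "\<And>x. k < \<bar>x\<bar> \<Longrightarrow> v x = 0"
    and le: "\<And>x y. powr_mean_le t (u x) (v y) (w (t * x + (1 - t) * y))"
  shows "powr_mean_le t (\<integral>\<^sup>+x. u x \<partial>lborel) (\<integral>\<^sup>+x. v x \<partial>lborel) (\<integral>\<^sup>+x. w x \<partial>lborel)"
  unfolding powr_mean_le_def
proof (intro allI impI)
  fix p q :: real
  assume p: "0 < p" "ennreal p < (\<integral>\<^sup>+x. u x \<partial>lborel)" and q: "0 < q" "ennreal q < (\<integral>\<^sup>+x. v x \<partial>lborel)"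
  define a where "a = (SUP x. u x)"
  define b where "b = (SUP x. v x)"
  have bdu: "bdd_above (range u)" using u(2) by (auto intro!: bdd_aboveI)
  have bdv: "bdd_above (range v)" using v(2) by (auto intro!: bdd_aboveI)
  have ua: "u x \<le> a" for x unfolding a_def using bdu by (intro cSUP_upper) auto
  have vb: "v x \<le> b" for x unfolding b_def using bdv by (intro cSUP_upper) auto
  have "a > 0"
  proof (rule ccontr)
    assume "\<not> a > 0"
    then have "u x = 0" for x using ua[of x] u(1)[of x] by linarith
    then show False using p by simp
  qed
  have "b > 0"
  proof (rule ccontr)
    assume "\<not> b > 0"
    then have "v x = 0" for x using vb[of x] v(1)[of x] by linarith
    then show False using q by simp
  qed
  define K where "K = a powr t * b powr (1 - t)"
  have "K > 0" using \<open>a > 0\<close> \<open>b > 0\<close> by (simp add: K_def)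
  define IA where "IA = (\<integral>\<^sup>+l\<in>{0<..<1}. emeasure lborel {x. a * l < u x} \<partial>lborel)"
  define IB where "IB = (\<integral>\<^sup>+l\<in>{0<..<1}. emeasure lborel {x. b * l < v x} \<partial>lborel)"
  have IA: "ennreal (p / a) \<le> IA"
  proof -
    have "ennreal p \<le> ennreal a * IA"
      using p layer_cake[of u a] \<open>a > 0\<close> u(1) ua by (simp add: IA_def)
    then have "ennreal (1 / a) * ennreal p \<le> ennreal (1 / a) * (ennreal a * IA)"
      by (intro mult_left_mono) auto
    then show ?thesis using \<open>a > 0\<close> p
      by (simp add: ennreal_mult'[symmetric] mult.assoc[symmetric])
  qed
  have IB: "ennreal (q / b) \<le> IB"
  proof -
    have "ennreal q \<le> ennreal b * IB"
      using q layer_cake[of v b] \<open>b > 0\<close> v(1) vb by (simp add: IB_def)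
    then have "ennreal (1 / b) * ennreal q \<le> ennreal (1 / b) * (ennreal b * IB)"
      by (intro mult_left_mono) auto
    then show ?thesis using \<open>b > 0\<close> q
      by (simp add: ennreal_mult'[symmetric] mult.assoc[symmetric])
  qed
  have lev: "ennreal t * emeasure lborel {x. a * l < u x} + ennreal (1 - t) * emeasure lborel {x. b * l < v x}
     \<le> emeasure lborel {x. ennreal (K * l) \<le> w x}" if l: "0 < l" "l < 1" for l
  proof (rule brunn_minkowski_line[OF t])
    have "a * l < a" "b * l < b" using l \<open>a > 0\<close> \<open>b > 0\<close> by auto
    then have "\<exists>x. a * l < u x" "\<exists>x. b * l < v x"
      using less_cSUP_iff[of UNIV u "a * l"] less_cSUP_iff[of UNIV v "b * l"] bdu bdv
      by (auto simp: a_def b_def)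
    then show "{x. a * l < u x} \<noteq> {}" "{x. b * l < v x} \<noteq> {}" by auto
    show "bdd_above {x. a * l < u x}"
    proof (rule bdd_aboveI[of _ k])
      fix x assume "x \<in> {x. a * l < u x}"
      moreover have "0 < a * l" using l \<open>a > 0\<close> by simp
      ultimately have "u x \<noteq> 0" by auto
      then show "x \<le> k" using u(3)[of x] by linarith
    qed
    show "bdd_below {x. b * l < v x}"
    proof (rule bdd_belowI[of _ "-k"])
      fix x assume "x \<in> {x. b * l < v x}"
      moreover have "0 < b * l" using l \<open>b > 0\<close> by simp
      ultimately have "v x \<noteq> 0" by auto
      then show "-k \<le> x" using v(3)[of x] by linarith
    qed
    fix x y assume x: "x \<in> {x. a * l < u x}" and y: "y \<in> {x. b * l < v x}"
    have "ennreal ((a * l) powr t * (b * l) powr (1 - t)) \<le> w (t * x + (1 - t) * y)"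
      using le[of x y, unfolded powr_mean_le_def, rule_format, of "a * l" "b * l"] x y l \<open>a > 0\<close> \<open>b > 0\<close>
      by (auto simp: ennreal_less_iff)
    also have "(a * l) powr t * (b * l) powr (1 - t) = K * (l powr t * l powr (1 - t))"
      using l \<open>a > 0\<close> \<open>b > 0\<close> by (simp add: K_def powr_mult)
    also have "l powr t * l powr (1 - t) = l" using l by (simp add: powr_add[symmetric])
    finally show "t * x + (1 - t) * y \<in> {x. ennreal (K * l) \<le> w x}" by simp
  qed measurable
  have "ennreal (p powr t * q powr (1 - t)) \<le> ennreal (K * (t * (p / a) + (1 - t) * (q / b)))"
  proof (rule ennreal_leI)
    have "(p / a) powr t * (q / b) powr (1 - t) \<le> t * (p / a) + (1 - t) * (q / b)"
      using t p q \<open>a > 0\<close> \<open>b > 0\<close> by (intro Youngs_inequality_0) auto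
    then have "K * ((p / a) powr t * (q / b) powr (1 - t)) \<le> K * (t * (p / a) + (1 - t) * (q / b))"
      using \<open>K > 0\<close> by simp
    also have "K * ((p / a) powr t * (q / b) powr (1 - t)) = p powr t * q powr (1 - t)"
      using p q \<open>a > 0\<close> \<open>b > 0\<close> by (simp add: K_def powr_divide)
    finally show "p powr t * q powr (1 - t) \<le> K * (t * (p / a) + (1 - t) * (q / b))" .
  qed
  also have "\<dots> = ennreal K * (ennreal t * ennreal (p / a) + ennreal (1 - t) * ennreal (q / b))"
    using t p q \<open>a > 0\<close> \<open>b > 0\<close> \<open>K > 0\<close>
    by (simp only: ennreal_mult ennreal_plus less_imp_le divide_nonneg_pos mult_nonneg_nonneg add_nonneg_nonneg
        diff_ge_0_iff_ge)
  also have "\<dots> \<le> ennreal K * (ennreal t * IA + ennreal (1 - t) * IB)"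
    using IA IB by (intro mult_left_mono add_mono) auto
  also have "ennreal t * IA + ennreal (1 - t) * IB =
     (\<integral>\<^sup>+l\<in>{0<..<1}. (ennreal t * emeasure lborel {x. a * l < u x}
        + ennreal (1 - t) * emeasure lborel {x. b * l < v x}) \<partial>lborel)"
    unfolding IA_def IB_def
    by (subst nn_integral_cmult[symmetric], measurable, subst nn_integral_cmult[symmetric], measurable,
        subst nn_integral_add[symmetric], measurable) (auto intro!: nn_integral_cong simp: algebra_simps)
  also have "\<dots> \<le> (\<integral>\<^sup>+l\<in>{0<..<1}. emeasure lborel {x. ennreal (K * l) \<le> w x} \<partial>lborel)"
    using lev by (intro nn_integral_mono) (auto simp: indicator_def)
  also have "ennreal K * \<dots> \<le> (\<integral>\<^sup>+x. w x \<partial>lborel)"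
    using \<open>K > 0\<close> by (intro layer_cake_le) auto
  finally show "ennreal (p powr t * q powr (1 - t)) \<le> (\<integral>\<^sup>+x. w x \<partial>lborel)"
    by (simp add: mult_left_mono)
qed


text \<open>\<open>u\<close> and \<open>v\<close> are truncated in height and support and
  \<open>w\<close> is left alone, so the pointwise hypothesis survives. Monotone convergence then
  reaches any \<open>p\<close> and \<open>q\<close> strictly below the two integrals.\<close>

lemma prekopa_leindler_line:
  assumes t: "0 < t" "t < 1"
  shows "prekopa_leindler t lborel (\<lambda>x y :: real. t * x + (1 - t) * y)"
  unfolding prekopa_leindler_def
proof (intro ballI impI)
  fix u v w :: "real \<Rightarrow> ennreal"
  assume [measurable]: "u \<in> borel_measurable lborel" "v \<in> borel_measurable lborel" "w \<in> borel_measurable lborel"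
  assume le: "\<forall>x\<in>space lborel. \<forall>y\<in>space lborel. powr_mean_le t (u x) (v y) (w (t * x + (1 - t) * y))"
  define cut where "cut f n x = enn2real (min (f x) (of_nat n)) * indicator {- real n..real n} x"
    for f :: "real \<Rightarrow> ennreal" and n :: nat and x :: real
  have cut_eq: "ennreal (cut f n x) = (if \<bar>x\<bar> \<le> real n then min (f x) (of_nat n) else 0)" for f n x
  proof -
    have "min (f x) (of_nat n) < top" by (simp add: min_less_iff_disj of_nat_less_top)
    then show ?thesis by (auto simp: cut_def indicator_def)
  qed
  have mono: "incseq (\<lambda>n x. ennreal (cut f n x))" for f
  proof (intro incseq_SucI le_funI)
    fix n x
    have "of_nat n \<le> (of_nat (Suc n) :: ennreal)" by (simp add: add_increasing)
    then show "ennreal (cut f n x) \<le> ennreal (cut f (Suc n) x)"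
      unfolding cut_eq using min.mono[OF order_refl[of "f x"], of "of_nat n" "of_nat (Suc n)"] by simp
  qed
  have SUP_cut: "(SUP n. ennreal (cut f n x)) = f x" for f x
  proof (rule antisym)
    show "(SUP n. ennreal (cut f n x)) \<le> f x"
      unfolding cut_eq by (rule SUP_least) auto
    show "f x \<le> (SUP n. ennreal (cut f n x))"
    proof (rule dense_le)
      fix y assume y: "y < f x"
      then have "y < top" using less_top order.strict_trans2 by (metis top_greatest)
      then obtain r where r: "y = ennreal r" "0 \<le> r" by (cases y) auto
      obtain n :: nat where n: "max r \<bar>x\<bar> \<le> real n" using real_arch_simple by blast
      have "y \<le> of_nat n" using n r by (metis ennreal_leI ennreal_of_nat_eq_real_of_nat max.bounded_iff)
      then have "y \<le> ennreal (cut f n x)" using n y by (simp add: cut_eq)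
      then show "y \<le> (SUP n. ennreal (cut f n x))" by (rule SUP_upper2[rotated]) auto
    qed
  qed
  have [measurable]: "cut f n \<in> borel_measurable borel" if [measurable]: "f \<in> borel_measurable borel" for f n
    unfolding cut_def by measurable
  have int: "integral\<^sup>N lborel f = (SUP n. \<integral>\<^sup>+x. cut f n x \<partial>lborel)"
    if [measurable]: "f \<in> borel_measurable borel" for f
    by (subst nn_integral_monotone_convergence_SUP[symmetric, OF mono]) (auto simp: SUP_cut)
  show "powr_mean_le t (integral\<^sup>N lborel u) (integral\<^sup>N lborel v) (integral\<^sup>N lborel w)"
    unfolding powr_mean_le_def
  proof (intro allI impI)
    fix p q :: real
    assume p: "0 < p" "ennreal p < integral\<^sup>N lborel u" and q: "0 < q" "ennreal q < integral\<^sup>N lborel v"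
    obtain m1 where m1: "ennreal p < (\<integral>\<^sup>+x. cut u m1 x \<partial>lborel)"
      using p int[of u] by (auto simp: less_SUP_iff)
    obtain m2 where m2: "ennreal q < (\<integral>\<^sup>+x. cut v m2 x \<partial>lborel)"
      using q int[of v] by (auto simp: less_SUP_iff)
    define n where "n = max m1 m2"
    have up: "(\<integral>\<^sup>+x. cut f m x \<partial>lborel) \<le> (\<integral>\<^sup>+x. cut f n x \<partial>lborel)" if "m \<le> n" for f m
      using incseqD[OF mono that, of f] by (intro nn_integral_mono) (simp add: le_fun_def)
    have "powr_mean_le t (\<integral>\<^sup>+x. cut u n x \<partial>lborel) (\<integral>\<^sup>+x. cut v n x \<partial>lborel) (\<integral>\<^sup>+x. w x \<partial>lborel)"
    proof (rule prekopa_leindler_line_bounded[OF t, where k="real n"])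
      have le_n: "cut f n x \<le> real n" for f x
      proof -
        have "ennreal (cut f n x) \<le> ennreal (real n)" unfolding cut_eq by (simp add: ennreal_of_nat_eq_real_of_nat)
        then show ?thesis by (simp add: ennreal_le_iff)
      qed
      show "cut u n x \<le> real n" "cut v n x \<le> real n" for x by (rule le_n)+
      show "cut u n x = 0" "cut v n x = 0" if "real n < \<bar>x\<bar>" for x
        using that by (auto simp: cut_def indicator_def)
      fix x y
      have "ennreal (cut u n x) \<le> u x" "ennreal (cut v n y) \<le> v y" unfolding cut_eq by auto
      then show "powr_mean_le t (cut u n x) (cut v n y) (w (t * x + (1 - t) * y))"
        using le unfolding powr_mean_le_def by (auto intro: order.strict_trans2)
    qed (auto simp: cut_def)
    then show "ennreal (p powr t * q powr (1 - t)) \<le> integral\<^sup>N lborel w"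
      using p(1) q(1) order.strict_trans2[OF m1 up] order.strict_trans2[OF m2 up]
      unfolding powr_mean_le_def n_def by auto
  qed
qed

text \<open>The inequality on \<open>M2\<close>, applied to sections over fixed first coordinates,
  is exactly the pointwise hypothesis for the marginals on \<open>M1\<close>.\<close>

lemma prekopa_leindler_pair:
  assumes "prekopa_leindler t M1 comb1" "prekopa_leindler t M2 comb2"
    and "sigma_finite_measure M2"
    and c1: "\<And>x y. x \<in> space M1 \<Longrightarrow> y \<in> space M1 \<Longrightarrow> comb1 x y \<in> space M1"
  shows "prekopa_leindler t (M1 \<Otimes>\<^sub>M M2) (\<lambda>x y. (comb1 (fst x) (fst y), comb2 (snd x) (snd y)))"
  unfolding prekopa_leindler_def
proof (intro ballI impI)
  interpret M2: sigma_finite_measure M2 by fact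
  fix u v w :: "_ \<Rightarrow> ennreal"
  assume [measurable]: "u \<in> borel_measurable (M1 \<Otimes>\<^sub>M M2)" "v \<in> borel_measurable (M1 \<Otimes>\<^sub>M M2)"
    "w \<in> borel_measurable (M1 \<Otimes>\<^sub>M M2)"
  assume le: "\<forall>x\<in>space (M1 \<Otimes>\<^sub>M M2). \<forall>y\<in>space (M1 \<Otimes>\<^sub>M M2).
    powr_mean_le t (u x) (v y) (w (comb1 (fst x) (fst y), comb2 (snd x) (snd y)))"
  have "powr_mean_le t (\<integral>\<^sup>+x. \<integral>\<^sup>+y. u (x, y) \<partial>M2 \<partial>M1) (\<integral>\<^sup>+x. \<integral>\<^sup>+y. v (x, y) \<partial>M2 \<partial>M1)
      (\<integral>\<^sup>+x. \<integral>\<^sup>+y. w (x, y) \<partial>M2 \<partial>M1)"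
  proof (rule prekopa_leindlerD[OF assms(1)])
    fix x y assume xy[measurable]: "x \<in> space M1" "y \<in> space M1"
    note [measurable] = c1[OF xy]
    show "powr_mean_le t (\<integral>\<^sup>+z. u (x, z) \<partial>M2) (\<integral>\<^sup>+z. v (y, z) \<partial>M2) (\<integral>\<^sup>+z. w (comb1 x y, z) \<partial>M2)"
      by (rule prekopa_leindlerD[OF assms(2)]) (use le xy in \<open>auto simp: space_pair_measure\<close>)
  qed measurable
  then show "powr_mean_le t (integral\<^sup>N (M1 \<Otimes>\<^sub>M M2) u) (integral\<^sup>N (M1 \<Otimes>\<^sub>M M2) v) (integral\<^sup>N (M1 \<Otimes>\<^sub>M M2) w)"
    by (simp add: M2.nn_integral_fst)
qed

text \<open>The argument for pairs, iterated: integrate out the new coordinate with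
  \<open>PL\<close> and hand the marginals to the induction hypothesis. The empty product is a
  single point, where integrals are values.\<close>

lemma prekopa_leindler_PiM:
  assumes "finite I" and "sigma_finite_measure M"
    and PL: "prekopa_leindler t M comb"
    and comb: "\<And>x y. x \<in> space M \<Longrightarrow> y \<in> space M \<Longrightarrow> comb x y \<in> space M"
  shows "prekopa_leindler t (Pi\<^sub>M I (\<lambda>_. M)) (\<lambda>x y. \<lambda>i\<in>I. comb (x i) (y i))"
  using assms(1)
proof (induction I)
  case empty
  show ?case
    unfolding prekopa_leindler_def by (auto simp: space_PiM_empty PiM_empty nn_integral_count_space_finite)
next
  case (insert i I)
  interpret product_sigma_finite "\<lambda>_. M" using assms(2) by (simp add: product_sigma_finite_def)
  show ?case
    unfolding prekopa_leindler_def
  proof (intro ballI impI)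
    fix u v w :: "_ \<Rightarrow> ennreal"
    assume [measurable]: "u \<in> borel_measurable (Pi\<^sub>M (insert i I) (\<lambda>_. M))"
      "v \<in> borel_measurable (Pi\<^sub>M (insert i I) (\<lambda>_. M))" "w \<in> borel_measurable (Pi\<^sub>M (insert i I) (\<lambda>_. M))"
    assume le: "\<forall>x\<in>space (Pi\<^sub>M (insert i I) (\<lambda>_. M)). \<forall>y\<in>space (Pi\<^sub>M (insert i I) (\<lambda>_. M)).
      powr_mean_le t (u x) (v y) (w (\<lambda>j\<in>insert i I. comb (x j) (y j)))"
    have m: "(\<lambda>y. f (x(i := y))) \<in> borel_measurable M"
      if [measurable]: "f \<in> borel_measurable (Pi\<^sub>M (insert i I) (\<lambda>_. M))" "x \<in> space (Pi\<^sub>M I (\<lambda>_. M))"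
      for x and f :: "_ \<Rightarrow> ennreal"
      by measurable
    have m2: "(\<lambda>x. \<integral>\<^sup>+y. f (x(i := y)) \<partial>M) \<in> borel_measurable (Pi\<^sub>M I (\<lambda>_. M))"
      if [measurable]: "f \<in> borel_measurable (Pi\<^sub>M (insert i I) (\<lambda>_. M))" for f :: "_ \<Rightarrow> ennreal"
      by measurable
    have "powr_mean_le t (\<integral>\<^sup>+x. \<integral>\<^sup>+y. u (x(i := y)) \<partial>M \<partial>Pi\<^sub>M I (\<lambda>_. M))
        (\<integral>\<^sup>+x. \<integral>\<^sup>+y. v (x(i := y)) \<partial>M \<partial>Pi\<^sub>M I (\<lambda>_. M))
        (\<integral>\<^sup>+x. \<integral>\<^sup>+y. w (x(i := y)) \<partial>M \<partial>Pi\<^sub>M I (\<lambda>_. M))"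
    proof (rule prekopa_leindlerD[OF insert.IH])
      fix x y assume xy: "x \<in> space (Pi\<^sub>M I (\<lambda>_. M))" "y \<in> space (Pi\<^sub>M I (\<lambda>_. M))"
      then have z: "(\<lambda>j\<in>I. comb (x j) (y j)) \<in> space (Pi\<^sub>M I (\<lambda>_. M))"
        by (auto simp: space_PiM PiE_iff intro!: comb)
      show "powr_mean_le t (\<integral>\<^sup>+z. u (x(i := z)) \<partial>M) (\<integral>\<^sup>+z. v (y(i := z)) \<partial>M)
          (\<integral>\<^sup>+z. w ((\<lambda>j\<in>I. comb (x j) (y j))(i := z)) \<partial>M)"
      proof (rule prekopa_leindlerD[OF PL])
        fix a b assume ab: "a \<in> space M" "b \<in> space M"
        have eq: "(\<lambda>j\<in>I. comb (x j) (y j))(i := comb a b)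
            = (\<lambda>j\<in>insert i I. comb ((x(i := a)) j) ((y(i := b)) j))"
          using insert.hyps by (auto simp: fun_eq_iff)
        have "x(i := a) \<in> space (Pi\<^sub>M (insert i I) (\<lambda>_. M))"
          "y(i := b) \<in> space (Pi\<^sub>M (insert i I) (\<lambda>_. M))"
          using xy ab by (auto simp: space_PiM PiE_iff extensional_def)
        then show "powr_mean_le t (u (x(i := a))) (v (y(i := b)))
            (w ((\<lambda>j\<in>I. comb (x j) (y j))(i := comb a b)))"
          unfolding eq by (rule le[rule_format])
      qed (use m xy z in auto)
    qed (use m2 in auto)
    then show "powr_mean_le t (integral\<^sup>N (Pi\<^sub>M (insert i I) (\<lambda>_. M)) u)
        (integral\<^sup>N (Pi\<^sub>M (insert i I) (\<lambda>_. M)) v) (integral\<^sup>N (Pi\<^sub>M (insert i I) (\<lambda>_. M)) w)"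
      using insert.hyps by (simp add: product_nn_integral_insert)
  qed
qed

text \<open>Strictness is removed by testing with \<open>a * r\<close> and \<open>b * r\<close> and
  letting \<open>r\<close> tend to 1 from below.\<close>

lemma powr_mean_le_real:
  assumes "powr_mean_le t (ennreal a) (ennreal b) (ennreal c)" "0 < a" "0 < b" "0 \<le> c"
  shows "a powr t * b powr (1 - t) \<le> c"
proof (rule tendsto_upperbound)
  show "\<forall>\<^sub>F r in at_left 1. (a * r) powr t * (b * r) powr (1 - t) \<le> c"
  proof -
    have "\<forall>\<^sub>F r in at_left 1. r \<in> {0<..<1::real}"
      by (rule eventually_at_left_real) simp
    then show ?thesis
    proof eventually_elim
      case (elim r)
      then have "ennreal (a * r) < ennreal a" "ennreal (b * r) < ennreal b"
        using assms by (auto simp: ennreal_less_iff)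
      then have "ennreal ((a * r) powr t * (b * r) powr (1 - t)) \<le> ennreal c"
        using assms elim unfolding powr_mean_le_def by auto
      then show ?case using assms(4) by (simp add: ennreal_le_iff)
    qed
  qed
  have "((\<lambda>r. (a * r) powr t * (b * r) powr (1 - t)) \<longlongrightarrow> (a * 1) powr t * (b * 1) powr (1 - t)) (at_left 1)"
    using assms by (intro tendsto_intros) auto
  then show "((\<lambda>r. (a * r) powr t * (b * r) powr (1 - t)) \<longlongrightarrow> a powr t * b powr (1 - t)) (at_left 1)"
    by simp
qed simp


section \<open>Trigonometric sums on the circle\<close>

lemma circle_eq_density:
  "circle = density lborel (\<lambda>x. ennreal (indicator {0..<2*pi} x / (2*pi)))"
  unfolding circle_def uniform_measure_def
  by (rule density_cong) (auto simp: indicator_def divide_ennreal simp flip: ennreal_1)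

lemma integral_circle_eq:
  fixes f :: "real \<Rightarrow> 'a::euclidean_space"
  assumes [measurable]: "f \<in> borel_measurable borel"
  shows "(LINT x|circle. f x) = (1 / (2*pi)) *\<^sub>R (LINT x:{0..2*pi}|lborel. f x)"
proof -
  have "(LINT x|circle. f x) = (LINT x|lborel. (indicator {0..<2*pi} x / (2*pi)) *\<^sub>R f x)"
    unfolding circle_eq_density by (rule integral_density) auto
  also have "\<dots> = (LINT x|lborel. (1 / (2*pi)) *\<^sub>R (indicator {0..<2*pi} x *\<^sub>R f x))"
    by (intro Bochner_Integration.integral_cong) (auto simp: indicator_def)
  also have "\<dots> = (1 / (2*pi)) *\<^sub>R (LINT x|lborel. indicator {0..<2*pi} x *\<^sub>R f x)"
    by (rule integral_scaleR_right)
  also have "(LINT x|lborel. indicator {0..<2*pi} x *\<^sub>R f x) = (LINT x|lborel. indicator {0..2*pi} x *\<^sub>R f x)"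
  proof (rule integral_cong_AE)
    show "AE x in lborel. indicator {0..<2*pi} x *\<^sub>R f x = indicator {0..2*pi} x *\<^sub>R f x"
      using AE_lborel_singleton[of "2*pi"] by eventually_elim (auto simp: indicator_def)
  qed measurable
  finally show ?thesis by (simp add: set_lebesgue_integral_def)
qed

interpretation circle: finite_measure circle
  by (rule finite_measure_circle)

lemma measure_circle_UNIV [simp]: "measure circle UNIV = 1"
  using emeasure_circle_UNIV by (simp add: measure_def)

lemma borel_measurable_cis [measurable]: "(\<lambda>x. cis (f x)) \<in> borel_measurable M"
  if [measurable]: "f \<in> borel_measurable M"
  unfolding cis_conv_exp by measurable

lemma integrable_circle_bounded:
  fixes f :: "real \<Rightarrow> 'a::{banach, second_countable_topology}"
  assumes [measurable]: "f \<in> borel_measurable borel" and "\<And>x. norm (f x) \<le> B"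
  shows "integrable circle f"
  by (rule circle.integrable_const_bound[of _ B]) (use assms in auto)

lemma integral_circle_cis:
  "(LINT x|circle. cis (of_int n * x)) = (if n = 0 then 1 else 0)"
proof (cases "n = 0")
  case True
  then show ?thesis by simp
next
  case False
  have "((\<lambda>x. cis (of_int n * x)) has_integral
     (cis (of_int n * (2*pi)) / (\<i> * of_int n) - cis (of_int n * 0) / (\<i> * of_int n))) {0..2*pi}"
  proof (rule fundamental_theorem_of_calculus)
    fix x :: real
    have "((\<lambda>z. exp (\<i> * of_int n * z) / (\<i> * of_int n)) has_field_derivative exp (\<i> * of_int n * of_real x))
        (at (of_real x))"
      by (rule derivative_eq_intros refl | simp add: False)+
    then have "((\<lambda>x. exp (\<i> * of_int n * complex_of_real x) / (\<i> * of_int n)) has_vector_derivative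
        exp (\<i> * of_int n * of_real x)) (at x within {0..2*pi})"
      by (rule has_vector_derivative_real_field)
    then show "((\<lambda>x. cis (of_int n * x) / (\<i> * of_int n)) has_vector_derivative
        cis (of_int n * x)) (at x within {0..2*pi})" by (simp add: cis_conv_exp mult.assoc)
  qed simp
  moreover have "cis (of_int n * (2*pi)) = 1"
    using cis_multiple_2pi[of "of_int n"] by (simp add: mult.commute)
  ultimately have "((\<lambda>x. cis (of_int n * x)) has_integral 0) {0..2*pi}" by simp
  moreover have "set_integrable lborel {0..2*pi} (\<lambda>x. cis (of_int n * x))"
    by (rule borel_integrable_atLeastAtMost') (intro continuous_intros)
  ultimately have "(LINT x:{0..2*pi}|lborel. cis (of_int n * x)) = 0"
    using set_borel_integral_eq_integral(2) by (metis integral_unique)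
  then show ?thesis using False by (simp add: integral_circle_eq)
qed

lemma integral_norm_trig_sum:
  fixes c :: "int \<Rightarrow> complex"
  assumes "finite I"
  shows "(LINT x|circle. (cmod (\<Sum>n\<in>I. c n * cis (of_int n * x)))\<^sup>2) = (\<Sum>n\<in>I. (cmod (c n))\<^sup>2)"
proof -
  have "complex_of_real (LINT x|circle. (cmod (\<Sum>n\<in>I. c n * cis (of_int n * x)))\<^sup>2)
      = (LINT x|circle. complex_of_real ((cmod (\<Sum>n\<in>I. c n * cis (of_int n * x)))\<^sup>2))"
    by (rule integral_complex_of_real[symmetric])
  also have "\<dots> = (LINT x|circle. (\<Sum>n\<in>I. \<Sum>m\<in>I. c n * cnj (c m) * cis (of_int (n - m) * x)))"
  proof (rule Bochner_Integration.integral_cong[OF refl])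
    fix x
    have "complex_of_real ((cmod (\<Sum>n\<in>I. c n * cis (of_int n * x)))\<^sup>2)
      = (\<Sum>n\<in>I. c n * cis (of_int n * x)) * (\<Sum>m\<in>I. cnj (c m) * cis (- (of_int m * x)))"
      by (simp only: complex_norm_square) (simp add: cis_cnj)
    also have "\<dots> = (\<Sum>n\<in>I. \<Sum>m\<in>I. c n * cnj (c m) * (cis (of_int n * x) * cis (- (of_int m * x))))"
      by (simp add: sum_product mult_ac)
    finally show "complex_of_real ((cmod (\<Sum>n\<in>I. c n * cis (of_int n * x)))\<^sup>2)
      = (\<Sum>n\<in>I. \<Sum>m\<in>I. c n * cnj (c m) * cis (of_int (n - m) * x))"
      by (simp add: cis_mult algebra_simps)
  qed
  also have "\<dots> = (\<Sum>n\<in>I. \<Sum>m\<in>I. c n * cnj (c m) * (LINT x|circle. cis (of_int (n - m) * x)))"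
    by (subst Bochner_Integration.integral_sum Bochner_Integration.integral_mult_right_zero,
        (intro Bochner_Integration.integrable_sum integrable_mult_right integrable_circle_bounded[where B=1];
         simp))+ simp
  also have "\<dots> = (\<Sum>n\<in>I. \<Sum>m\<in>I. (if n = m then c n * cnj (c m) else 0))"
    unfolding integral_circle_cis by (intro sum.cong) auto
  also have "\<dots> = complex_of_real (\<Sum>n\<in>I. (cmod (c n))\<^sup>2)"
    using assms by (simp add: complex_norm_square del: of_real_power)
  finally show ?thesis using of_real_eq_iff by blast
qed

text \<open>The telescoping remainder makes the induction go through, by
  \<open>1/(n+1)^2 \<le> 1/n - 1/(n+1)\<close>; \<open>max 1 n\<close> keeps it meaningful for the
  empty sum.\<close>

lemma sum_inverse_squares_nat: "(\<Sum>k=1..n. 1 / (real k)\<^sup>2) \<le> 2 - 1 / real (max 1 n)"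
proof (induction n)
  case (Suc n)
  show ?case
  proof (cases "n = 0")
    case False
    have "1 / (real (Suc n))\<^sup>2 \<le> 1 / real n - 1 / real (Suc n)"
    proof -
      have "1 / real n - 1 / real (Suc n) = 1 / (real n * real (Suc n))" using False by (simp add: field_simps)
      moreover have "1 / (real (Suc n))\<^sup>2 \<le> 1 / (real n * real (Suc n))"
        using False by (intro frac_le) (auto simp: power2_eq_square)
      ultimately show ?thesis by simp
    qed
    then show ?thesis using Suc False by (simp add: max_def split: if_splits)
  qed simp
qed simp

text \<open>Each sign contributes at most 2. The full sum is \<open>pi^2 / 3\<close>; the value 4
  has an integer square root, which becomes the factor 2 in later bounds.\<close>

lemma sum_inverse_squares_int:
  assumes "finite I" "0 \<notin> I"
  shows "(\<Sum>k\<in>I. 1 / (real_of_int k)\<^sup>2) \<le> 4"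
proof -
  obtain n where n: "\<And>k. k \<in> I \<Longrightarrow> nat \<bar>k\<bar> \<le> n"
    using finite_nat_set_iff_bounded_le[of "(\<lambda>k. nat \<bar>k\<bar>) ` I"] assms by auto
  have two: "(\<Sum>k=1..n. 1 / (real k)\<^sup>2) \<le> 2"
    using sum_inverse_squares_nat[of n] by (smt (verit) divide_nonneg_nonneg of_nat_0_le_iff)
  have "(\<Sum>k\<in>I. 1 / (real_of_int k)\<^sup>2)
      \<le> (\<Sum>k\<in>int ` {1..n} \<union> (\<lambda>k. - int k) ` {1..n}. 1 / (real_of_int k)\<^sup>2)"
  proof (rule sum_mono2)
    show "I \<subseteq> int ` {1..n} \<union> (\<lambda>k. - int k) ` {1..n}"
    proof
      fix k assume k: "k \<in> I"
      then have "k = int (nat \<bar>k\<bar>) \<or> k = - int (nat \<bar>k\<bar>)" "nat \<bar>k\<bar> \<in> {1..n}"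
        using n[OF k] assms(2) by (auto simp: le_Suc_eq Suc_le_eq)
      then show "k \<in> int ` {1..n} \<union> (\<lambda>k. - int k) ` {1..n}" by blast
    qed
  qed auto
  also have "\<dots> \<le> (\<Sum>k\<in>int ` {1..n}. 1 / (real_of_int k)\<^sup>2)
     + (\<Sum>k\<in>(\<lambda>k. - int k) ` {1..n}. 1 / (real_of_int k)\<^sup>2)"
    by (subst sum_Un) (auto intro!: sum_nonneg)
  also have "\<dots> = 2 * (\<Sum>k=1..n. 1 / (real k)\<^sup>2)"
    by (subst (1 2) sum.reindex) (auto simp: inj_on_def)
  finally show ?thesis using two by linarith
qed

text \<open>The \<open>m\<close>-th coefficient of the square is a convolution; Cauchy--Schwarz with the weights
  \<open>\<bar>k\<bar> \<bar>l\<bar>\<close> over \<open>k + l = m\<close> leaves the kernel \<open>1 / (\<bar>k\<bar> \<bar>l\<bar>)\<close>, which is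
  summable uniformly in \<open>m\<close>.\<close>

lemma trig_sum_L4_bound:
  fixes c :: "int \<Rightarrow> complex"
  assumes I: "finite I" "0 \<notin> I"
  shows "(LINT x|circle. (cmod (\<Sum>n\<in>I. c n * cis (of_int n * x))) ^ 4)
    \<le> 4 * (\<Sum>n\<in>I. \<bar>of_int n\<bar> * (cmod (c n))\<^sup>2)\<^sup>2"
proof -
  define e where "e k = \<bar>of_int k\<bar> * (cmod (c k))\<^sup>2" for k
  define J where "J = (\<lambda>(k, l). k + l) ` (I \<times> I)"
  define P where "P m = {p \<in> I \<times> I. (case p of (k, l) \<Rightarrow> k + l) = m}" for m
  define d where "d m = (\<Sum>(k, l)\<in>P m. c k * c l)" for m
  have fin: "finite J" "finite (P m)" for m using I by (auto simp: J_def P_def)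
  have sq: "(\<Sum>n\<in>I. c n * cis (of_int n * x))\<^sup>2 = (\<Sum>m\<in>J. d m * cis (of_int m * x))" for x
  proof -
    have "(\<Sum>n\<in>I. c n * cis (of_int n * x))\<^sup>2
        = (\<Sum>(k, l)\<in>I \<times> I. c k * c l * cis (of_int (k + l) * x))"
      by (simp add: power2_eq_square sum_product sum.cartesian_product algebra_simps flip: cis_mult)
    also have "\<dots> = (\<Sum>m\<in>J. \<Sum>(k, l)\<in>P m. c k * c l * cis (of_int (k + l) * x))"
      unfolding J_def P_def using I by (intro sum.image_gen) auto
    also have "\<dots> = (\<Sum>m\<in>J. d m * cis (of_int m * x))"
      unfolding d_def sum_distrib_right by (intro sum.cong) (auto simp: P_def)
    finally show ?thesis .
  qed
  have dm: "(cmod (d m))\<^sup>2 \<le> 4 * (\<Sum>(k, l)\<in>P m. e k * e l)" for m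
  proof -
    let ?w = "\<lambda>p :: int \<times> int. sqrt (\<bar>of_int (fst p)\<bar> * \<bar>of_int (snd p)\<bar>) :: real"
    let ?a = "\<lambda>p. cmod (c (fst p)) * cmod (c (snd p))"
    have nz: "k \<noteq> 0 \<and> l \<noteq> 0" if "(k, l) \<in> P m" for k l using that I by (auto simp: P_def)
    have "cmod (d m) \<le> (\<Sum>p\<in>P m. ?a p)"
      unfolding d_def by (rule order.trans[OF norm_sum]) (simp add: norm_mult split_beta)
    also have "\<dots> = (\<Sum>p\<in>P m. (?w p * ?a p)
        * (1 / ?w p))"
      by (intro sum.cong refl) (use nz in force)
    finally have "(cmod (d m))\<^sup>2 \<le> (\<Sum>p\<in>P m. (?w p * ?a p)
        * (1 / ?w p))\<^sup>2"
      by (intro power_mono) auto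
    also have "\<dots> \<le> (\<Sum>p\<in>P m. (?w p * ?a p)\<^sup>2)
        * (\<Sum>p\<in>P m. (1 / ?w p)\<^sup>2)"
      by (rule Cauchy_Schwarz_ineq_sum)
    also have "\<dots> \<le> (\<Sum>p\<in>P m. (?w p * ?a p)\<^sup>2) * 4"
    proof (rule mult_left_mono)
      \<comment> \<open>The arithmetic-geometric mean inequality separates the two
        frequencies.\<close>
      have "(\<Sum>p\<in>P m. (1 / ?w p)\<^sup>2)
         \<le> (\<Sum>p\<in>P m. (1 / (of_int (fst p))\<^sup>2 + 1 / (of_int (snd p))\<^sup>2) / 2)"
      proof (rule sum_mono)
        fix p assume "p \<in> P m"
        have "(1 / ?w p)\<^sup>2
            = (1 / \<bar>real_of_int (fst p)\<bar>) * (1 / \<bar>real_of_int (snd p)\<bar>)"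
          by (simp add: power_divide)
        also have "\<dots> \<le> ((1 / \<bar>real_of_int (fst p)\<bar>)\<^sup>2 + (1 / \<bar>real_of_int (snd p)\<bar>)\<^sup>2) / 2"
          using sum_squares_bound[of "1 / \<bar>real_of_int (fst p)\<bar>" "1 / \<bar>real_of_int (snd p)\<bar>"] by simp
        also have "\<dots> = (1 / (of_int (fst p))\<^sup>2 + 1 / (of_int (snd p))\<^sup>2) / 2"
          by (simp add: power_divide)
        finally show "(1 / ?w p)\<^sup>2
           \<le> (1 / (real_of_int (fst p))\<^sup>2 + 1 / (real_of_int (snd p))\<^sup>2) / 2" .
      qed
      also have "\<dots> = ((\<Sum>p\<in>P m. 1 / (real_of_int (fst p))\<^sup>2) + (\<Sum>p\<in>P m. 1 / (real_of_int (snd p))\<^sup>2)) / 2"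
        by (simp only: sum.distrib flip: sum_divide_distrib)
      \<comment> \<open>On \<open>k + l = m\<close> either coordinate determines the other, so both
        projections are injective and each sum is at most 4, uniformly in \<open>m\<close>.\<close>
      also have "(\<Sum>p\<in>P m. 1 / (real_of_int (fst p))\<^sup>2) = (\<Sum>k\<in>fst ` P m. 1 / (real_of_int k)\<^sup>2)"
        by (subst sum.reindex) (auto simp: inj_on_def P_def)
      also have "(\<Sum>p\<in>P m. 1 / (real_of_int (snd p))\<^sup>2) = (\<Sum>k\<in>snd ` P m. 1 / (real_of_int k)\<^sup>2)"
        by (subst sum.reindex) (auto simp: inj_on_def P_def)
      also have "((\<Sum>k\<in>fst ` P m. 1 / (real_of_int k)\<^sup>2) + (\<Sum>k\<in>snd ` P m. 1 / (real_of_int k)\<^sup>2)) / 2 \<le> 4"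
        using sum_inverse_squares_int[of "fst ` P m"] sum_inverse_squares_int[of "snd ` P m"] fin(2)[of m] nz
        by force
      finally show "(\<Sum>p\<in>P m. (1 / ?w p)\<^sup>2) \<le> (4::real)" .
    qed (auto intro!: sum_nonneg)
    also have "\<dots> = 4 * (\<Sum>(k, l)\<in>P m. e k * e l)"
      by (simp add: e_def power_mult_distrib split_beta algebra_simps)
    finally show ?thesis .
  qed
  have "(LINT x|circle. (cmod (\<Sum>n\<in>I. c n * cis (of_int n * x))) ^ 4)
      = (LINT x|circle. (cmod (\<Sum>m\<in>J. d m * cis (of_int m * x)))\<^sup>2)"
    by (intro Bochner_Integration.integral_cong refl) (simp add: sq[symmetric] norm_power flip: power_mult)
  also have "\<dots> = (\<Sum>m\<in>J. (cmod (d m))\<^sup>2)" by (rule integral_norm_trig_sum) fact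
  also have "\<dots> \<le> (\<Sum>m\<in>J. 4 * (\<Sum>(k, l)\<in>P m. e k * e l))"
    by (rule sum_mono) (rule dm)
  also have "\<dots> = 4 * (\<Sum>m\<in>J. \<Sum>(k, l)\<in>P m. e k * e l)"
    by (simp add: sum_distrib_left)
  also have "(\<Sum>m\<in>J. \<Sum>(k, l)\<in>P m. e k * e l)
     = (\<Sum>(k, l)\<in>I \<times> I. e k * e l)"
    unfolding J_def P_def using I by (intro sum.image_gen[symmetric]) auto
  also have "\<dots> = (\<Sum>n\<in>I. \<bar>of_int n\<bar> * (cmod (c n))\<^sup>2)\<^sup>2"
    by (simp add: e_def power2_eq_square sum_product sum.cartesian_product)
  finally show ?thesis .
qed


section \<open>Representatives and uniqueness of Fourier coefficients\<close>

lemma L2_rel_refl: "L2_rel f f \<longleftrightarrow> square_integrable f"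
  by (auto simp: L2_rel_def)

lemma square_integrable_rep: "square_integrable (rep_L2 u)"
  using Quotient3_rep_reflp[OF Quotient3_L2, of u] by (simp add: L2_rel_refl)

lemma borel_measurable_rep [measurable]: "rep_L2 u \<in> borel_measurable borel"
  using square_integrable_rep by (rule square_integrable_measurable)

lemma abs_rep_L2: "abs_L2 (rep_L2 u) = u"
  by (rule Quotient3_abs_rep[OF Quotient3_L2])

lemma rep_abs_L2:
  assumes "square_integrable f" shows "AE x in circle. rep_L2 (abs_L2 f) x = f x"
  using Quotient3_rep_abs[OF Quotient3_L2, of f] assms by (simp add: L2_rel_def)

lemma L2_eqI:
  assumes "AE x in circle. rep_L2 u x = rep_L2 v x" shows "u = v"
  using Quotient3_rel_rep[OF Quotient3_L2, of u v] assms square_integrable_rep by (simp add: L2_rel_def)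

lemma rep_add: "AE x in circle. rep_L2 (u + v) x = rep_L2 u x + rep_L2 v x"
proof -
  have "u + v = abs_L2 (\<lambda>x. rep_L2 u x + rep_L2 v x)"
    using plus_L2.abs_eq[of "rep_L2 u" "rep_L2 v"] by (simp add: L2_rel_refl square_integrable_rep abs_rep_L2)
  then show ?thesis
    using rep_abs_L2[OF square_integrable_add[OF square_integrable_rep square_integrable_rep]] by simp
qed

lemma rep_scaleR: "AE x in circle. rep_L2 (a *\<^sub>R u) x = a * rep_L2 u x"
proof -
  have "a *\<^sub>R u = abs_L2 (\<lambda>x. a * rep_L2 u x)"
    using scaleR_L2.abs_eq[of "rep_L2 u" a] by (simp add: L2_rel_refl square_integrable_rep abs_rep_L2)
  then show ?thesis
    using rep_abs_L2[OF square_integrable_scaleR[OF square_integrable_rep]] by simp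
qed

lemma rep_zero: "AE x in circle. rep_L2 0 x = 0"
  using rep_abs_L2[OF square_integrable_zero] by (simp add: zero_L2_def)

lemma rep_sum:
  assumes "finite I" shows "AE x in circle. rep_L2 (\<Sum>i\<in>I. u i) x = (\<Sum>i\<in>I. rep_L2 (u i) x)"
  using assms
proof induction
  case empty
  then show ?case using rep_zero by simp
next
  case (insert i I)
  show ?case using insert.IH rep_add[of "u i" "\<Sum>i\<in>I. u i"] insert.hyps by (auto elim!: eventually_elim2)
qed

lemma inner_L2_eq: "inner u v = (LINT x|circle. rep_L2 u x * rep_L2 v x)"
  using inner_L2.abs_eq[of "rep_L2 u" "rep_L2 v"] by (simp add: L2_rel_refl square_integrable_rep abs_rep_L2)

lemma inner_abs_L2:
  assumes "square_integrable f" "square_integrable g"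
  shows "inner (abs_L2 f) (abs_L2 g) = (LINT x|circle. f x * g x)"
  using inner_L2.abs_eq assms by (simp add: L2_rel_refl)

lemma norm_abs_L2:
  assumes "square_integrable f" shows "(norm (abs_L2 f))\<^sup>2 = (LINT x|circle. (f x)\<^sup>2)"
  unfolding power2_norm_eq_inner using inner_abs_L2[OF assms assms] by (simp only: power2_eq_square)

lemma fourier_eq: "fourier u n = (LINT x|circle. of_real (rep_L2 u x) * cis (- of_int n * x))"
  using fourier.abs_eq[of "rep_L2 u"] by (simp add: L2_rel_refl square_integrable_rep abs_rep_L2)

lemma cubic_integral_eq: "cubic_integral u = (LINT x|circle. (rep_L2 u x) ^ 3)"
  using cubic_integral.abs_eq[of "rep_L2 u"] by (simp add: L2_rel_refl square_integrable_rep abs_rep_L2)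

section \<open>Functions with vanishing Fourier coefficients are null\<close>

lemma square_integrable_imp_integrable:
  assumes "square_integrable f" shows "integrable circle f"
  using square_integrable_mult[OF assms square_integrable_bounded[of "\<lambda>_. 1" 1]] by simp

lemma integrable_mult_bounded:
  fixes f g :: "real \<Rightarrow> 'a::{real_normed_algebra, banach, second_countable_topology}"
  assumes f: "integrable circle f" and [measurable]: "g \<in> borel_measurable borel"
    and B: "\<And>x. norm (g x) \<le> B"
  shows "integrable circle (\<lambda>x. f x * g x)"
proof (rule Bochner_Integration.integrable_bound)
  show "integrable circle (\<lambda>x. B * norm (f x))" using f by auto
  show "(\<lambda>x. f x * g x) \<in> borel_measurable circle" using f by measurable
  have "0 \<le> B" using B[of 0] norm_ge_zero order_trans by blast
  have "norm (f x * g x) \<le> norm (B * norm (f x))" for x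
  proof -
    have "norm (f x * g x) \<le> norm (f x) * norm (g x)" by (rule norm_mult_ineq)
    also have "\<dots> \<le> norm (f x) * B" by (intro mult_left_mono B) auto
    finally show ?thesis using \<open>0 \<le> B\<close> by (simp add: mult.commute)
  qed
  then show "AE x in circle. norm (f x * g x) \<le> norm (B * norm (f x))" by auto
qed

lemma integrable_mult_cis:
  assumes "integrable circle f"
  shows "integrable circle (\<lambda>x. of_real (f x) * cis (a * x))"
  by (rule integrable_mult_bounded[where B=1]) (use assms in auto)

text \<open>A property of plain integrable functions rather than of elements of \<open>L2\<close>:
  it is stable under multiplication by trigonometric polynomials, which drives the uniqueness
  proof.\<close>

definition fourier_null :: "(real \<Rightarrow> real) \<Rightarrow> bool" where
  "fourier_null f \<longleftrightarrow> integrable circle f \<and>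
     (\<forall>n::int. (LINT x|circle. of_real (f x) * cis (- of_int n * x)) = 0)"

lemma fourier_null_add:
  assumes "fourier_null f" "fourier_null g" shows "fourier_null (\<lambda>x. f x + g x)"
  unfolding fourier_null_def
proof safe
  show "integrable circle (\<lambda>x. f x + g x)" using assms by (simp add: fourier_null_def)
  fix n :: int
  have "(LINT x|circle. of_real (f x + g x) * cis (- of_int n * x))
    = (LINT x|circle. of_real (f x) * cis (- of_int n * x))
      + (LINT x|circle. of_real (g x) * cis (- of_int n * x))"
    unfolding of_real_add distrib_right
    by (intro Bochner_Integration.integral_add integrable_mult_cis) (use assms in \<open>auto simp: fourier_null_def\<close>)
  then show "(LINT x|circle. of_real (f x + g x) * cis (- of_int n * x)) = 0"
    using assms unfolding fourier_null_def by simp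
qed

lemma fourier_null_cmult: "fourier_null f \<Longrightarrow> fourier_null (\<lambda>x. f x * c)"
  unfolding fourier_null_def by (auto simp: mult.commute[of _ "complex_of_real c"] mult.assoc)

text \<open>Multiplication by \<open>cis x\<close> or \<open>cis (- x)\<close> shifts frequencies by
  one, so each coefficient of the product is a combination of two vanishing ones.\<close>

lemma fourier_null_Re_cis:
  assumes f: "fourier_null f" shows "fourier_null (\<lambda>x. f x * Re (w * cis x))"
  unfolding fourier_null_def
proof safe
  have int: "integrable circle f" using f by (simp add: fourier_null_def)
  then show "integrable circle (\<lambda>x. f x * Re (w * cis x))"
    by (rule integrable_mult_bounded[where B="cmod w"])
       (auto intro: order.trans[OF abs_Re_le_cmod] simp: norm_mult simp del: times_complex.sel)
  fix n :: int
  have "of_real (f x * Re (w * cis x)) * cis (- of_int n * x)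
      = (w * (of_real (f x) * cis (- of_int (n - 1) * x))
        + cnj w * (of_real (f x) * cis (- of_int (n + 1) * x))) / 2" for x
  proof -
    have e: "cis (- of_int (n - 1) * x) = cis (- of_int n * x) * cis x"
      "cis (- of_int (n + 1) * x) = cis (- of_int n * x) * cis (- x)"
      by (simp_all add: cis_mult algebra_simps)
    have re: "complex_of_real (Re (w * cis x)) = (w * cis x + cnj w * cis (- x)) / 2"
      by (simp add: complex_eq_iff)
    show ?thesis
      unfolding e of_real_mult re by (simp add: field_simps del: mult_minus_left)
  qed
  then have "(LINT x|circle. of_real (f x * Re (w * cis x)) * cis (- of_int n * x))
    = (w * (LINT x|circle. of_real (f x) * cis (- of_int (n - 1) * x))
      + cnj w * (LINT x|circle. of_real (f x) * cis (- of_int (n + 1) * x))) / 2"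
    by (simp only: integral_divide_zero integral_mult_right_zero
        Bochner_Integration.integral_add[OF integrable_mult_right[OF integrable_mult_cis[OF int]]
          integrable_mult_right[OF integrable_mult_cis[OF int]]])
  moreover have "(LINT x|circle. of_real (f x) * cis (- of_int m * x)) = 0" for m
    using f unfolding fourier_null_def by blast
  ultimately show "(LINT x|circle. of_real (f x * Re (w * cis x)) * cis (- of_int n * x)) = 0"
    by (simp only: mult_zero_right add_0 div_0)
qed

text \<open>A trigonometric polynomial is a real polynomial in the point \<open>cis x\<close> of the
  plane. \<open>f\<close> is arbitrary in the induction because a product is treated by absorbing
  its first factor into \<open>f\<close>.\<close>

lemma fourier_null_polynomial:
  fixes p :: "complex \<Rightarrow> real"
  assumes "real_polynomial_function p" "fourier_null f"
  shows "fourier_null (\<lambda>x. f x * p (cis x))"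
  using assms
proof (induction arbitrary: f)
  case (linear L)
  interpret L: bounded_linear L by fact
  \<comment> \<open>A real-linear functional on the plane is determined by its values at 1 and at
    the imaginary unit; this is its representation as the real part of a complex multiple.\<close>
  have "L (cis x) = Re (Complex (L 1) (- L \<i>) * cis x)" for x
  proof -
    have "cis x = cos x *\<^sub>R 1 + sin x *\<^sub>R \<i>" by (simp add: complex_eq_iff)
    then have "L (cis x) = cos x * L 1 + sin x * L \<i>" by (simp only: L.add L.scaleR) simp
    then show ?thesis by (simp add: algebra_simps)
  qed
  then show ?case using fourier_null_Re_cis[OF linear(2), of "Complex (L 1) (- L \<i>)"] by (simp only:)
next
  case (const c)
  then show ?case by (rule fourier_null_cmult)
next
  case (add p q)
  then show ?case by (simp add: distrib_left fourier_null_add)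
next
  case (mult p q)
  have "fourier_null (\<lambda>x. (f x * p (cis x)) * q (cis x))" by (intro mult)
  then show ?case by (simp add: mult.assoc)
qed

text \<open>Stone--Weierstrass on the unit circle of the plane, where periodicity is built in: the
  integral is at most \<open>e\<close> times the \<open>L1\<close> norm of \<open>f\<close>, for
  every \<open>e\<close>.\<close>

lemma fourier_null_continuous:
  fixes \<phi> :: "complex \<Rightarrow> real"
  assumes f: "fourier_null f" and cont: "continuous_on UNIV \<phi>"
  shows "(LINT x|circle. f x * \<phi> (cis x)) = 0"
proof -
  have int: "integrable circle f" using f by (simp add: fourier_null_def)
  have le: "\<bar>LINT x|circle. f x * \<phi> (cis x)\<bar> \<le> e * (LINT x|circle. \<bar>f x\<bar>)" if "e > 0" for e
  proof -
    obtain p where p: "real_polynomial_function p" "\<And>z. z \<in> sphere 0 1 \<Longrightarrow> \<bar>\<phi> z - p z\<bar> < e"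
      using Stone_Weierstrass_real_polynomial_function[of "sphere 0 1" \<phi> e] cont \<open>e > 0\<close>
      by (metis compact_sphere continuous_on_subset top_greatest)
    have pe: "\<bar>\<phi> (cis x) - p (cis x)\<bar> \<le> e" for x using p(2)[of "cis x"] by simp
    have [measurable]: "\<phi> \<in> borel_measurable borel" by (rule borel_measurable_continuous_onI[OF cont])
    have "polynomial_function p" using p(1) by (simp add: real_polynomial_function_eq)
    then have [measurable]: "p \<in> borel_measurable borel"
      by (intro borel_measurable_continuous_onI continuous_on_polymonial_function)
    have null: "fourier_null (\<lambda>x. f x * p (cis x))" by (rule fourier_null_polynomial[OF p(1) f])
    then have "(LINT x|circle. of_real (f x * p (cis x)) * cis (- of_int 0 * x)) = 0"
      unfolding fourier_null_def by blast
    then have zero: "(LINT x|circle. f x * p (cis x)) = 0"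
      by (simp del: of_real_mult)
    have i1: "integrable circle (\<lambda>x. f x * p (cis x))" using null by (simp add: fourier_null_def)
    have i2: "integrable circle (\<lambda>x. f x * (\<phi> (cis x) - p (cis x)))"
      by (rule integrable_mult_bounded[OF int, where B=e]) (use pe in auto)
    have "(LINT x|circle. f x * \<phi> (cis x)) = (LINT x|circle. f x * p (cis x) + f x * (\<phi> (cis x) - p (cis x)))"
      by (simp add: algebra_simps)
    also have "\<dots> = (LINT x|circle. f x * (\<phi> (cis x) - p (cis x)))"
      using i1 i2 zero by simp
    finally have "\<bar>LINT x|circle. f x * \<phi> (cis x)\<bar> \<le> (LINT x|circle. \<bar>f x * (\<phi> (cis x) - p (cis x))\<bar>)"
      by simp
    also have "\<dots> \<le> (LINT x|circle. e * \<bar>f x\<bar>)"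
    proof (rule integral_mono)
      show "\<bar>f x * (\<phi> (cis x) - p (cis x))\<bar> \<le> e * \<bar>f x\<bar>" for x
        using mult_left_mono[OF pe[of x] abs_ge_zero[of "f x"]] by (simp add: abs_mult mult.commute)
    qed (use i2 int in \<open>auto intro: integrable_abs\<close>)
    finally show ?thesis by simp
  qed
  show ?thesis
  proof (rule ccontr)
    assume "(LINT x|circle. f x * \<phi> (cis x)) \<noteq> 0"
    then have pos: "0 < \<bar>LINT x|circle. f x * \<phi> (cis x)\<bar>" by simp
    have nn: "0 \<le> (LINT x|circle. \<bar>f x\<bar>)" by simp
    define I where "I = \<bar>LINT x|circle. f x * \<phi> (cis x)\<bar>"
    define S where "S = (LINT x|circle. \<bar>f x\<bar>)"
    \<comment> \<open>This \<open>e\<close> makes the bound smaller than \<open>I\<close> itself;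
      the \<open>+ 1\<close> guards against \<open>S = 0\<close>.\<close>
    have "I \<le> (I / (2 * (S + 1))) * S" unfolding I_def S_def
      by (rule le) (use pos nn in \<open>auto intro!: divide_pos_pos add_nonneg_pos\<close>)
    moreover have "(I / (2 * (S + 1))) * S < I"
      using pos nn unfolding I_def[symmetric] S_def[symmetric]
      by (simp add: field_simps add_nonneg_pos)
    ultimately show False by simp
  qed
qed

lemma AE_circle_iff: "(AE x in circle. P x) \<longleftrightarrow> (AE x in lborel. x \<in> {0..<2*pi} \<longrightarrow> P x)"
proof -
  have "(AE x in circle. P x) \<longleftrightarrow> (AE x in lborel. 0 < ennreal (indicator {0..<2*pi} x / (2*pi)) \<longrightarrow> P x)"
    unfolding circle_eq_density by (rule AE_density) auto
  moreover have "0 < ennreal (indicator {0..<2*pi} x / (2*pi)) \<longleftrightarrow> x \<in> {0..<2*pi}" for x :: real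
    by (cases "x \<in> {0..<2*pi}") (auto simp: zero_less_divide_iff)
  ultimately show ?thesis by simp
qed

lemma AE_circle_mem: "AE x in circle. x \<in> {0..<2*pi}"
  by (simp add: AE_circle_iff)

text \<open>The indicator of \<open>K\<close> is the pointwise limit of continuous tents of slope
  \<open>k\<close> around \<open>K\<close>, and \<open>|f|\<close> dominates. \<open>K\<close> must
  be nonempty because \<open>infdist\<close> to the empty set is 0, which would make every tent
  equal to 1.\<close>

lemma fourier_null_closed:
  assumes f: "fourier_null f" and K: "closed K" "K \<noteq> {}"
  shows "(LINT x|circle. f x * indicator K (cis x)) = 0"
proof -
  have int: "integrable circle f" using f by (simp add: fourier_null_def)
  have [measurable]: "f \<in> borel_measurable circle" using int by auto
  have [measurable]: "K \<in> sets borel" using K by auto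
  define \<phi> where "\<phi> k z = max 0 (1 - real k * infdist z K)" for k z
  have cont: "continuous_on UNIV (\<phi> k)" for k unfolding \<phi>_def by (intro continuous_intros)
  then have [measurable]: "\<phi> k \<in> borel_measurable borel" for k by (rule borel_measurable_continuous_onI)
  have lim: "(\<lambda>k. \<phi> k z) \<longlonglongrightarrow> indicator K z" for z
  proof (cases "z \<in> K")
    case True
    then show ?thesis by (simp add: \<phi>_def)
  next
    case False
    then have pos: "infdist z K > 0" using infdist_pos_not_in_closed[OF K] by simp
    have "filterlim (\<lambda>k. real k * infdist z K) at_top sequentially"
      by (intro filterlim_at_top_mult_tendsto_pos[OF tendsto_const pos] filterlim_real_sequentially)
    then have "eventually (\<lambda>k. 1 \<le> real k * infdist z K) sequentially"
      by (simp add: filterlim_at_top)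
    then have "eventually (\<lambda>k. \<phi> k z = 0) sequentially"
      by eventually_elim (simp add: \<phi>_def)
    then show ?thesis using False by (simp add: tendsto_eventually)
  qed
  have "(\<lambda>k. LINT x|circle. f x * \<phi> k (cis x)) \<longlonglongrightarrow> (LINT x|circle. f x * indicator K (cis x))"
  proof (rule integral_dominated_convergence[where w="\<lambda>x. \<bar>f x\<bar>"])
    show "AE x in circle. (\<lambda>k. f x * \<phi> k (cis x)) \<longlonglongrightarrow> f x * indicator K (cis x)"
      by (intro AE_I2 tendsto_intros lim)
    have "\<bar>\<phi> k z\<bar> \<le> 1" for k z by (simp add: \<phi>_def infdist_nonneg)
    then show "AE x in circle. norm (f x * \<phi> k (cis x)) \<le> \<bar>f x\<bar>" for k
      by (intro AE_I2) (simp add: abs_mult mult_left_le)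
  qed (use int in auto)
  moreover have "(LINT x|circle. f x * \<phi> k (cis x)) = 0" for k
    by (rule fourier_null_continuous[OF f cont])
  ultimately show ?thesis by (simp add: LIMSEQ_const_iff)
qed

lemma fourier_null_AE:
  assumes f: "fourier_null f" shows "AE x in circle. f x = 0"
proof -
  have int: "integrable circle f" using f by (simp add: fourier_null_def)
  have [measurable]: "f \<in> borel_measurable circle" using int by auto
  have total: "(LINT x|circle. f x) = 0"
  proof -
    have "(LINT x|circle. of_real (f x) * cis (- of_int 0 * x)) = 0"
      using f unfolding fourier_null_def by blast
    then show ?thesis by simp
  qed
  have iA: "integrable circle (\<lambda>x. f x * indicator A x)" if "A \<in> sets borel" for A :: "real set"
    using that by (intro integrable_mult_bounded[OF int, where B=1]) (auto simp: indicator_def)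
  have half: "(LINT x|circle. f x * indicator {..a} x) = 0" for a
  proof -
    consider "a < 0" | "0 \<le> a" "a < 2 * pi" | "2 * pi \<le> a" by linarith
    then show ?thesis
    proof cases
      case 1
      have "(LINT x|circle. f x * indicator {..a} x) = (LINT x|circle. 0)"
      proof (rule integral_cong_AE)
        show "AE x in circle. f x * indicator {..a} x = 0"
          using AE_circle_mem by eventually_elim (use 1 in \<open>auto simp: indicator_def\<close>)
      qed measurable
      then show ?thesis by simp
    next
      case 2
      have "compact (cis ` {0..a})" by (intro compact_continuous_image continuous_intros) auto
      then have K: "closed (cis ` {0..a})" by (rule compact_imp_closed)
      then have [measurable]: "cis ` {0..a} \<in> sets borel" by auto
      have "(LINT x|circle. f x * indicator {..a} x) = (LINT x|circle. f x * indicator (cis ` {0..a}) (cis x))"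
      proof (rule integral_cong_AE)
        show "AE x in circle. f x * indicator {..a} x = f x * indicator (cis ` {0..a}) (cis x)"
          using AE_circle_mem
        proof eventually_elim
          case (elim x)
          \<comment> \<open>\<open>cis\<close> is injective on the half-open period; the point
            \<open>2*pi\<close> is excluded on both sides.\<close>
          have "cis x \<in> cis ` {0..a} \<longleftrightarrow> x \<le> a"
          proof
            assume "cis x \<in> cis ` {0..a}"
            then obtain y where y: "0 \<le> y" "y \<le> a" "cis x = cis y" by auto
            then obtain k :: int where k: "x = y + 2 * pi * k"
              using sin_cos_eq_iff[of x y] by (auto simp: complex_eq_iff)
            have "k < 1"
            proof (rule ccontr)
              assume "\<not> k < 1"
              then have "2 * pi * 1 \<le> 2 * pi * real_of_int k" by (intro mult_left_mono) auto
              then show False using k y elim unfolding atLeastLessThan_iff by linarith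
            qed
            then have "2 * pi * real_of_int k \<le> 2 * pi * 0" by (intro mult_left_mono) auto
            then show "x \<le> a" using k y by linarith
          qed (use elim in auto)
          then show ?case by (simp add: indicator_def)
        qed
      qed measurable
      also have "\<dots> = 0" using K 2 by (intro fourier_null_closed[OF f]) auto
      finally show ?thesis .
    next
      case 3
      have "(LINT x|circle. f x * indicator {..a} x) = (LINT x|circle. f x)"
      proof (rule integral_cong_AE)
        show "AE x in circle. f x * indicator {..a} x = f x"
          using AE_circle_mem by eventually_elim (use 3 in \<open>auto simp: indicator_def\<close>)
      qed measurable
      then show ?thesis using total by simp
    qed
  qed
  have all: "(LINT x|circle. f x * indicator A x) = 0" if A: "A \<in> sets borel" for A :: "real set"
  proof -
    have "Int_stable (range (atMost :: real \<Rightarrow> _))" "range (atMost :: real \<Rightarrow> _) \<subseteq> Pow UNIV"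
      by (auto simp: Int_stable_def)
    moreover have "A \<in> sigma_sets UNIV (range atMost)"
      using A by (simp add: borel_eq_atMost)
    ultimately show ?thesis
    proof (induction rule: sigma_sets_induct_disjoint)
      case (basic A)
      then show ?case using half by auto
    next
      case (compl A)
      then have "A \<in> sets borel" by (simp add: borel_eq_atMost)
      have "(LINT x|circle. f x * indicator (UNIV - A) x) = (LINT x|circle. f x - f x * indicator A x)"
        by (intro Bochner_Integration.integral_cong) (auto simp: indicator_def)
      also have "\<dots> = 0" using compl iA[OF \<open>A \<in> sets borel\<close>] int total by simp
      finally show ?case .
    next
      case (union A)
      have [measurable]: "A i \<in> sets borel" for i using union(2) by (auto simp: borel_eq_atMost)
      have "(LINT x:(\<Union>i. A i)|circle. f x) = (\<Sum>i. LINT x:A i|circle. f x)"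
        using union(1) iA[of "\<Union>i. A i"]
        by (intro lebesgue_integral_countable_add)
           (auto simp: disjoint_family_on_def set_integrable_def mult.commute)
      then show ?case using union(3) by (simp add: set_lebesgue_integral_def mult.commute)
    qed auto
  qed
  show ?thesis
    by (rule density_unique_real[where f'="\<lambda>_. 0"])
       (use int all in \<open>auto simp: set_lebesgue_integral_def mult.commute\<close>)
qed

section \<open>Linearity, symmetry and injectivity of the coefficients\<close>

lemma fourier_add: "fourier (u + v) n = fourier u n + fourier v n"
proof -
  have "fourier (u + v) n = (LINT x|circle. of_real (rep_L2 u x) * cis (- of_int n * x)
      + of_real (rep_L2 v x) * cis (- of_int n * x))"
    unfolding fourier_eq
    by (rule integral_cong_AE, measurable, use rep_add[of u v] in eventually_elim) (simp add: distrib_right)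
  also have "\<dots> = fourier u n + fourier v n"
    unfolding fourier_eq
    by (intro Bochner_Integration.integral_add integrable_mult_cis square_integrable_imp_integrable square_integrable_rep)
  finally show ?thesis .
qed

lemma fourier_scaleR: "fourier (a *\<^sub>R u) n = a * fourier u n"
proof -
  have "fourier (a *\<^sub>R u) n = (LINT x|circle. complex_of_real a * (of_real (rep_L2 u x) * cis (- of_int n * x)))"
    unfolding fourier_eq
    by (rule integral_cong_AE, measurable, use rep_scaleR[of a u] in eventually_elim) simp
  then show ?thesis unfolding fourier_eq by (simp only: integral_mult_right_zero)
qed

lemma fourier_abs:
  assumes "square_integrable f"
  shows "fourier (abs_L2 f) n = (LINT x|circle. of_real (f x) * cis (- of_int n * x))"
  using fourier.abs_eq[of f] assms by (simp add: L2_rel_refl)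

lemma fourier_cnj: "fourier u (- n) = cnj (fourier u n)"
proof -
  have "cnj (fourier u n) = (LINT x|circle. cnj (of_real (rep_L2 u x) * cis (- of_int n * x)))"
    unfolding fourier_eq by (rule Bochner_Integration.integral_cnj[symmetric])
  then show ?thesis unfolding fourier_eq by (simp add: cis_cnj)
qed

text \<open>The difference is \<open>fourier_null\<close>. This is the uniqueness half of the
  definite descriptions behind \<open>hilbert_transform\<close> and \<open>derivative\<close>, and
  the way identities between such operators are proved.\<close>

lemma fourier_inject:
  assumes "\<And>n. fourier u n = fourier v n" shows "u = v"
proof -
  have "fourier (u + (- 1) *\<^sub>R v) n = 0" for n
    by (simp only: fourier_add fourier_scaleR assms) simp
  then have "AE x in circle. rep_L2 (u + (- 1) *\<^sub>R v) x = 0"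
    unfolding fourier_eq
    by (intro fourier_null_AE) (simp only: fourier_null_def square_integrable_imp_integrable square_integrable_rep simp_thms)
  then have "u + (- 1) *\<^sub>R v = 0"
    using rep_zero by (intro L2_eqI, eventually_elim) simp
  then show ?thesis by simp
qed


section \<open>Fourier series of functions in \<open>H\<^sup>1\<close>\<close>

lemma integrable_trig_sum:
  assumes "finite I"
  shows "integrable circle (\<lambda>x. (cmod (\<Sum>n\<in>I. c n * cis (of_int n * x)))\<^sup>2)"
proof (rule integrable_circle_bounded[where B="(\<Sum>n\<in>I. cmod (c n))\<^sup>2"])
  fix x
  have "cmod (\<Sum>n\<in>I. c n * cis (of_int n * x)) \<le> (\<Sum>n\<in>I. cmod (c n))"
    by (rule order.trans[OF norm_sum]) (simp add: norm_mult)
  then show "norm ((cmod (\<Sum>n\<in>I. c n * cis (of_int n * x)))\<^sup>2) \<le> (\<Sum>n\<in>I. cmod (c n))\<^sup>2"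
    by (simp add: power_mono)
qed measurable

lemma integral_mult_trig_sum:
  assumes "integrable circle f" "finite I"
  shows "(LINT x|circle. complex_of_real (f x) * (\<Sum>n\<in>I. c n * cis (of_int n * x)))
    = (\<Sum>n\<in>I. c n * (LINT x|circle. of_real (f x) * cis (of_int n * x)))"
proof -
  have "(LINT x|circle. complex_of_real (f x) * (\<Sum>n\<in>I. c n * cis (of_int n * x)))
     = (LINT x|circle. (\<Sum>n\<in>I. c n * (of_real (f x) * cis (of_int n * x))))"
    by (simp add: sum_distrib_left mult_ac)
  also have "\<dots> = (\<Sum>n\<in>I. LINT x|circle. c n * (of_real (f x) * cis (of_int n * x)))"
    by (intro Bochner_Integration.integral_sum integrable_mult_right integrable_mult_cis assms)
  finally show ?thesis by simp
qed

lemma fourier_eq_neg: "(LINT x|circle. of_real (rep_L2 u x) * cis (of_int n * x)) = cnj (fourier u n)"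
  using fourier_eq[of u "- n"] by (simp add: fourier_cnj)

text \<open>Expand the nonnegative integral of \<open>|f - S|^2\<close>. The index set need not be
  symmetric, so \<open>S\<close> is complex; as \<open>f\<close> is real, the cross term may be
  written with \<open>S\<close> instead of its conjugate.\<close>

lemma bessel_inequality:
  assumes "finite I" shows "(\<Sum>n\<in>I. (cmod (fourier u n))\<^sup>2) \<le> (norm u)\<^sup>2"
proof -
  define S where "S x = (\<Sum>n\<in>I. fourier u n * cis (of_int n * x))" for x
  define f where "f = rep_L2 u"
  have [measurable]: "S \<in> borel_measurable borel" unfolding S_def by measurable
  have [measurable]: "f \<in> borel_measurable borel" unfolding f_def by measurable
  have f2: "integrable circle (\<lambda>x. (f x)\<^sup>2)"
    using square_integrable_rep[of u] by (simp add: square_integrable_def f_def)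
  have f1: "integrable circle f"
    unfolding f_def by (intro square_integrable_imp_integrable square_integrable_rep)
  have Sb: "cmod (S x) \<le> (\<Sum>n\<in>I. cmod (fourier u n))" for x
    unfolding S_def by (rule order.trans[OF norm_sum]) (simp add: norm_mult)
  have fS: "integrable circle (\<lambda>x. complex_of_real (f x) * S x)"
    by (rule integrable_mult_bounded[where B="\<Sum>n\<in>I. cmod (fourier u n)"]) (use f1 Sb in auto)
  have S2: "integrable circle (\<lambda>x. (cmod (S x))\<^sup>2)"
    unfolding S_def by (rule integrable_trig_sum) fact
  have "(cmod (complex_of_real (f x) - S x))\<^sup>2 = (f x)\<^sup>2 - 2 * Re (complex_of_real (f x) * S x) + (cmod (S x))\<^sup>2" for x
    unfolding cmod_power2 by (simp add: power2_eq_square algebra_simps)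
  then have "(LINT x|circle. (cmod (complex_of_real (f x) - S x))\<^sup>2)
     = (LINT x|circle. (f x)\<^sup>2) - 2 * (LINT x|circle. Re (complex_of_real (f x) * S x)) + (LINT x|circle. (cmod (S x))\<^sup>2)"
    using f2 integrable_Re[OF fS] S2
    by (simp only: Bochner_Integration.integral_add Bochner_Integration.integral_diff
        Bochner_Integration.integrable_diff integrable_mult_right integral_mult_right_zero)
  moreover have "(LINT x|circle. Re (complex_of_real (f x) * S x)) = (\<Sum>n\<in>I. (cmod (fourier u n))\<^sup>2)"
  proof -
    have "(LINT x|circle. complex_of_real (f x) * S x) = (\<Sum>n\<in>I. fourier u n * cnj (fourier u n))"
      unfolding S_def using integral_mult_trig_sum[OF f1 assms] by (simp add: f_def fourier_eq_neg)
    then have "Re (LINT x|circle. complex_of_real (f x) * S x) = (\<Sum>n\<in>I. (cmod (fourier u n))\<^sup>2)"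
      unfolding cmod_power2 by (simp add: power2_eq_square)
    then show ?thesis using integral_Re[OF fS] by simp
  qed
  moreover have "(LINT x|circle. (cmod (S x))\<^sup>2) = (\<Sum>n\<in>I. (cmod (fourier u n))\<^sup>2)"
    unfolding S_def by (rule integral_norm_trig_sum) fact
  moreover have "0 \<le> (LINT x|circle. (cmod (complex_of_real (f x) - S x))\<^sup>2)" by simp
  moreover have "(LINT x|circle. (f x)\<^sup>2) = (norm u)\<^sup>2"
    using norm_abs_L2[OF square_integrable_rep[of u]] by (simp add: f_def abs_rep_L2)
  ultimately show ?thesis by linarith
qed

text \<open>The symmetric range makes the sums real for conjugate-symmetric coefficients.\<close>

definition partial_sum :: "(int \<Rightarrow> complex) \<Rightarrow> nat \<Rightarrow> real \<Rightarrow> complex" where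
  "partial_sum c N x = (\<Sum>n\<in>{- int N..int N}. c n * cis (of_int n * x))"

lemma borel_measurable_partial_sum [measurable]: "partial_sum c N \<in> borel_measurable borel"
  unfolding partial_sum_def by measurable

lemma partial_sum_real:
  assumes "\<And>n. c (- n) = cnj (c n)"
  shows "complex_of_real (Re (partial_sum c N x)) = partial_sum c N x"
proof -
  have "cnj (partial_sum c N x) = (\<Sum>n\<in>{- int N..int N}. c (- n) * cis (of_int (- n) * x))"
    unfolding partial_sum_def by (simp add: assms cis_cnj)
  also have "\<dots> = partial_sum c N x"
    unfolding partial_sum_def
    by (rule sum.reindex_bij_witness[of _ uminus uminus]) auto
  finally show ?thesis by (simp add: complex_eq_iff)
qed

lemma filterlim_symmetric_intervals:
  "filterlim (\<lambda>N. {- int N..int N}) (finite_subsets_at_top UNIV) sequentially"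
  unfolding filterlim_finite_subsets_at_top
proof safe
  fix X :: "int set" assume "finite X"
  then obtain m where m: "\<And>k. k \<in> X \<Longrightarrow> nat \<bar>k\<bar> \<le> m"
    using finite_nat_set_iff_bounded_le[of "(\<lambda>k. nat \<bar>k\<bar>) ` X"] by auto
  show "\<forall>\<^sub>F N in sequentially. finite {- int N..int N} \<and> X \<subseteq> {- int N..int N} \<and> {- int N..int N} \<subseteq> UNIV"
    using eventually_ge_at_top[of m]
  proof eventually_elim
    case (elim N)
    have "k \<in> {- int N..int N}" if "k \<in> X" for k using m[OF that] elim by auto
    then show ?case by auto
  qed
qed

text \<open>Write \<open>|u_n| = |n u_n| * (1/|n|)\<close> for nonzero \<open>n\<close> and use
  Cauchy--Schwarz: Bessel for the derivative bounds the first factor, and the 2 is the square root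
  of the bound for the inverse squares.\<close>

lemma H1_abs_summable:
  assumes "u \<in> H1" shows "(\<lambda>n. cmod (fourier u n)) summable_on UNIV"
proof -
  obtain v where v: "\<And>n. fourier v n = \<i> * of_int n * fourier u n"
    using assms by (auto simp: H1_def is_multiplier_def)
  have "(\<Sum>n\<in>I. cmod (fourier u n)) \<le> cmod (fourier u 0) + norm v * 2" if I: "finite I" for I
  proof -
    have "(\<Sum>n\<in>I. cmod (fourier u n)) \<le> (\<Sum>n\<in>insert 0 (I - {0}). cmod (fourier u n))"
      using I by (intro sum_mono2) auto
    also have "\<dots> = cmod (fourier u 0) + (\<Sum>n\<in>I - {0}. cmod (fourier u n))"
      by (subst sum.insert) (use I in auto)
    also have "(\<Sum>n\<in>I - {0}. cmod (fourier u n)) = (\<Sum>n\<in>I - {0}. cmod (fourier v n) * (1 / \<bar>of_int n\<bar>))"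
      by (intro sum.cong) (auto simp: v norm_mult)
    also have "\<dots> \<le> norm v * 2"
    proof (rule power2_le_imp_le)
      have "(\<Sum>n\<in>I - {0}. cmod (fourier v n) * (1 / \<bar>of_int n\<bar>))\<^sup>2
         \<le> (\<Sum>n\<in>I - {0}. (cmod (fourier v n))\<^sup>2) * (\<Sum>n\<in>I - {0}. (1 / \<bar>of_int n\<bar>)\<^sup>2)"
        by (rule Cauchy_Schwarz_ineq_sum)
      also have "\<dots> \<le> (norm v)\<^sup>2 * 4"
        using sum_inverse_squares_int[of "I - {0}"] I
        by (intro mult_mono bessel_inequality) (auto simp: power_divide intro!: sum_nonneg)
      finally show "(\<Sum>n\<in>I - {0}. cmod (fourier v n) * (1 / \<bar>of_int n\<bar>))\<^sup>2 \<le> (norm v * 2)\<^sup>2"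
        by (simp add: power_mult_distrib)
    qed auto
    finally show ?thesis by simp
  qed
  then show ?thesis unfolding abs_summable_iff_bdd_above by (intro bdd_aboveI2) auto
qed

lemma partial_sum_bounded:
  assumes "(\<lambda>n. cmod (c n)) summable_on UNIV"
  shows "cmod (partial_sum c N x) \<le> (\<Sum>\<^sub>\<infinity>n. cmod (c n))"
proof -
  have "cmod (partial_sum c N x) \<le> (\<Sum>n\<in>{- int N..int N}. cmod (c n))"
    unfolding partial_sum_def by (rule order.trans[OF norm_sum]) (simp add: norm_mult)
  also have "\<dots> \<le> (\<Sum>\<^sub>\<infinity>n. cmod (c n))"
    by (rule finite_sum_le_infsum[OF assms]) auto
  finally show ?thesis .
qed

lemma integral_partial_sum_cis:
  assumes "nat \<bar>k\<bar> \<le> N"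
  shows "(LINT x|circle. partial_sum c N x * cis (- of_int k * x)) = c k"
proof -
  have "(LINT x|circle. partial_sum c N x * cis (- of_int k * x))
    = (LINT x|circle. (\<Sum>n\<in>{- int N..int N}. c n * cis (of_int (n - k) * x)))"
    unfolding partial_sum_def sum_distrib_right
    by (intro Bochner_Integration.integral_cong sum.cong refl) (simp add: mult.assoc cis_mult algebra_simps)
  also have "\<dots> = (\<Sum>n\<in>{- int N..int N}. LINT x|circle. c n * cis (of_int (n - k) * x))"
    by (intro Bochner_Integration.integral_sum integrable_mult_right integrable_circle_bounded[where B=1]) auto
  also have "\<dots> = (\<Sum>n\<in>{- int N..int N}. if n = k then c n else 0)"
    by (intro sum.cong refl) (simp add: integral_circle_cis del: of_int_diff)
  also have "\<dots> = c k" using assms by auto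
  finally show ?thesis .
qed

text \<open>The absolutely convergent series has some bounded limit \<open>g\<close>. Dominated
  convergence shows that \<open>g\<close> has the coefficients of \<open>u\<close>, and uniqueness
  identifies the two almost everywhere.\<close>

lemma H1_partial_sum_tendsto:
  assumes u: "u \<in> H1"
  shows "AE x in circle. (\<lambda>N. partial_sum (fourier u) N x) \<longlonglongrightarrow> complex_of_real (rep_L2 u x)"
proof -
  note abs = H1_abs_summable[OF u]
  define B where "B = (\<Sum>\<^sub>\<infinity>n. cmod (fourier u n))"
  define g where "g x = (\<Sum>\<^sub>\<infinity>n. fourier u n * cis (of_int n * x))" for x
  have lim: "(\<lambda>N. partial_sum (fourier u) N x) \<longlonglongrightarrow> g x" for x
  proof -
    have "(\<lambda>n. norm (fourier u n * cis (of_int n * x))) summable_on UNIV"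
      using abs by (simp add: norm_mult)
    then have "((\<lambda>n. fourier u n * cis (of_int n * x)) has_sum g x) UNIV"
      unfolding g_def by (rule has_sum_infsum[OF abs_summable_summable])
    then show ?thesis
      unfolding has_sum_def partial_sum_def using filterlim_compose[OF _ filterlim_symmetric_intervals] by blast
  qed
  have [measurable]: "g \<in> borel_measurable borel"
    by (rule borel_measurable_LIMSEQ_metric[OF _ lim]) measurable
  have greal: "g x = complex_of_real (Re (g x))" for x
  proof (rule LIMSEQ_unique[OF lim])
    have "(\<lambda>N. complex_of_real (Re (partial_sum (fourier u) N x))) \<longlonglongrightarrow> complex_of_real (Re (g x))"
      by (intro tendsto_intros lim)
    then show "(\<lambda>N. partial_sum (fourier u) N x) \<longlonglongrightarrow> complex_of_real (Re (g x))"
      by (simp add: partial_sum_real fourier_cnj)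
  qed
  have gB: "cmod (g x) \<le> B" for x
    using tendsto_norm[OF lim[of x]] partial_sum_bounded[OF abs] unfolding B_def
    by (intro tendsto_upperbound[OF tendsto_norm[OF lim[of x]]]) auto
  have sq: "square_integrable (\<lambda>x. Re (g x))"
    by (rule square_integrable_bounded[of _ B]) (use order.trans[OF abs_Re_le_cmod gB] in auto)
  have "fourier (abs_L2 (\<lambda>x. Re (g x))) k = fourier u k" for k
  proof -
    have "(\<lambda>N. LINT x|circle. partial_sum (fourier u) N x * cis (- of_int k * x))
        \<longlonglongrightarrow> (LINT x|circle. g x * cis (- of_int k * x))"
    proof (rule integral_dominated_convergence[where w="\<lambda>_. B"])
      show "AE x in circle. (\<lambda>N. partial_sum (fourier u) N x * cis (- of_int k * x)) \<longlonglongrightarrow> g x * cis (- of_int k * x)"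
        by (intro AE_I2 tendsto_intros lim)
      show "AE x in circle. norm (partial_sum (fourier u) N x * cis (- of_int k * x)) \<le> B" for N
        using partial_sum_bounded[OF abs] by (simp add: norm_mult B_def)
    qed simp_all
    moreover have "\<forall>\<^sub>F N in sequentially. (LINT x|circle. partial_sum (fourier u) N x * cis (- of_int k * x)) = fourier u k"
      unfolding eventually_sequentially using integral_partial_sum_cis by blast
    then have "(\<lambda>N. LINT x|circle. partial_sum (fourier u) N x * cis (- of_int k * x)) \<longlonglongrightarrow> fourier u k"
      by (rule tendsto_eventually)
    ultimately have "(LINT x|circle. g x * cis (- of_int k * x)) = fourier u k"
      by (rule LIMSEQ_unique)
    then show ?thesis using greal by (simp add: fourier_abs[OF sq])
  qed
  then have eq: "abs_L2 (\<lambda>x. Re (g x)) = u" by (rule fourier_inject)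
  show ?thesis
    using rep_abs_L2[OF sq] unfolding eq
  proof eventually_elim
    case (elim x)
    then show ?case using lim[of x] greal[of x] by simp
  qed
qed

lemma H1_AE_bounded:
  assumes u: "u \<in> H1"
  shows "AE x in circle. \<bar>rep_L2 u x\<bar> \<le> (\<Sum>\<^sub>\<infinity>n. cmod (fourier u n))"
  using H1_partial_sum_tendsto[OF u]
proof eventually_elim
  case (elim x)
  have "norm (complex_of_real (rep_L2 u x)) \<le> (\<Sum>\<^sub>\<infinity>n. cmod (fourier u n))"
    using partial_sum_bounded[OF H1_abs_summable[OF u]]
    by (intro tendsto_upperbound[OF tendsto_norm[OF elim]]) auto
  then show ?case by simp
qed

text \<open>Only \<open>h\<close> has to lie in \<open>H1\<close>: its partial sums are uniformly
  bounded, so \<open>|v|\<close> times a constant dominates. Thus \<open>v\<close> may be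
  \<open>hilbert_transform (derivative h)\<close>, which is merely in \<open>L2\<close>.\<close>

lemma parseval_H1:
  assumes h: "h \<in> H1"
  shows "(\<lambda>N. \<Sum>n\<in>{- int N..int N}. Re (fourier h n * cnj (fourier v n))) \<longlonglongrightarrow> inner v h"
proof -
  define B where "B = (\<Sum>\<^sub>\<infinity>n. cmod (fourier h n))"
  have v1: "integrable circle (rep_L2 v)"
    by (intro square_integrable_imp_integrable square_integrable_rep)
  have "(\<lambda>N. LINT x|circle. of_real (rep_L2 v x) * partial_sum (fourier h) N x)
      \<longlonglongrightarrow> (LINT x|circle. complex_of_real (rep_L2 v x) * complex_of_real (rep_L2 h x))"
  proof (rule integral_dominated_convergence[where w="\<lambda>x. \<bar>rep_L2 v x\<bar> * B"])
    show "AE x in circle. (\<lambda>N. of_real (rep_L2 v x) * partial_sum (fourier h) N x)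
        \<longlonglongrightarrow> complex_of_real (rep_L2 v x) * complex_of_real (rep_L2 h x)"
      using H1_partial_sum_tendsto[OF h] by eventually_elim (intro tendsto_intros)
    show "AE x in circle. norm (of_real (rep_L2 v x) * partial_sum (fourier h) N x) \<le> \<bar>rep_L2 v x\<bar> * B" for N
      using partial_sum_bounded[OF H1_abs_summable[OF h]] by (simp add: norm_mult B_def mult_left_mono)
  qed (use v1 in auto)
  also have "(LINT x|circle. complex_of_real (rep_L2 v x) * complex_of_real (rep_L2 h x)) = complex_of_real (inner v h)"
    unfolding inner_L2_eq by (simp flip: of_real_mult)
  finally have "(\<lambda>N. \<Sum>n\<in>{- int N..int N}. fourier h n * cnj (fourier v n)) \<longlonglongrightarrow> complex_of_real (inner v h)"
    unfolding partial_sum_def by (simp add: integral_mult_trig_sum[OF v1] fourier_eq_neg)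
  from tendsto_Re[OF this] show ?thesis by simp
qed


section \<open>The Riesz--Fischer theorem and the Hilbert transform\<close>

lemma partial_sum_L2_diff:
  assumes "M \<le> N"
  shows "(LINT x|circle. (Re (partial_sum c N x) - Re (partial_sum c M x))\<^sup>2)
    \<le> (\<Sum>n\<in>{- int N..int N}. (cmod (c n))\<^sup>2) - (\<Sum>n\<in>{- int M..int M}. (cmod (c n))\<^sup>2)"
proof -
  define I where "I = {- int N..int N} - {- int M..int M}"
  have sub: "{- int M..int M} \<subseteq> {- int N..int N}" using assms by auto
  have diff: "partial_sum c N x - partial_sum c M x = (\<Sum>n\<in>I. c n * cis (of_int n * x))" for x
    unfolding partial_sum_def I_def using sub by (simp add: sum_diff)
  have "(LINT x|circle. (Re (partial_sum c N x) - Re (partial_sum c M x))\<^sup>2)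
     \<le> (LINT x|circle. (cmod (\<Sum>n\<in>I. c n * cis (of_int n * x)))\<^sup>2)"
  proof (rule integral_mono_AE')
    show "integrable circle (\<lambda>x. (cmod (\<Sum>n\<in>I. c n * cis (of_int n * x)))\<^sup>2)"
      by (rule integrable_trig_sum) (simp add: I_def)
    show "AE x in circle. (Re (partial_sum c N x) - Re (partial_sum c M x))\<^sup>2 \<le> (cmod (\<Sum>n\<in>I. c n * cis (of_int n * x)))\<^sup>2"
    proof (rule AE_I2)
      fix x
      have "\<bar>Re (partial_sum c N x - partial_sum c M x)\<bar> \<le> cmod (partial_sum c N x - partial_sum c M x)"
        by (rule abs_Re_le_cmod)
      then show "(Re (partial_sum c N x) - Re (partial_sum c M x))\<^sup>2 \<le> (cmod (\<Sum>n\<in>I. c n * cis (of_int n * x)))\<^sup>2"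
        unfolding diff[symmetric] by (metis abs_le_square_iff abs_norm_cancel minus_complex.sel(1))
    qed
  qed simp
  also have "\<dots> = (\<Sum>n\<in>I. (cmod (c n))\<^sup>2)"
    by (rule integral_norm_trig_sum) (simp add: I_def)
  also have "\<dots> = (\<Sum>n\<in>{- int N..int N}. (cmod (c n))\<^sup>2) - (\<Sum>n\<in>{- int M..int M}. (cmod (c n))\<^sup>2)"
    unfolding I_def using sub by (simp add: sum_diff)
  finally show ?thesis .
qed

text \<open>Along a subsequence the increments \<open>D j\<close> satisfy \<open>\<parallel>D j\<parallel>\<^sup>2 \<le> 4\<^sup>-\<^sup>j\<close>, so \<open>q = \<Sum>j. 2\<^sup>j (D j)\<^sup>2\<close> is
  integrable; by Cauchy--Schwarz it controls the square of every partial sum of the increments.\<close>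

lemma riesz_fischer:
  fixes c :: "int \<Rightarrow> complex"
  assumes cnj: "\<And>n. c (- n) = cnj (c n)"
    and bd: "\<And>I. finite I \<Longrightarrow> (\<Sum>n\<in>I. (cmod (c n))\<^sup>2) \<le> B"
  shows "\<exists>v. \<forall>n. fourier v n = c n"
proof -
  define a where "a N = (\<Sum>n\<in>{- int N..int N}. (cmod (c n))\<^sup>2)" for N
  have "incseq a" unfolding a_def by (intro incseq_SucI sum_mono2) auto
  moreover have "a N \<le> B" for N unfolding a_def by (rule bd) simp
  ultimately obtain L where L: "a \<longlonglongrightarrow> L" "\<And>N. a N \<le> L"
    using incseq_convergent by blast
  have ex: "\<exists>N\<ge>m. L - a N \<le> (1/4) ^ j" for m j :: nat
  proof -
    have "\<forall>\<^sub>F N in sequentially. L - (1/4) ^ j < a N"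
      using L(1) by (rule order_tendstoD) simp
    then obtain N0 where "\<And>N. N \<ge> N0 \<Longrightarrow> L - (1/4) ^ j < a N"
      by (auto simp: eventually_sequentially)
    from this[of "max m N0"] show ?thesis by (intro exI[of _ "max m N0"]) auto
  qed
  have "\<exists>k. \<forall>j. L - a (k j) \<le> (1/4) ^ j \<and> k j < k (Suc j)"
  proof (rule dependent_nat_choice)
    show "\<exists>x. L - a x \<le> (1/4) ^ 0" using ex[of 0 0] by blast
    show "\<exists>y. L - a y \<le> (1/4) ^ Suc j \<and> x < y" for x j
      using ex[of "Suc x" "Suc j"] by (auto simp only: Suc_le_eq)
  qed
  then obtain k where k: "\<And>j. L - a (k j) \<le> (1/4) ^ j" "\<And>j. k j < k (Suc j)" by blast
  have "strict_mono k" using k(2) by (rule strict_monoI_Suc)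
  define P where "P j x = Re (partial_sum c (k j) x)" for j x
  define D where "D j x = P (Suc j) x - P j x" for j x
  have [measurable]: "P j \<in> borel_measurable borel" "D j \<in> borel_measurable borel" for j
    unfolding P_def D_def by measurable
  have Pb: "\<exists>C. \<forall>x. \<bar>P j x\<bar> \<le> C" for j
  proof (intro exI allI)
    fix x
    have "\<bar>P j x\<bar> \<le> cmod (partial_sum c (k j) x)" unfolding P_def by (rule abs_Re_le_cmod)
    also have "\<dots> \<le> (\<Sum>n\<in>{- int (k j)..int (k j)}. cmod (c n))"
      unfolding partial_sum_def by (rule order.trans[OF norm_sum]) (simp add: norm_mult)
    finally show "\<bar>P j x\<bar> \<le> (\<Sum>n\<in>{- int (k j)..int (k j)}. cmod (c n))" .
  qed
  have sqP: "square_integrable (P j)" for j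
    using Pb[of j] by (auto intro: square_integrable_bounded)
  have "square_integrable (\<lambda>x. P (Suc j) x + (- 1) * P j x)" for j
    by (intro square_integrable_add square_integrable_scaleR sqP)
  then have sqD: "square_integrable (D j)" for j unfolding D_def by simp
  have D2: "(LINT x|circle. (D j x)\<^sup>2) \<le> (1/4) ^ j" for j
  proof -
    have "(LINT x|circle. (D j x)\<^sup>2) \<le> a (k (Suc j)) - a (k j)"
      unfolding D_def P_def a_def using k(2)[of j] by (intro partial_sum_L2_diff) simp
    also have "\<dots> \<le> (1/4) ^ j" using k(1)[of j] L(2)[of "k (Suc j)"] by simp
    finally show ?thesis .
  qed
  define f where "f j x = 2 ^ j * (D j x)\<^sup>2" for j x
  have f_int: "integrable circle (f j)" for j
    using sqD[of j] unfolding f_def square_integrable_def by simp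
  then have [measurable]: "f j \<in> borel_measurable borel" for j by auto
  have f_nn: "0 \<le> f j x" for j x by (simp add: f_def)
  have f_le: "(LINT x|circle. f j x) \<le> (1/2) ^ j" for j
  proof -
    have "(LINT x|circle. f j x) = 2 ^ j * (LINT x|circle. (D j x)\<^sup>2)" by (simp add: f_def)
    also have "\<dots> \<le> 2 ^ j * (1/4) ^ j" by (intro mult_left_mono D2) simp
    also have "\<dots> = (1/2) ^ j" by (simp flip: power_mult_distrib)
    finally show ?thesis .
  qed
  have sum_int: "summable (\<lambda>j. LINT x|circle. f j x)"
    by (rule summable_comparison_test'[OF summable_geometric[of "1/2"], of 0]) (use f_le f_nn in auto)
  have AEs: "AE x in circle. summable (\<lambda>j. f j x)"
  proof -
    have "(\<integral>\<^sup>+x. (\<Sum>j. ennreal (f j x)) \<partial>circle) = (\<Sum>j. \<integral>\<^sup>+x. ennreal (f j x) \<partial>circle)"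
      by (rule nn_integral_suminf) auto
    also have "\<dots> = (\<Sum>j. ennreal (LINT x|circle. f j x))"
      using f_int f_nn by (simp add: nn_integral_eq_integral)
    also have "\<dots> = ennreal (\<Sum>j. LINT x|circle. f j x)"
      using f_nn sum_int by (intro suminf_ennreal2) auto
    finally have "(\<integral>\<^sup>+x. (\<Sum>j. ennreal (f j x)) \<partial>circle) \<noteq> \<infinity>" by simp
    then have "AE x in circle. (\<Sum>j. ennreal (f j x)) \<noteq> \<infinity>"
      by (intro nn_integral_PInf_AE) auto
    then show ?thesis
      by eventually_elim (rule summable_suminf_not_top[OF f_nn], simp)
  qed
  define q where "q x = (\<Sum>j. f j x)" for x
  have q_int: "integrable circle q"
    unfolding q_def using f_nn sum_int AEs by (intro integrable_suminf f_int) auto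
  define F where "F x = lim (\<lambda>j. P j x)" for x
  have [measurable]: "F \<in> borel_measurable borel" unfolding F_def by measurable
  have tele: "P J x = P 0 x + (\<Sum>j<J. D j x)" for J x
    by (induction J) (auto simp: D_def)
  have conv: "AE x in circle. (\<lambda>j. P j x) \<longlonglongrightarrow> F x"
    using AEs
  proof eventually_elim
    case (elim x)
    have "summable (\<lambda>j. D j x)"
    proof (rule summable_comparison_test')
      show "summable (\<lambda>j. (1/2) ^ j + f j x)"
        using elim by (intro summable_add summable_geometric) auto
      fix j
      \<comment> \<open>With \<open>r = 2^j\<close>, dividing
        \<open>r |D| \<le> 1 + (r |D|)^2\<close> by \<open>r\<close> trades an increment for a
        geometric term plus a summable one.\<close>
      have "\<bar>D j x\<bar> \<le> (1/2) ^ j + f j x"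
      proof -
        define r where "r = (2::real) ^ j"
        have "r > 0" by (simp add: r_def)
        have "2 * (r * \<bar>D j x\<bar>) \<le> 1 + (r * \<bar>D j x\<bar>)\<^sup>2"
          using sum_squares_bound[of 1 "r * \<bar>D j x\<bar>"] by simp
        moreover have "0 \<le> r * \<bar>D j x\<bar>" using \<open>r > 0\<close> by simp
        ultimately have "r * \<bar>D j x\<bar> \<le> 1 + (r * \<bar>D j x\<bar>)\<^sup>2" by linarith
        then have "\<bar>D j x\<bar> \<le> 1 / r + r * (D j x)\<^sup>2"
          using \<open>r > 0\<close> by (simp add: field_simps power2_eq_square)
        then show ?thesis by (simp add: f_def r_def power_one_over)
      qed
      then show "norm (D j x) \<le> (1/2) ^ j + f j x" by simp
    qed
    then have "(\<lambda>J. P 0 x + (\<Sum>j<J. D j x)) \<longlonglongrightarrow> P 0 x + (\<Sum>j. D j x)"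
      by (intro tendsto_intros summable_LIMSEQ)
    then have "(\<lambda>J. P J x) \<longlonglongrightarrow> P 0 x + (\<Sum>j. D j x)" unfolding tele[symmetric] .
    then show ?case unfolding F_def using convergent_LIMSEQ_iff convergentI by blast
  qed
  have dom: "AE x in circle. \<forall>J. (P J x)\<^sup>2 \<le> 2 * (P 0 x)\<^sup>2 + 4 * q x"
    using AEs
  proof eventually_elim
    case (elim x)
    show ?case
    proof
      fix J
      \<comment> \<open>Reciprocal weights pair a geometric series of sum at most 2 with the partial
        sums of \<open>q\<close>.\<close>
      have "(\<Sum>j<J. D j x)\<^sup>2 = (\<Sum>j<J. sqrt ((1/2) ^ j) * (sqrt (2 ^ j) * D j x))\<^sup>2"
        by (simp flip: real_sqrt_mult mult.assoc power_mult_distrib)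
      also have "\<dots> \<le> (\<Sum>j<J. (sqrt ((1/2) ^ j))\<^sup>2) * (\<Sum>j<J. (sqrt (2 ^ j) * D j x)\<^sup>2)"
        by (rule Cauchy_Schwarz_ineq_sum)
      also have "\<dots> = (\<Sum>j<J. (1/2) ^ j) * (\<Sum>j<J. f j x)"
        by (simp add: f_def power_mult_distrib)
      also have "\<dots> \<le> 2 * q x"
      proof (rule mult_mono)
        have "(\<Sum>j<J. (1/2) ^ j) \<le> (\<Sum>j. (1/2 :: real) ^ j)"
          by (intro sum_le_suminf summable_geometric) auto
        then show "(\<Sum>j<J. (1/2) ^ j) \<le> (2::real)" by (simp add: suminf_geometric)
        show "(\<Sum>j<J. f j x) \<le> q x"
          unfolding q_def using elim f_nn by (intro sum_le_suminf) auto
      qed (auto intro: sum_nonneg f_nn)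
      finally have 1: "(\<Sum>j<J. D j x)\<^sup>2 \<le> 2 * q x" .
      have "(P J x)\<^sup>2 \<le> 2 * (P 0 x)\<^sup>2 + 2 * (\<Sum>j<J. D j x)\<^sup>2"
        unfolding tele[of J] using sum_squares_bound[of "P 0 x" "\<Sum>j<J. D j x"]
        by (simp add: power2_sum)
      then show "(P J x)\<^sup>2 \<le> 2 * (P 0 x)\<^sup>2 + 4 * q x" using 1 by simp
    qed
  qed
  \<comment> \<open>The added 1 lets \<open>w\<close> dominate \<open>|P j x|\<close> as well as its
    square, by \<open>|y| \<le> 1 + y^2\<close>. One majorant then serves both the square
    integrability of \<open>F\<close> and the convergence of the coefficients.\<close>
  define w where "w x = 1 + (2 * (P 0 x)\<^sup>2 + 4 * q x)" for x
  have w_int: "integrable circle w"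
    unfolding w_def using q_int sqP[of 0] by (simp add: square_integrable_def)
  have sqF: "square_integrable F"
    unfolding square_integrable_def
  proof
    show "integrable circle (\<lambda>x. (F x)\<^sup>2)"
    proof (rule Bochner_Integration.integrable_bound[OF w_int])
      show "AE x in circle. norm ((F x)\<^sup>2) \<le> norm (w x)"
        using conv dom
      proof eventually_elim
        case (elim x)
        have "(F x)\<^sup>2 \<le> 2 * (P 0 x)\<^sup>2 + 4 * q x"
          using elim by (intro tendsto_upperbound[OF tendsto_power[OF elim(1)]]) auto
        then show ?case unfolding w_def by simp
      qed
    qed measurable
  qed measurable
  have "fourier (abs_L2 F) n = c n" for n
  proof -
    have "(\<lambda>j. LINT x|circle. of_real (P j x) * cis (- of_int n * x))
        \<longlonglongrightarrow> (LINT x|circle. of_real (F x) * cis (- of_int n * x))"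
    proof (rule integral_dominated_convergence[where w=w])
      show "AE x in circle. (\<lambda>j. of_real (P j x) * cis (- of_int n * x))
          \<longlonglongrightarrow> of_real (F x) * cis (- of_int n * x)"
        using conv by eventually_elim (intro tendsto_intros)
      show "AE x in circle. norm (of_real (P j x) * cis (- of_int n * x)) \<le> w x" for j
        using dom
      proof eventually_elim
        case (elim x)
        have "\<bar>P j x\<bar> \<le> 1 + (P j x)\<^sup>2"
          using sum_squares_bound[of 1 "\<bar>P j x\<bar>"] by (simp add: power2_eq_square) 
        moreover have "(P j x)\<^sup>2 \<le> 2 * (P 0 x)\<^sup>2 + 4 * q x" using elim by blast
        ultimately show ?case unfolding w_def by (simp add: norm_mult)
      qed
    qed (use w_int in auto)
    then have lim: "(\<lambda>j. LINT x|circle. of_real (P j x) * cis (- of_int n * x))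
        \<longlonglongrightarrow> fourier (abs_L2 F) n"
      unfolding fourier_abs[OF sqF] .
    have "\<forall>\<^sub>F j in sequentially. (LINT x|circle. of_real (P j x) * cis (- of_int n * x)) = c n"
      unfolding eventually_sequentially
    proof (intro exI allI impI)
      fix j assume "nat \<bar>n\<bar> \<le> j"
      then have "nat \<bar>n\<bar> \<le> k j" using seq_suble[OF \<open>strict_mono k\<close>, of j] by simp
      then show "(LINT x|circle. of_real (P j x) * cis (- of_int n * x)) = c n"
        unfolding P_def partial_sum_real[of c, OF cnj] by (rule integral_partial_sum_cis)
    qed
    then show ?thesis
      by (rule LIMSEQ_unique[OF lim tendsto_eventually])
  qed
  then show ?thesis by blast
qed

text \<open>The definite description has this value only once a solution exists. The multiplier has
  modulus at most 1, so Bessel supplies the bound that Riesz--Fischer asks for; uniqueness is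
  \<open>fourier_inject\<close>.\<close>

lemma fourier_hilbert_transform: "fourier (hilbert_transform u) n = - \<i> * of_int (sgn n) * fourier u n"
proof -
  define m where "m n = - \<i> * of_int (sgn n)" for n :: int
  have "\<exists>v. \<forall>n. fourier v n = m n * fourier u n"
  proof (rule riesz_fischer)
    show "m (- n) * fourier u (- n) = cnj (m n * fourier u n)" for n
      by (simp add: m_def fourier_cnj)
    show "(\<Sum>n\<in>I. (cmod (m n * fourier u n))\<^sup>2) \<le> (norm u)\<^sup>2" if "finite I" for I
    proof (rule order.trans[OF sum_mono bessel_inequality[OF that]])
      fix n
      have "cmod (m n) \<le> 1" by (simp add: m_def norm_mult sgn_if)
      then show "(cmod (m n * fourier u n))\<^sup>2 \<le> (cmod (fourier u n))\<^sup>2"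
        by (intro power_mono) (auto simp: norm_mult mult_left_le_one_le)
    qed
  qed
  then have "\<exists>!v. is_multiplier (\<lambda>n. - \<i> * of_int (sgn n)) u v"
    unfolding is_multiplier_def m_def by (auto intro: fourier_inject)
  from theI'[OF this] show ?thesis
    unfolding hilbert_transform_def is_multiplier_def by blast
qed

lemma fourier_derivative:
  assumes "u \<in> H1" shows "fourier (derivative u) n = \<i> * of_int n * fourier u n"
proof -
  have "\<exists>!v. is_multiplier (\<lambda>n. \<i> * of_int n) u v"
    using assms unfolding H1_def is_multiplier_def by (auto intro: fourier_inject)
  from theI'[OF this] show ?thesis
    unfolding derivative_def is_multiplier_def by blast
qed

text \<open>The symbols multiply to \<open>(- \<i> sgn n) * (\<i> n) = |n|\<close>: the composite is
  the absolute value of the derivative, and its quadratic form is the energy used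
  throughout.\<close>

lemma fourier_hilbert_derivative:
  assumes "u \<in> H1"
  shows "fourier (hilbert_transform (derivative u)) n = of_real \<bar>of_int n\<bar> * fourier u n"
  unfolding fourier_hilbert_transform fourier_derivative[OF assms]
  by (simp add: sgn_if flip: mult.assoc)

lemma H1_add_scaleR:
  assumes "u \<in> H1" "h \<in> H1" shows "u + s *\<^sub>R h \<in> H1"
proof -
  have "fourier (derivative u + s *\<^sub>R derivative h) n = \<i> * of_int n * fourier (u + s *\<^sub>R h) n" for n
    using assms by (simp add: fourier_add fourier_scaleR fourier_derivative algebra_simps)
  then show ?thesis unfolding H1_def is_multiplier_def by blast
qed

lemma hilbert_derivative_add_scaleR:
  assumes "u \<in> H1" "h \<in> H1"
  shows "hilbert_transform (derivative (u + s *\<^sub>R h))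
    = hilbert_transform (derivative u) + s *\<^sub>R hilbert_transform (derivative h)"
  by (rule fourier_inject)
     (simp add: fourier_add fourier_scaleR fourier_hilbert_derivative assms H1_add_scaleR algebra_simps)

section \<open>Uniform convexity of the Hamiltonian\<close>

lemma H1_energy_tendsto:
  assumes "h \<in> H1"
  shows "(\<lambda>N. \<Sum>n\<in>{- int N..int N}. \<bar>of_int n\<bar> * (cmod (fourier h n))\<^sup>2)
    \<longlonglongrightarrow> inner (hilbert_transform (derivative h)) h"
proof -
  have "Re (fourier h n * cnj (of_real r * fourier h n)) = r * (cmod (fourier h n))\<^sup>2" for n r
    unfolding cmod_power2 by (simp add: power2_eq_square algebra_simps)
  with parseval_H1[OF assms, of "hilbert_transform (derivative h)"] show ?thesis
    by (simp only: fourier_hilbert_derivative[OF assms])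
qed

text \<open>Mean zero removes the frequency 0, and every other frequency has modulus at least
  1.\<close>

lemma norm_le_H1_energy:
  assumes h: "h \<in> H1" "fourier h 0 = 0"
  shows "(norm h)\<^sup>2 \<le> inner (hilbert_transform (derivative h)) h"
proof (rule LIMSEQ_le[OF _ H1_energy_tendsto[OF h(1)]])
  have "Re (fourier h n * cnj (fourier h n)) = (cmod (fourier h n))\<^sup>2" for n
    unfolding cmod_power2 by (simp add: power2_eq_square)
  with parseval_H1[OF h(1), of h]
  show "(\<lambda>N. \<Sum>n\<in>{- int N..int N}. (cmod (fourier h n))\<^sup>2) \<longlonglongrightarrow> (norm h)\<^sup>2"
    by (simp only: power2_norm_eq_inner)
  have "(cmod (fourier h n))\<^sup>2 \<le> \<bar>of_int n\<bar> * (cmod (fourier h n))\<^sup>2" for n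
    using h(2) mult_right_mono[of 1 "\<bar>of_int n\<bar>" "(cmod (fourier h n))\<^sup>2"] by (cases "n = 0") auto
  then show "\<exists>N0. \<forall>N\<ge>N0. (\<Sum>n\<in>{- int N..int N}. (cmod (fourier h n))\<^sup>2)
      \<le> (\<Sum>n\<in>{- int N..int N}. \<bar>of_int n\<bar> * (cmod (fourier h n))\<^sup>2)"
    by (intro exI allI impI sum_mono)
qed

text \<open>The finite estimate passes to the limit, since the partial sums of an \<open>H1\<close>
  function are bounded uniformly. Mean zero allows 0 to be dropped from the index set, as
  \<open>trig_sum_L4_bound\<close> requires.\<close>

lemma H1_L4_bound:
  assumes h: "h \<in> H1" "fourier h 0 = 0"
  shows "(LINT x|circle. (rep_L2 h x) ^ 4) \<le> 4 * (inner (hilbert_transform (derivative h)) h)\<^sup>2"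
proof (rule LIMSEQ_le)
  define B where "B = (\<Sum>\<^sub>\<infinity>n. cmod (fourier h n))"
  have "(\<lambda>N. LINT x|circle. (cmod (partial_sum (fourier h) N x)) ^ 4)
      \<longlonglongrightarrow> (LINT x|circle. (cmod (complex_of_real (rep_L2 h x))) ^ 4)"
  proof (rule integral_dominated_convergence[where w="\<lambda>_. B ^ 4"])
    show "AE x in circle. (\<lambda>N. (cmod (partial_sum (fourier h) N x)) ^ 4)
        \<longlonglongrightarrow> (cmod (complex_of_real (rep_L2 h x))) ^ 4"
      using H1_partial_sum_tendsto[OF h(1)] by eventually_elim (intro tendsto_intros)
    show "AE x in circle. norm ((cmod (partial_sum (fourier h) N x)) ^ 4) \<le> B ^ 4" for N
      using partial_sum_bounded[OF H1_abs_summable[OF h(1)]] by (auto simp: B_def intro!: power_mono)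
  qed simp_all
  then show "(\<lambda>N. LINT x|circle. (cmod (partial_sum (fourier h) N x)) ^ 4) \<longlonglongrightarrow> (LINT x|circle. (rep_L2 h x) ^ 4)"
    by (simp add: power_even_abs)
  show "(\<lambda>N. 4 * (\<Sum>n\<in>{- int N..int N}. \<bar>of_int n\<bar> * (cmod (fourier h n))\<^sup>2)\<^sup>2)
      \<longlonglongrightarrow> 4 * (inner (hilbert_transform (derivative h)) h)\<^sup>2"
    by (intro tendsto_intros H1_energy_tendsto h)
  have "(LINT x|circle. (cmod (partial_sum (fourier h) N x)) ^ 4)
      \<le> 4 * (\<Sum>n\<in>{- int N..int N}. \<bar>of_int n\<bar> * (cmod (fourier h n))\<^sup>2)\<^sup>2" for N
  proof -
    have "partial_sum (fourier h) N x = (\<Sum>n\<in>{- int N..int N} - {0}. fourier h n * cis (of_int n * x))" for x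
      unfolding partial_sum_def using h(2) by (intro sum.mono_neutral_right) auto
    moreover have "(\<Sum>n\<in>{- int N..int N} - {0}. \<bar>of_int n\<bar> * (cmod (fourier h n))\<^sup>2)
      = (\<Sum>n\<in>{- int N..int N}. \<bar>of_int n\<bar> * (cmod (fourier h n))\<^sup>2)"
      by (intro sum.mono_neutral_left) auto
    ultimately show ?thesis
      using trig_sum_L4_bound[of "{- int N..int N} - {0}" "fourier h"] by simp
  qed
  then show "\<exists>N0. \<forall>N\<ge>N0. (LINT x|circle. (cmod (partial_sum (fourier h) N x)) ^ 4)
      \<le> 4 * (\<Sum>n\<in>{- int N..int N}. \<bar>of_int n\<bar> * (cmod (fourier h n))\<^sup>2)\<^sup>2" by blast
qed

text \<open>Cauchy--Schwarz between \<open>f\<close> and \<open>g^2\<close>; the norm of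
  \<open>g^2\<close> is the square root of the fourth moment of \<open>g\<close>, hence at most
  \<open>2 * E\<close>. Stated for plain functions to serve both \<open>H1\<close> and trigonometric
  polynomials.\<close>

lemma integral_mult_square_le:
  assumes f: "square_integrable f" and g: "square_integrable (\<lambda>x. (g x)\<^sup>2)"
    and "(LINT x|circle. (g x) ^ 4) \<le> 4 * E\<^sup>2" "0 \<le> E"
  shows "\<bar>LINT x|circle. f x * (g x)\<^sup>2\<bar> \<le> 2 * norm (abs_L2 f) * E"
proof -
  have "(norm (abs_L2 (\<lambda>x. (g x)\<^sup>2)))\<^sup>2 \<le> (2 * E)\<^sup>2"
    using assms(3) norm_abs_L2[OF g] by (simp add: power_mult_distrib flip: power_mult)
  then have "norm (abs_L2 (\<lambda>x. (g x)\<^sup>2)) \<le> 2 * E"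
    by (rule power2_le_imp_le) (use assms in simp)
  then have "norm (abs_L2 f) * norm (abs_L2 (\<lambda>x. (g x)\<^sup>2)) \<le> norm (abs_L2 f) * (2 * E)"
    by (intro mult_left_mono) auto
  then show ?thesis
    using Cauchy_Schwarz_ineq2[of "abs_L2 f" "abs_L2 (\<lambda>x. (g x)\<^sup>2)"]
    by (simp add: inner_abs_L2[OF f g])
qed

text \<open>Along a line the Hamiltonian is exactly a cubic polynomial in the parameter, so the
  Hessian value is read off its coefficients. The cubic term costs at most \<open>4 * (1/6)\<close>
  of the energy, which leaves \<open>1/3\<close>.\<close>

theorem hamiltonian_uniformly_convex:
  assumes small: "\<bar>\<beta>\<bar> * sqrt N < 1 / 6"
  shows "uniformly_convex_on (Omega N) (hamiltonian \<beta>)"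
  unfolding uniformly_convex_on_def
proof (rule exI[of _ "1/3"], intro conjI ballI impI)
  show "(0::real) < 1 / 3" by simp
  fix u h assume "u \<in> Omega N \<inter> H1" and h: "h \<in> H1" "fourier h 0 = 0"
  then have u: "u \<in> H1" "(norm u)\<^sup>2 \<le> N" by (auto simp: Omega_def)
  define \<Lambda> where "\<Lambda> v = hilbert_transform (derivative v)" for v
  define E where "E = inner (\<Lambda> h) h"
  define f where "f = rep_L2 u"
  define g where "g = rep_L2 h"
  have [measurable]: "f \<in> borel_measurable borel" "g \<in> borel_measurable borel"
    unfolding f_def g_def by measurable
  obtain B where B: "AE x in circle. \<bar>f x\<bar> \<le> B" "AE x in circle. \<bar>g x\<bar> \<le> B"
  proof
    define C where "C = max (\<Sum>\<^sub>\<infinity>n. cmod (fourier u n)) (\<Sum>\<^sub>\<infinity>n. cmod (fourier h n))"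
    show "AE x in circle. \<bar>f x\<bar> \<le> C"
      unfolding f_def using H1_AE_bounded[OF u(1)] by eventually_elim (simp add: C_def)
    show "AE x in circle. \<bar>g x\<bar> \<le> C"
      unfolding g_def using H1_AE_bounded[OF h(1)] by eventually_elim (simp add: C_def)
  qed
  \<comment> \<open>Essential boundedness of \<open>H1\<close> functions makes every mixed moment
    finite, so the cube may be expanded under the integral.\<close>
  have int: "integrable circle (\<lambda>x. f x ^ i * g x ^ j)" for i j
  proof (rule circle.integrable_const_bound[where B="B ^ i * B ^ j"])
    show "AE x in circle. norm (f x ^ i * g x ^ j) \<le> B ^ i * B ^ j"
      using B by eventually_elim (auto simp: abs_mult power_abs intro!: mult_mono power_mono)
  qed measurable
  define C where "C i j = (LINT x|circle. f x ^ i * g x ^ j)" for i j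
  have cubic: "cubic_integral (u + s *\<^sub>R h) = C 3 0 + 3 * s * C 2 1 + 3 * s\<^sup>2 * C 1 2 + s ^ 3 * C 0 3" for s
  proof -
    have "AE x in circle. (rep_L2 (u + s *\<^sub>R h) x) ^ 3 = f x ^ 3 * g x ^ 0 + 3 * s * (f x ^ 2 * g x ^ 1)
        + 3 * s\<^sup>2 * (f x ^ 1 * g x ^ 2) + s ^ 3 * (f x ^ 0 * g x ^ 3)"
      using rep_add[of u "s *\<^sub>R h"] rep_scaleR[of s h]
      by eventually_elim (simp add: f_def g_def power2_eq_square power3_eq_cube algebra_simps)
    then have "cubic_integral (u + s *\<^sub>R h) = (LINT x|circle. f x ^ 3 * g x ^ 0 + 3 * s * (f x ^ 2 * g x ^ 1)
        + 3 * s\<^sup>2 * (f x ^ 1 * g x ^ 2) + s ^ 3 * (f x ^ 0 * g x ^ 3))"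
      unfolding cubic_integral_eq by (intro integral_cong_AE) measurable
    also have "\<dots> = C 3 0 + 3 * s * C 2 1 + 3 * s\<^sup>2 * C 1 2 + s ^ 3 * C 0 3"
      unfolding C_def
      by (simp only: Bochner_Integration.integral_add Bochner_Integration.integrable_add
          integrable_mult_right integral_mult_right_zero int)
    finally show ?thesis .
  qed
  \<comment> \<open>Both cross terms sit in the linear coefficient, which the second derivative does
    not see.\<close>
  define b where "b = (inner (\<Lambda> u) h + inner (\<Lambda> h) u)"
  define q where "q = E + 2 * \<beta> * C 1 2"
  have ham: "hamiltonian \<beta> (u + s *\<^sub>R h) = 1/2 * (inner (\<Lambda> u) u + s * b + s\<^sup>2 * E)
      + \<beta> / 3 * (C 3 0 + 3 * s * C 2 1 + 3 * s\<^sup>2 * C 1 2 + s ^ 3 * C 0 3)" for s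
    unfolding hamiltonian_def cubic hilbert_derivative_add_scaleR[OF u(1) h(1)] b_def E_def \<Lambda>_def
    by (simp add: inner_simps algebra_simps power2_eq_square)
  have hess: "has_hessian_value (hamiltonian \<beta>) u h q"
    unfolding has_hessian_value_def
  proof (intro exI conjI allI)
    define g' where "g' t = 1/2 * (b + 2 * t * E) + \<beta> / 3 * (3 * C 2 1 + 6 * t * C 1 2 + 3 * t\<^sup>2 * C 0 3)" for t
    show "((\<lambda>s. hamiltonian \<beta> (u + s *\<^sub>R h)) has_real_derivative g' t) (at t)" for t
      unfolding ham g'_def
      by (rule derivative_eq_intros refl | simp add: algebra_simps)+
    show "(g' has_real_derivative q) (at 0)"
      unfolding g'_def[abs_def] q_def
      by (rule derivative_eq_intros refl | simp add: algebra_simps)+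
  qed
  have normE: "(norm h)\<^sup>2 \<le> E" unfolding E_def \<Lambda>_def by (rule norm_le_H1_energy[OF h])
  then have E0: "0 \<le> E" using zero_le_power2[of "norm h"] by linarith
  have "\<bar>LINT x|circle. f x * (g x)\<^sup>2\<bar> \<le> 2 * norm (abs_L2 f) * E"
  proof (rule integral_mult_square_le)
    show "square_integrable f" unfolding f_def by (rule square_integrable_rep)
    show "square_integrable (\<lambda>x. (g x)\<^sup>2)"
      unfolding square_integrable_def using int[of 0 4] by (simp flip: power_mult)
    show "(LINT x|circle. (g x) ^ 4) \<le> 4 * E\<^sup>2"
      unfolding g_def E_def \<Lambda>_def by (rule H1_L4_bound[OF h])
  qed (rule E0)
  then have C12: "\<bar>C 1 2\<bar> \<le> 2 * norm u * E" by (simp add: C_def f_def abs_rep_L2)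
  have "norm u \<le> sqrt N" using u(2) by (simp add: real_le_rsqrt)
  have "\<bar>2 * \<beta> * C 1 2\<bar> \<le> 2 * \<bar>\<beta>\<bar> * (2 * norm u * E)"
    using mult_left_mono[OF C12, of "2 * \<bar>\<beta>\<bar>"] by (simp only: abs_mult abs_numeral)
  also have "\<dots> = 4 * (\<bar>\<beta>\<bar> * norm u) * E" by simp
  also have "\<dots> \<le> 4 * (\<bar>\<beta>\<bar> * sqrt N) * E"
    using \<open>norm u \<le> sqrt N\<close> E0 by (intro mult_right_mono mult_left_mono) auto
  also have "\<dots> \<le> 4 * (1 / 6) * E"
    using small E0 by (intro mult_right_mono mult_left_mono) auto
  finally have "1 / 3 * E \<le> q" unfolding q_def by linarith
  moreover have "1 / 3 * (norm h)\<^sup>2 \<le> 1 / 3 * E" using normE by simp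
  ultimately show "\<exists>q. has_hessian_value (hamiltonian \<beta>) u h q \<and> 1 / 3 * (norm h)\<^sup>2 \<le> q"
    using hess by (intro exI[of _ q]) simp
qed


section \<open>From Prekopa--Leindler to the logarithmic Sobolev inequality\<close>

text \<open>At \<open>s = 0\<close> both sides equal \<open>A\<close>, so the right derivative of
  their difference there cannot be negative. That derivative is
  \<open>C - B + A * ln (A / Z)\<close>; the term with \<open>D\<close> is of second order.\<close>

lemma lsi_from_small_parameter:
  fixes A B C D Z :: real
  assumes A: "0 < A" and Z: "0 < Z"
    and ev: "\<forall>\<^sub>F s in at_right 0.
      (A + s / (1 - s) * B) powr (1 - s) * Z powr s \<le> A + s / (1 - s) * C + (s / (1 - s))\<^sup>2 * D"
  shows "B - A * ln (A / Z) \<le> C"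
proof (rule ccontr)
  assume "\<not> B - A * ln (A / Z) \<le> C"
  then have neg: "C - A * (- ln A + B / A + ln Z) < 0"
    using A Z by (simp add: ln_div algebra_simps)
  define \<phi> where "\<phi> s = A + s / (1 - s) * C + (s / (1 - s))\<^sup>2 * D
     - exp ((1 - s) * ln (A + s / (1 - s) * B) + s * ln Z)" for s
  have "(\<phi> has_real_derivative C - A * (- ln A + B / A + ln Z)) (at 0)"
    unfolding \<phi>_def[abs_def]
    by (rule derivative_eq_intros refl | use A in simp)+
  from DERIV_neg_dec_right[OF this neg] obtain r where r: "0 < r" "\<And>h. 0 < h \<Longrightarrow> h < r \<Longrightarrow> \<phi> h < \<phi> 0"
    by auto
  have "((\<lambda>s. A + s / (1 - s) * B) \<longlongrightarrow> A + 0 / (1 - 0) * B) (at_right 0)"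
    by (intro tendsto_intros) auto
  then have pos: "\<forall>\<^sub>F s in at_right 0. 0 < A + s / (1 - s) * B"
    using A by (intro order_tendstoD(1)) auto
  have "\<forall>\<^sub>F s in at_right 0. s \<in> {0<..<r}" using r by (intro eventually_at_right_real)
  then have "\<forall>\<^sub>F s in at_right (0::real). False"
    using ev pos
  proof eventually_elim
    case (elim s)
    have "exp ((1 - s) * ln (A + s / (1 - s) * B) + s * ln Z) = (A + s / (1 - s) * B) powr (1 - s) * Z powr s"
      using elim Z by (simp add: powr_def exp_add)
    then have "0 \<le> \<phi> s" using elim(2) by (simp add: \<phi>_def)
    moreover have "\<phi> 0 = 0" using A by (simp add: \<phi>_def)
    ultimately show False using r(2)[of s] elim(1) by auto
  qed
  then show False by (simp add: trivial_limit_at_right_real)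
qed

text \<open>What the argument uses of Euclidean space: \<open>comb t x y\<close> stands for
  \<open>t x + (1-t) y\<close>, and \<open>d\<close> for a distance, of which only the scaling along
  segments is needed. \<open>bounded_support\<close> makes \<open>d x (comb t x y)\<close> small
  uniformly as \<open>t\<close> tends to 1.\<close>

locale strongly_log_concave_weight =
  fixes M :: "'a measure" and comb :: "real \<Rightarrow> 'a \<Rightarrow> 'a \<Rightarrow> 'a" and d :: "'a \<Rightarrow> 'a \<Rightarrow> real"
    and W :: "'a \<Rightarrow> real" and \<alpha> R :: real
  assumes PL: "\<And>t. 0 < t \<Longrightarrow> t < 1 \<Longrightarrow> prekopa_leindler t M (comb t)"
    and comb_space: "\<And>t x y. 0 < t \<Longrightarrow> t < 1 \<Longrightarrow> x \<in> space M \<Longrightarrow> y \<in> space M \<Longrightarrow> comb t x y \<in> space M"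
    and d_nonneg: "\<And>x y. 0 \<le> d x y"
    and d_comb: "\<And>t x y. 0 < t \<Longrightarrow> t < 1 \<Longrightarrow> d x (comb t x y) = (1 - t) * d x y"
    and \<alpha>_pos: "0 < \<alpha>"
    and W_int: "integrable M W" and W_nonneg: "\<And>x. 0 \<le> W x"
    and Z_pos: "0 < (LINT x|M. W x)"
    and log_concave: "\<And>t x y. 0 < t \<Longrightarrow> t < 1 \<Longrightarrow> x \<in> space M \<Longrightarrow> y \<in> space M \<Longrightarrow>
       W x powr t * W y powr (1 - t) * exp (\<alpha> * t * (1 - t) / 2 * (d x y)\<^sup>2) \<le> W (comb t x y)"
    and bounded_support: "\<And>x y. x \<in> space M \<Longrightarrow> y \<in> space M \<Longrightarrow> 0 < W x \<Longrightarrow> 0 < W y \<Longrightarrow> d x y \<le> R"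
begin

definition K :: "'a set" where "K = {x \<in> space M. 0 < W x}"

text \<open>A one-sided bound of the local slope of \<open>G\<close> by \<open>g\<close>, uniform
  over \<open>K\<close>. The slope is taken at \<open>z\<close>, because \<open>z\<close> will be
  the combined point at which the majorant is evaluated.\<close>

definition upper_slope :: "('a \<Rightarrow> real) \<Rightarrow> ('a \<Rightarrow> real) \<Rightarrow> bool" where
  "upper_slope G g \<longleftrightarrow>
     (\<forall>e>0. \<exists>r>0. \<forall>x\<in>K. \<forall>z\<in>K. d x z < r \<longrightarrow> G x \<le> G z + (g z + e) * d x z)"

lemma W_measurable [measurable]: "W \<in> borel_measurable M"
  using W_int by auto

lemma integrable_mult_W:
  assumes [measurable]: "h \<in> borel_measurable M" and "\<And>x. x \<in> K \<Longrightarrow> \<bar>h x\<bar> \<le> c"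
  shows "integrable M (\<lambda>x. h x * W x)"
proof (rule Bochner_Integration.integrable_bound)
  show "integrable M (\<lambda>x. c * W x)" using W_int by simp
  show "AE x in M. norm (h x * W x) \<le> norm (c * W x)"
  proof (rule AE_I2)
    fix x assume "x \<in> space M"
    show "norm (h x * W x) \<le> norm (c * W x)"
    proof (cases "W x = 0")
      case False
      then have "x \<in> K" using \<open>x \<in> space M\<close> W_nonneg[of x] by (simp add: K_def)
      then have "\<bar>h x\<bar> * W x \<le> \<bar>c\<bar> * W x"
        using assms(2)[of x] W_nonneg[of x] by (intro mult_right_mono) auto
      then show ?thesis using W_nonneg[of x] by (simp add: abs_mult)
    qed simp
  qed
qed measurable

lemma integrable_exp_W:
  assumes [measurable]: "h \<in> borel_measurable M" and "\<And>x. x \<in> K \<Longrightarrow> h x \<le> c"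
  shows "integrable M (\<lambda>x. exp (h x) * W x)"
  by (rule integrable_mult_W[where c="exp c"]) (use assms in auto)

lemma integral_W_mono:
  assumes "integrable M (\<lambda>x. h x * W x)" "integrable M (\<lambda>x. k x * W x)" "\<And>x. x \<in> K \<Longrightarrow> h x \<le> k x"
  shows "(LINT x|M. h x * W x) \<le> (LINT x|M. k x * W x)"
proof (rule integral_mono[OF assms(1,2)])
  fix x assume "x \<in> space M"
  show "h x * W x \<le> k x * W x"
  proof (cases "W x = 0")
    case False
    then have "x \<in> K" using \<open>x \<in> space M\<close> W_nonneg[of x] by (simp add: K_def)
    then show ?thesis using assms(3) W_nonneg by (intro mult_right_mono) auto
  qed simp
qed

text \<open>The supremum over \<open>x\<close> of \<open>G x - \<alpha> t (d x z)\<^sup>2 / (2 s)\<close>, which Prekopa--Leindler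
  asks for, is bounded by completing the square.\<close>

lemma prekopa_leindler_exp:
  assumes [measurable]: "G \<in> borel_measurable M" "g \<in> borel_measurable M"
    and C: "\<And>x. x \<in> K \<Longrightarrow> \<bar>G x\<bar> \<le> C" "\<And>x. x \<in> K \<Longrightarrow> 0 \<le> g x" "\<And>x. x \<in> K \<Longrightarrow> g x \<le> C"
    and e: "0 < e" and r: "\<And>x z. x \<in> K \<Longrightarrow> z \<in> K \<Longrightarrow> d x z < r \<Longrightarrow> G x \<le> G z + (g z + e) * d x z"
    and s: "0 < s" "s < 1" "s * R < r"
  shows "(LINT x|M. exp (G x / (1 - s)) * W x) powr (1 - s) * (LINT x|M. W x) powr s
    \<le> (LINT x|M. exp (G x + s / (1 - s) * ((g x + e)\<^sup>2 / (2 * \<alpha>))) * W x)"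
proof -
  define t where "t = 1 - s"
  have t: "0 < t" "t < 1" "1 - t = s" using s by (auto simp: t_def)
  let ?k = "\<lambda>x. s / t * ((g x + e)\<^sup>2 / (2 * \<alpha>))"
  define w where "w x = exp (G x + ?k x) * W x" for x
  have i1: "integrable M (\<lambda>x. exp (G x / t) * W x)"
    using C(1) t by (intro integrable_exp_W[where c="C / t"]) (auto simp: abs_le_iff intro!: divide_right_mono)
  have i2: "integrable M w"
    unfolding w_def
  proof (rule integrable_exp_W[where c="C + s / t * ((C + e)\<^sup>2 / (2 * \<alpha>))"])
    fix x assume x: "x \<in> K"
    have "(g x + e)\<^sup>2 \<le> (C + e)\<^sup>2" using C[OF x] e by (intro power_mono) auto
    then have "?k x \<le> s / t * ((C + e)\<^sup>2 / (2 * \<alpha>))"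
      using s t \<alpha>_pos by (intro mult_left_mono divide_right_mono) auto
    then show "G x + ?k x \<le> C + s / t * ((C + e)\<^sup>2 / (2 * \<alpha>))"
      using C(1)[OF x] by simp
  qed measurable
  have w_nonneg: "0 \<le> w x" for x using W_nonneg by (simp add: w_def)
  have "powr_mean_le t (\<integral>\<^sup>+x. exp (G x / t) * W x \<partial>M) (\<integral>\<^sup>+x. W x \<partial>M) (\<integral>\<^sup>+x. w x \<partial>M)"
  proof (rule prekopa_leindlerD[OF PL[OF t(1,2)]])
    fix x y assume xy: "x \<in> space M" "y \<in> space M"
    define z where "z = comb t x y"
    show "powr_mean_le t (exp (G x / t) * W x) (W y) (w (comb t x y))"
      unfolding powr_mean_le_def z_def[symmetric]
    proof (intro allI impI)
      fix p q :: real assume p: "0 < p" "ennreal p < ennreal (exp (G x / t) * W x)" and q: "0 < q" "ennreal q < ennreal (W y)"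
      have p': "p < exp (G x / t) * W x" and q': "q < W y"
        using p q by (auto simp: ennreal_less_iff)
      have "0 < exp (G x / t) * W x" using p(1) p' by (rule order.strict_trans)
      then have Wx: "0 < W x" by (simp add: zero_less_mult_iff)
      have Wy: "0 < W y" using q(1) q' by (rule order.strict_trans)
      have lc: "W x powr t * W y powr s * exp (\<alpha> * t * s / 2 * (d x y)\<^sup>2) \<le> W z"
        using log_concave[OF t(1,2) xy] t by (simp add: z_def)
      have Wz: "0 < W z"
        by (rule order.strict_trans2[OF _ lc]) (use Wx Wy in simp)
      have K: "x \<in> K" "z \<in> K"
        using xy Wx Wz comb_space[OF t(1,2) xy] by (auto simp: K_def z_def)
      have dz: "d x z = s * d x y" using d_comb[OF t(1,2)] t by (simp add: z_def)
      \<comment> \<open>Here the bounded support brings \<open>z\<close> within the radius in which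
        the slope estimate holds, whatever \<open>y\<close> is.\<close>
      have "d x z \<le> s * R" using bounded_support[OF xy Wx Wy] s by (simp add: dz)
      then have Gx: "G x \<le> G z + (g z + e) * d x z" using s by (intro r K) simp
      have sq: "(g z + e) * d x z \<le> \<alpha> * t * s / 2 * (d x y)\<^sup>2 + ?k z"
      proof -
        have "0 \<le> s / (2 * \<alpha> * t) * (\<alpha> * t * d x y - (g z + e))\<^sup>2"
          using s t \<alpha>_pos by simp
        also have "\<dots> = \<alpha> * t * s / 2 * (d x y)\<^sup>2 + ?k z - (g z + e) * (s * d x y)"
          using t \<alpha>_pos by (simp add: power2_diff field_simps power2_eq_square)
        finally show ?thesis by (simp add: dz)
      qed
      have "p powr t * q powr s \<le> (exp (G x / t) * W x) powr t * W y powr s"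
        using p p' q q' t s by (intro mult_mono powr_mono2) auto
      also have "\<dots> = exp (G x) * (W x powr t * W y powr s)"
        using Wx t by (simp add: powr_mult exp_powr_real)
      also have "\<dots> \<le> exp (G z + ?k z + \<alpha> * t * s / 2 * (d x y)\<^sup>2) * (W x powr t * W y powr s)"
        using Gx sq by (intro mult_right_mono) auto
      also have "\<dots> = exp (G z + ?k z) * (W x powr t * W y powr s * exp (\<alpha> * t * s / 2 * (d x y)\<^sup>2))"
        by (simp add: exp_add)
      also have "\<dots> \<le> w z"
        unfolding w_def using lc by (intro mult_left_mono) auto
      finally show "ennreal (p powr t * q powr (1 - t)) \<le> ennreal (w z)"
        using t by (intro ennreal_leI) simp
    qed
  qed (auto simp: w_def)
  then have mean: "powr_mean_le t (ennreal (LINT x|M. exp (G x / t) * W x)) (ennreal (LINT x|M. W x)) (ennreal (LINT x|M. w x))"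
    using i1 i2 W_int W_nonneg w_nonneg by (simp add: nn_integral_eq_integral)
  \<comment> \<open>\<open>powr_mean_le_real\<close> needs a strictly positive integral; the lower
    bound \<open>- C\<close> for \<open>G\<close> on \<open>K\<close> provides it.\<close>
  have "(LINT x|M. exp (- C / t) * W x) \<le> (LINT x|M. exp (G x / t) * W x)"
  proof (rule integral_W_mono[OF _ i1])
    fix x assume "x \<in> K"
    then have "- C / t \<le> G x / t" using C(1)[of x] t by (intro divide_right_mono) auto
    then show "exp (- C / t) \<le> exp (G x / t)" by simp
  qed (use W_int in simp)
  moreover have "0 < (LINT x|M. exp (- C / t) * W x)" using Z_pos by simp
  ultimately have "0 < (LINT x|M. exp (G x / t) * W x)" by linarith
  then have "(LINT x|M. exp (G x / t) * W x) powr t * (LINT x|M. W x) powr (1 - t) \<le> (LINT x|M. w x)"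
    by (intro powr_mean_le_real[OF mean]) (use Z_pos w_nonneg in auto)
  then show ?thesis unfolding w_def t(3) t_def by simp
qed

text \<open>Put \<open>\<sigma> = s / (1 - s)\<close>, so that
  \<open>G / (1 - s) = G + \<sigma> G\<close>. In \<open>prekopa_leindler_exp\<close>, bound the
  left integral below by \<open>1 + y \<le> exp y\<close> and the right one above by
  \<open>exp y \<le> 1 + y + y^2\<close> for \<open>0 \<le> y \<le> 1\<close>; the result is the
  hypothesis of \<open>lsi_from_small_parameter\<close>.\<close>

lemma entropy_exp_le:
  assumes [measurable]: "G \<in> borel_measurable M" "g \<in> borel_measurable M"
    and C: "\<And>x. x \<in> K \<Longrightarrow> \<bar>G x\<bar> \<le> C" "\<And>x. x \<in> K \<Longrightarrow> 0 \<le> g x" "\<And>x. x \<in> K \<Longrightarrow> g x \<le> C"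
    and slope: "upper_slope G g"
  shows "(LINT x|M. G x * exp (G x) * W x)
      - (LINT x|M. exp (G x) * W x) * ln ((LINT x|M. exp (G x) * W x) / (LINT x|M. W x))
    \<le> 1 / (2 * \<alpha>) * (LINT x|M. (g x)\<^sup>2 * exp (G x) * W x)"
proof -
  define A where "A = (LINT x|M. exp (G x) * W x)"
  define B where "B = (LINT x|M. G x * exp (G x) * W x)"
  define Z where "Z = (LINT x|M. W x)"
  define Q where "Q j = (LINT x|M. g x ^ j * exp (G x) * W x)" for j
  have eG: "exp (G x) \<le> exp C" if "x \<in> K" for x using C(1)[OF that] by simp
  have i0: "integrable M (\<lambda>x. exp (G x) * W x)"
    using C(1) by (intro integrable_exp_W[where c=C]) (auto simp: abs_le_iff)
  have i1: "integrable M (\<lambda>x. G x * exp (G x) * W x)"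
    by (rule integrable_mult_W[where c="C * exp C"])
       (use eG in \<open>auto simp: abs_mult intro!: mult_mono C(1) order.trans[OF abs_ge_zero C(1)]\<close>)
  have iQ: "integrable M (\<lambda>x. g x ^ j * exp (G x) * W x)" for j
  proof (rule integrable_mult_W[where c="C ^ j * exp C"])
    fix x assume x: "x \<in> K"
    have "g x ^ j * exp (G x) \<le> C ^ j * exp C"
      using C[OF x] eG[OF x] by (intro mult_mono power_mono) auto
    then show "\<bar>g x ^ j * exp (G x)\<bar> \<le> C ^ j * exp C"
      using C(2)[OF x] by (simp add: abs_mult)
  qed measurable
  have "(LINT x|M. exp (- C) * W x) \<le> A"
    unfolding A_def by (rule integral_W_mono[OF _ i0]) (use C W_int in \<open>force simp: abs_le_iff\<close>)+
  moreover have "0 < (LINT x|M. exp (- C) * W x)" using Z_pos by simp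
  ultimately have A_pos: "0 < A" by linarith
  \<comment> \<open>\<open>e\<close> stays fixed while \<open>s\<close> tends to 0, since the
    admissible \<open>s\<close> depend on \<open>e\<close> through \<open>r\<close>; only afterwards
    does \<open>e\<close> tend to 0.\<close>
  have key: "B - A * ln (A / Z) \<le> (Q 2 + 2 * e * Q 1 + e\<^sup>2 * A) / (2 * \<alpha>)" if e: "0 < e" for e
  proof (rule lsi_from_small_parameter[OF A_pos])
    show "0 < Z" using Z_pos by (simp add: Z_def)
    obtain r where r: "0 < r" "\<And>x z. x \<in> K \<Longrightarrow> z \<in> K \<Longrightarrow> d x z < r \<Longrightarrow> G x \<le> G z + (g z + e) * d x z"
      using slope e unfolding upper_slope_def by meson
    define L where "L = (C + e)\<^sup>2 / (2 * \<alpha>)"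
    define k where "k x = (g x + e)\<^sup>2 / (2 * \<alpha>)" for x
    have k: "0 \<le> k x" "k x \<le> L" if x: "x \<in> K" for x
      using C[OF x] e \<alpha>_pos unfolding k_def L_def by (auto intro!: divide_right_mono power_mono)
    have [measurable]: "k \<in> borel_measurable M" unfolding k_def by measurable
    have kint: "(LINT x|M. k x * exp (G x) * W x) = (Q 2 + 2 * e * Q 1 + e\<^sup>2 * A) / (2 * \<alpha>)"
    proof -
      have "(LINT x|M. k x * exp (G x) * W x)
        = (LINT x|M. (g x ^ 2 * exp (G x) * W x + 2 * e * (g x ^ 1 * exp (G x) * W x) + e\<^sup>2 * (exp (G x) * W x)) / (2 * \<alpha>))"
        by (intro Bochner_Integration.integral_cong refl) (simp add: k_def power2_sum algebra_simps)
      also have "\<dots> = (Q 2 + 2 * e * Q 1 + e\<^sup>2 * A) / (2 * \<alpha>)"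
        unfolding Q_def A_def
        by (simp only: integral_divide_zero Bochner_Integration.integral_add Bochner_Integration.integrable_add
            integrable_mult_right integral_mult_right_zero iQ i0)
      finally show ?thesis .
    qed
    have ik: "integrable M (\<lambda>x. k x ^ j * exp (G x) * W x)" for j
    proof (rule integrable_mult_W[where c="L ^ j * exp C"])
      fix x assume x: "x \<in> K"
      have "k x ^ j * exp (G x) \<le> L ^ j * exp C"
        using k[OF x] eG[OF x] order.trans[OF k[OF x]] by (intro mult_mono power_mono) auto
      then show "\<bar>k x ^ j * exp (G x)\<bar> \<le> L ^ j * exp C" using k(1)[OF x] by (simp add: abs_mult)
    qed measurable
    have lim: "((\<lambda>s. s * R) \<longlongrightarrow> 0 * R) (at_right 0)" "((\<lambda>s. s / (1 - s) * L) \<longlongrightarrow> 0 / (1 - 0) * L) (at_right 0)"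
      "((\<lambda>s. A + s / (1 - s) * B) \<longlongrightarrow> A + 0 / (1 - 0) * B) (at_right 0)"
      by (intro tendsto_intros; simp)+
    have "\<forall>\<^sub>F s in at_right 0. s * R < r" "\<forall>\<^sub>F s in at_right 0. s / (1 - s) * L < 1"
      "\<forall>\<^sub>F s in at_right 0. 0 < A + s / (1 - s) * B"
      using order_tendstoD(2)[OF lim(1), of r] order_tendstoD(2)[OF lim(2), of 1] order_tendstoD(1)[OF lim(3), of 0] r(1) A_pos
      by simp_all
    moreover have "\<forall>\<^sub>F s in at_right (0::real). s \<in> {0<..<1}" by (intro eventually_at_right_real) simp
    ultimately show "\<forall>\<^sub>F s in at_right 0. (A + s / (1 - s) * B) powr (1 - s) * Z powr s
      \<le> A + s / (1 - s) * ((Q 2 + 2 * e * Q 1 + e\<^sup>2 * A) / (2 * \<alpha>)) + (s / (1 - s))\<^sup>2 * (LINT x|M. (k x)\<^sup>2 * exp (G x) * W x)"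
    proof eventually_elim
      case (elim s)
      then have s: "0 < s" "s < 1" "s * R < r" by auto
      define \<sigma> where "\<sigma> = s / (1 - s)"
      have \<sigma>: "0 < \<sigma>" "\<sigma> * L < 1" "0 < A + \<sigma> * B" using s elim by (auto simp: \<sigma>_def)
      have G1: "G x / (1 - s) = G x + \<sigma> * G x" for x
        using s by (simp add: \<sigma>_def field_simps)
      have i3: "integrable M (\<lambda>x. exp (G x / (1 - s)) * W x)"
        using C(1) s by (intro integrable_exp_W[where c="C / (1 - s)"]) (auto simp: abs_le_iff intro!: divide_right_mono)
      have i4: "integrable M (\<lambda>x. exp (G x + \<sigma> * k x) * W x)"
      proof (rule integrable_exp_W[where c="C + \<sigma> * L"])
        fix x assume x: "x \<in> K"
        have "\<sigma> * k x \<le> \<sigma> * L" using k[OF x] \<sigma> by simp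
        then show "G x + \<sigma> * k x \<le> C + \<sigma> * L" using C(1)[OF x] by simp
      qed measurable
      have "A + \<sigma> * B = (LINT x|M. exp (G x) * W x + \<sigma> * (G x * exp (G x) * W x))"
        unfolding A_def B_def using i0 i1 by simp
      also have "\<dots> = (LINT x|M. (exp (G x) + \<sigma> * (G x * exp (G x))) * W x)"
        by (simp add: algebra_simps)
      also have "\<dots> \<le> (LINT x|M. exp (G x / (1 - s)) * W x)"
      proof (rule integral_W_mono[OF _ i3])
        show "integrable M (\<lambda>x. (exp (G x) + \<sigma> * (G x * exp (G x))) * W x)"
          using Bochner_Integration.integrable_add[OF i0 integrable_mult_right[OF i1, of \<sigma>]]
          by (simp add: algebra_simps)
        fix x
        have "exp (G x) * (1 + \<sigma> * G x) \<le> exp (G x) * exp (\<sigma> * G x)"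
          by (intro mult_left_mono exp_ge_add_one_self) auto
        then show "exp (G x) + \<sigma> * (G x * exp (G x)) \<le> exp (G x / (1 - s))"
          unfolding G1 exp_add by (simp add: algebra_simps)
      qed
      finally have "(A + \<sigma> * B) powr (1 - s) * Z powr s \<le> (LINT x|M. exp (G x / (1 - s)) * W x) powr (1 - s) * Z powr s"
        using \<sigma> s by (intro mult_right_mono powr_mono2) auto
      also have "\<dots> \<le> (LINT x|M. exp (G x + \<sigma> * k x) * W x)"
        unfolding Z_def \<sigma>_def k_def
        by (rule prekopa_leindler_exp[OF assms(1,2) C e r(2) s])
      also have "\<dots> \<le> (LINT x|M. (exp (G x) + \<sigma> * (k x ^ 1 * exp (G x)) + \<sigma>\<^sup>2 * (k x ^ 2 * exp (G x))) * W x)"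
      proof (rule integral_W_mono[OF i4])
        show "integrable M (\<lambda>x. (exp (G x) + \<sigma> * (k x ^ 1 * exp (G x)) + \<sigma>\<^sup>2 * (k x ^ 2 * exp (G x))) * W x)"
          using Bochner_Integration.integrable_add[OF Bochner_Integration.integrable_add[OF i0 integrable_mult_right[OF ik[of 1], of \<sigma>]]
              integrable_mult_right[OF ik[of 2], of "\<sigma>\<^sup>2"]]
          by (simp add: algebra_simps)
        fix x assume x: "x \<in> K"
        have "\<sigma> * k x \<le> \<sigma> * L" using k[OF x] \<sigma> by simp
        then have "\<sigma> * k x \<le> 1" using \<sigma> by linarith
        then have "exp (\<sigma> * k x) \<le> 1 + \<sigma> * k x + (\<sigma> * k x)\<^sup>2"
          using k[OF x] \<sigma> by (intro exp_bound) auto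
        then have "exp (G x) * exp (\<sigma> * k x) \<le> exp (G x) * (1 + \<sigma> * k x + (\<sigma> * k x)\<^sup>2)"
          by (intro mult_left_mono) auto
        then show "exp (G x + \<sigma> * k x) \<le> exp (G x) + \<sigma> * (k x ^ 1 * exp (G x)) + \<sigma>\<^sup>2 * (k x ^ 2 * exp (G x))"
          by (simp add: exp_add algebra_simps power_mult_distrib)
      qed
      also have "\<dots> = (LINT x|M. exp (G x) * W x + \<sigma> * (k x ^ 1 * exp (G x) * W x) + \<sigma>\<^sup>2 * (k x ^ 2 * exp (G x) * W x))"
        by (simp add: algebra_simps)
      also have "\<dots> = A + \<sigma> * (LINT x|M. k x ^ 1 * exp (G x) * W x) + \<sigma>\<^sup>2 * (LINT x|M. (k x)\<^sup>2 * exp (G x) * W x)"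
        unfolding A_def
        by (simp only: Bochner_Integration.integral_add Bochner_Integration.integrable_add
            integrable_mult_right integral_mult_right_zero ik i0)
      finally show ?case by (simp add: \<sigma>_def kint)
    qed
  qed
  have "((\<lambda>e. (Q 2 + 2 * e * Q 1 + e\<^sup>2 * A) / (2 * \<alpha>)) \<longlongrightarrow> (Q 2 + 2 * 0 * Q 1 + 0\<^sup>2 * A) / (2 * \<alpha>)) (at_right 0)"
    by (intro tendsto_intros) (use \<alpha>_pos in simp)
  then have "B - A * ln (A / Z) \<le> (Q 2 + 2 * 0 * Q 1 + 0\<^sup>2 * A) / (2 * \<alpha>)"
    by (rule tendsto_lowerbound) (use key in \<open>auto simp: eventually_at_right_field intro!: exI[of _ 1]\<close>)
  then show ?thesis unfolding A_def B_def Z_def Q_def by simp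
qed

text \<open>The chain rule for \<open>ln (f^2 + \<delta>)\<close> without derivatives: expand
  \<open>(f x)^2\<close> around \<open>z\<close>, divide by \<open>(f z)^2 + \<delta>\<close> and
  use \<open>1 + y \<le> exp y\<close>. The error terms are absorbed because this denominator is at
  least \<delta>.\<close>

lemma upper_slope_ln:
  assumes C: "\<And>x. x \<in> K \<Longrightarrow> \<bar>f x\<bar> \<le> C" "\<And>x. x \<in> K \<Longrightarrow> 0 \<le> g x" "\<And>x. x \<in> K \<Longrightarrow> g x \<le> C"
    and slope: "\<And>e. 0 < e \<Longrightarrow> \<exists>r>0. \<forall>x\<in>K. \<forall>z\<in>K. d x z < r \<longrightarrow> \<bar>f x - f z\<bar> \<le> (g z + e) * d x z"
    and \<delta>: "0 < \<delta>"
  shows "upper_slope (\<lambda>x. ln ((f x)\<^sup>2 + \<delta>)) (\<lambda>x. 2 * \<bar>f x\<bar> * g x / ((f x)\<^sup>2 + \<delta>))"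
  unfolding upper_slope_def
proof (intro allI impI)
  fix e :: real assume e: "0 < e"
  show "\<exists>r>0. \<forall>x\<in>K. \<forall>z\<in>K. d x z < r \<longrightarrow>
    ln ((f x)\<^sup>2 + \<delta>) \<le> ln ((f z)\<^sup>2 + \<delta>) + (2 * \<bar>f z\<bar> * g z / ((f z)\<^sup>2 + \<delta>) + e) * d x z"
  proof (cases "K = {}")
    case False
    then have C0: "0 \<le> C" using C(1) abs_ge_zero order_trans by blast
    \<comment> \<open>Half of the error budget \<open>e * \<delta>\<close> goes to the slope error
      \<open>2 * C * e'\<close>, the other half, through \<open>r'\<close>, to the quadratic
      remainder. The cap 1 ensures \<open>g z + e' \<le> C + 1\<close>.\<close>
    define e' where "e' = min 1 (e * \<delta> / (4 * (C + 1)))"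
    have e': "0 < e'" "e' \<le> 1" "2 * C * e' \<le> e * \<delta> / 2"
    proof -
      show "0 < e'" "e' \<le> 1" using e \<delta> C0 by (auto simp: e'_def)
      have "2 * C * e' \<le> 2 * (C + 1) * (e * \<delta> / (4 * (C + 1)))"
        using \<open>0 < e'\<close> C0 by (intro mult_mono) (auto simp: e'_def)
      also have "\<dots> = e * \<delta> / 2" using C0 by (simp add: field_simps)
      finally show "2 * C * e' \<le> e * \<delta> / 2" .
    qed
    obtain r where r: "0 < r" "\<And>x z. x \<in> K \<Longrightarrow> z \<in> K \<Longrightarrow> d x z < r \<Longrightarrow> \<bar>f x - f z\<bar> \<le> (g z + e') * d x z"
      using slope[OF e'(1)] by meson
    define r' where "r' = min r (e * \<delta> / (2 * (C + 1)\<^sup>2))"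
    show ?thesis
    proof (intro exI[of _ r'] conjI ballI impI)
      show "0 < r'" using r e \<delta> C0 by (simp add: r'_def)
      fix x z assume x: "x \<in> K" and z: "z \<in> K" and dr: "d x z < r'"
      define D where "D = d x z"
      define P where "P = (f z)\<^sup>2 + \<delta>"
      have D0: "0 \<le> D" and P0: "\<delta> \<le> P" by (auto simp: D_def P_def d_nonneg)
      have fx: "\<bar>f x - f z\<bar> \<le> (g z + e') * D" using r(2)[OF x z] dr by (simp add: r'_def D_def)
      have ge: "0 \<le> g z + e'" "g z + e' \<le> C + 1" using C(2,3)[OF z] e' by auto
      have small: "(C + 1)\<^sup>2 * D \<le> e * \<delta> / 2"
      proof -
        have "(C + 1)\<^sup>2 * D \<le> (C + 1)\<^sup>2 * (e * \<delta> / (2 * (C + 1)\<^sup>2))"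
          using dr by (intro mult_left_mono) (auto simp: r'_def D_def)
        also have "\<dots> = e * \<delta> / 2" using C0 by (simp add: field_simps)
        finally show ?thesis .
      qed
      have "(f x)\<^sup>2 = (f z)\<^sup>2 + 2 * f z * (f x - f z) + (f x - f z)\<^sup>2"
        by (simp add: power2_eq_square algebra_simps)
      also have "\<dots> \<le> (f z)\<^sup>2 + 2 * \<bar>f z\<bar> * ((g z + e') * D) + ((g z + e') * D)\<^sup>2"
      proof (intro add_mono order_refl)
        have "f z * (f x - f z) \<le> \<bar>f z\<bar> * \<bar>f x - f z\<bar>" by (metis abs_ge_self abs_mult)
        also have "\<dots> \<le> \<bar>f z\<bar> * ((g z + e') * D)" using fx by (intro mult_left_mono) auto
        finally show "2 * f z * (f x - f z) \<le> 2 * \<bar>f z\<bar> * ((g z + e') * D)" by simp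
        show "(f x - f z)\<^sup>2 \<le> ((g z + e') * D)\<^sup>2"
          using fx by (metis abs_ge_zero power2_abs power_mono)
      qed
      also have "\<dots> = (f z)\<^sup>2 + (2 * \<bar>f z\<bar> * g z + (2 * \<bar>f z\<bar> * e' + (g z + e')\<^sup>2 * D)) * D"
        by (simp add: power2_eq_square algebra_simps)
      also have "\<dots> \<le> (f z)\<^sup>2 + (2 * \<bar>f z\<bar> * g z + e * P) * D"
      proof (intro add_left_mono mult_right_mono D0)
        have "2 * \<bar>f z\<bar> * e' \<le> 2 * C * e'" using C(1)[OF z] e' by (intro mult_right_mono mult_left_mono) auto
        moreover have "(g z + e')\<^sup>2 * D \<le> (C + 1)\<^sup>2 * D" using ge D0 by (intro mult_right_mono power_mono) auto
        moreover have "e * \<delta> \<le> e * P" using e P0 by simp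
        ultimately show "2 * \<bar>f z\<bar> * e' + (g z + e')\<^sup>2 * D \<le> e * P" using e'(3) small by linarith
      qed
      finally have "(f x)\<^sup>2 + \<delta> \<le> P + (2 * \<bar>f z\<bar> * g z + e * P) * D" by (simp add: P_def)
      also have "\<dots> = P * (1 + (2 * \<bar>f z\<bar> * g z / P + e) * D)" using P0 \<delta> by (simp add: field_simps)
      also have "\<dots> \<le> P * exp ((2 * \<bar>f z\<bar> * g z / P + e) * D)"
        using P0 \<delta> by (intro mult_left_mono exp_ge_add_one_self) auto
      finally have "(f x)\<^sup>2 + \<delta> \<le> P * exp ((2 * \<bar>f z\<bar> * g z / P + e) * D)" .
      moreover have "0 < (f x)\<^sup>2 + \<delta>" using \<delta> by (simp add: add_nonneg_pos)
      ultimately have "ln ((f x)\<^sup>2 + \<delta>) \<le> ln (P * exp ((2 * \<bar>f z\<bar> * g z / P + e) * D))"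
        by (subst ln_le_cancel_iff) auto
      also have "\<dots> = ln P + (2 * \<bar>f z\<bar> * g z / P + e) * D" using P0 \<delta> by (simp add: ln_mult)
      finally show "ln ((f x)\<^sup>2 + \<delta>) \<le> ln ((f z)\<^sup>2 + \<delta>) + (2 * \<bar>f z\<bar> * g z / ((f z)\<^sup>2 + \<delta>) + e) * d x z"
        by (simp add: P_def D_def)
    qed
  qed (auto intro: exI[of _ 1])
qed

text \<open>\<open>entropy_exp_le\<close> for \<open>G = ln (f^2 + \<delta>)\<close>, whose slope
  \<open>h\<close> satisfies \<open>h^2 * exp G = 4 g^2 f^2 / (f^2 + \<delta>) \<le> 4 g^2\<close>;
  this 4 turns \<open>1 / (2 \<alpha>)\<close> into \<open>2 / \<alpha>\<close>. On the left,
  monotonicity of \<open>ln\<close> splits off \<open>f^2 ln f^2\<close> and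
  \<open>\<delta> ln \<delta>\<close>.\<close>

lemma log_sobolev_perturbed:
  assumes [measurable]: "f \<in> borel_measurable M" "g \<in> borel_measurable M"
    and C: "\<And>x. x \<in> K \<Longrightarrow> \<bar>f x\<bar> \<le> C" "\<And>x. x \<in> K \<Longrightarrow> 0 \<le> g x" "\<And>x. x \<in> K \<Longrightarrow> g x \<le> C"
    and slope: "\<And>e. 0 < e \<Longrightarrow> \<exists>r>0. \<forall>x\<in>K. \<forall>z\<in>K. d x z < r \<longrightarrow> \<bar>f x - f z\<bar> \<le> (g z + e) * d x z"
    and \<delta>: "0 < \<delta>" "\<delta> < 1"
  shows "(LINT x|M. (f x)\<^sup>2 * ln ((f x)\<^sup>2) * W x) + \<delta> * ln \<delta> * (LINT x|M. W x)
      - ((LINT x|M. (f x)\<^sup>2 * W x) + \<delta> * (LINT x|M. W x))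
        * ln (((LINT x|M. (f x)\<^sup>2 * W x) + \<delta> * (LINT x|M. W x)) / (LINT x|M. W x))
    \<le> 2 / \<alpha> * (LINT x|M. (g x)\<^sup>2 * W x)"
proof -
  have "\<exists>x. x \<in> K"
  proof (rule ccontr)
    assume "\<nexists>x. x \<in> K"
    then have "W x = 0" if "x \<in> space M" for x
      using that W_nonneg[of x] by (force simp: K_def)
    then have "(LINT x|M. W x) = (LINT x|M. 0)" by (intro Bochner_Integration.integral_cong) auto
    then show False using Z_pos by simp
  qed
  then have C0: "0 \<le> C" using C(1) abs_ge_zero order_trans by blast
  define G where "G x = ln ((f x)\<^sup>2 + \<delta>)" for x
  define h where "h x = 2 * \<bar>f x\<bar> * g x / ((f x)\<^sup>2 + \<delta>)" for x
  have P: "0 < (f x)\<^sup>2 + \<delta>" for x using \<delta> by (simp add: add_nonneg_pos)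
  have eG: "exp (G x) = (f x)\<^sup>2 + \<delta>" for x using P by (simp add: G_def)
  have f2: "(f x)\<^sup>2 \<le> C\<^sup>2" if "x \<in> K" for x using C(1)[OF that] C0 by (metis abs_le_square_iff abs_of_nonneg)
  have [measurable]: "G \<in> borel_measurable M" "h \<in> borel_measurable M"
    unfolding G_def h_def by measurable
  define C1 where "C1 = max (max \<bar>ln \<delta>\<bar> \<bar>ln (C\<^sup>2 + \<delta>)\<bar>) (2 * C * C / \<delta>)"
  have G_bd: "\<bar>G x\<bar> \<le> C1" if x: "x \<in> K" for x
  proof -
    have "ln \<delta> \<le> G x" "G x \<le> ln (C\<^sup>2 + \<delta>)"
      unfolding G_def using \<delta> f2[OF x] P[of x] by (auto intro!: ln_mono add_nonneg_pos)
    then show ?thesis by (auto simp: C1_def)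
  qed
  have h_nn: "0 \<le> h x" if x: "x \<in> K" for x
    using C(2)[OF x] P[of x] by (simp add: h_def)
  have h_bd: "h x \<le> C1" if x: "x \<in> K" for x
  proof -
    have "2 * \<bar>f x\<bar> * g x / ((f x)\<^sup>2 + \<delta>) \<le> 2 * C * C / \<delta>"
      using C[OF x] C0 \<delta> by (intro frac_le mult_mono) auto
    then show ?thesis by (simp add: h_def C1_def)
  qed
  have slope': "upper_slope G h"
    unfolding G_def h_def by (rule upper_slope_ln[OF C slope \<delta>(1)])
  have ent: "(LINT x|M. G x * exp (G x) * W x)
      - (LINT x|M. exp (G x) * W x) * ln ((LINT x|M. exp (G x) * W x) / (LINT x|M. W x))
    \<le> 1 / (2 * \<alpha>) * (LINT x|M. (h x)\<^sup>2 * exp (G x) * W x)"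
    by (rule entropy_exp_le[OF _ _ G_bd h_nn h_bd slope']) measurable
  have if2: "integrable M (\<lambda>x. (f x)\<^sup>2 * W x)"
    by (rule integrable_mult_W[where c="C\<^sup>2"]) (use f2 in auto)
  have ig2: "integrable M (\<lambda>x. (g x)\<^sup>2 * W x)"
    by (rule integrable_mult_W[where c="C\<^sup>2"]) (use C in \<open>auto intro!: power_mono\<close>)
  have A: "(LINT x|M. exp (G x) * W x) = (LINT x|M. (f x)\<^sup>2 * W x) + \<delta> * (LINT x|M. W x)"
    unfolding eG using if2 W_int by (simp add: distrib_right)
  have xlnx: "\<bar>y * ln y\<bar> \<le> 1 + c\<^sup>2" if "0 \<le> y" "y \<le> c" for y c :: real
  proof (cases "y = 0")
    case False
    then have y: "0 < y" using that by simp
    have "y * ln (inverse y) \<le> y * (inverse y - 1)"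
      using y by (intro mult_left_mono ln_le_minus_one) auto
    then have "- 1 \<le> y * ln y" using y by (simp add: ln_inverse algebra_simps)
    moreover have "y * ln y \<le> y * y"
      using y ln_le_minus_one[of y] by (intro mult_left_mono) auto
    moreover have "y * y \<le> c\<^sup>2" using that by (simp add: power2_eq_square mult_mono)
    moreover have "0 \<le> c\<^sup>2" by simp
    ultimately show ?thesis unfolding abs_le_iff by linarith
  qed simp
  have ifl: "integrable M (\<lambda>x. (f x)\<^sup>2 * ln ((f x)\<^sup>2) * W x)"
    by (rule integrable_mult_W[where c="1 + (C\<^sup>2)\<^sup>2"], measurable) (rule xlnx, use f2 in auto)
  have iGe: "integrable M (\<lambda>x. G x * exp (G x) * W x)"
    by (rule integrable_mult_W[where c="1 + (C\<^sup>2 + \<delta>)\<^sup>2"])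
       (use f2 xlnx P in \<open>auto simp: eG G_def mult.commute less_imp_le\<close>)
  have "(LINT x|M. (f x)\<^sup>2 * ln ((f x)\<^sup>2) * W x) + \<delta> * ln \<delta> * (LINT x|M. W x)
      = (LINT x|M. ((f x)\<^sup>2 * ln ((f x)\<^sup>2) + \<delta> * ln \<delta>) * W x)"
    using ifl W_int by (simp add: distrib_right)
  also have "\<dots> \<le> (LINT x|M. G x * exp (G x) * W x)"
  proof (rule integral_W_mono[OF _ iGe])
    show "integrable M (\<lambda>x. ((f x)\<^sup>2 * ln ((f x)\<^sup>2) + \<delta> * ln \<delta>) * W x)"
      using ifl W_int by (simp add: distrib_right)
    fix x
    have "(f x)\<^sup>2 * ln ((f x)\<^sup>2) \<le> (f x)\<^sup>2 * ln ((f x)\<^sup>2 + \<delta>)"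
    proof (cases "f x = 0")
      case False
      then show ?thesis using \<delta> by (intro mult_left_mono ln_mono) auto
    qed simp
    moreover have "\<delta> * ln \<delta> \<le> \<delta> * ln ((f x)\<^sup>2 + \<delta>)"
      using \<delta> P[of x] by (intro mult_left_mono ln_mono) auto
    ultimately show "(f x)\<^sup>2 * ln ((f x)\<^sup>2) + \<delta> * ln \<delta> \<le> G x * exp (G x)"
      unfolding eG unfolding G_def by (simp add: algebra_simps)
  qed
  finally have L: "(LINT x|M. (f x)\<^sup>2 * ln ((f x)\<^sup>2) * W x) + \<delta> * ln \<delta> * (LINT x|M. W x)
    \<le> (LINT x|M. G x * exp (G x) * W x)" .
  have h_le: "(h x)\<^sup>2 * exp (G x) \<le> 4 * (g x)\<^sup>2" if x: "x \<in> K" for x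
  proof -
    have "(h x)\<^sup>2 * exp (G x) = 4 * (g x)\<^sup>2 * ((f x)\<^sup>2 / ((f x)\<^sup>2 + \<delta>))"
    proof -
      define p where "p = (f x)\<^sup>2 + \<delta>"
      have "p > 0" using P[of x] by (simp add: p_def)
      then have "(2 * \<bar>f x\<bar> * g x / p)\<^sup>2 * p = 4 * (g x)\<^sup>2 * ((f x)\<^sup>2 / p)"
        by (simp add: power_mult_distrib power_divide power2_eq_square[of p])
      then show ?thesis unfolding eG h_def p_def .
    qed
    also have "\<dots> \<le> 4 * (g x)\<^sup>2 * 1"
      using P[of x] \<delta> by (intro mult_left_mono) auto
    finally show ?thesis by simp
  qed
  have "(LINT x|M. (h x)\<^sup>2 * exp (G x) * W x) \<le> (LINT x|M. 4 * (g x)\<^sup>2 * W x)"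
  proof (rule integral_W_mono)
    show "integrable M (\<lambda>x. (h x)\<^sup>2 * exp (G x) * W x)"
    proof (rule integrable_mult_W[where c="4 * C\<^sup>2"])
      fix x assume x: "x \<in> K"
      have "(g x)\<^sup>2 \<le> C\<^sup>2" using C[OF x] by (intro power_mono) auto
      then show "\<bar>(h x)\<^sup>2 * exp (G x)\<bar> \<le> 4 * C\<^sup>2" using h_le[OF x] by (simp add: abs_mult)
    qed measurable
    show "integrable M (\<lambda>x. 4 * (g x)\<^sup>2 * W x)" using ig2 by (simp add: mult.assoc)
  qed (rule h_le)
  then have "1 / (2 * \<alpha>) * (LINT x|M. (h x)\<^sup>2 * exp (G x) * W x) \<le> 1 / (2 * \<alpha>) * (LINT x|M. 4 * (g x)\<^sup>2 * W x)"
    using \<alpha>_pos by (intro mult_left_mono) auto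
  also have "\<dots> = 2 / \<alpha> * (LINT x|M. (g x)\<^sup>2 * W x)" by (simp add: mult.assoc)
  finally show ?thesis using ent L unfolding A by linarith
qed

theorem log_sobolev:
  assumes [measurable]: "f \<in> borel_measurable M" "g \<in> borel_measurable M"
    and C: "\<And>x. x \<in> K \<Longrightarrow> \<bar>f x\<bar> \<le> C" "\<And>x. x \<in> K \<Longrightarrow> 0 \<le> g x" "\<And>x. x \<in> K \<Longrightarrow> g x \<le> C"
    and slope: "\<And>e. 0 < e \<Longrightarrow> \<exists>r>0. \<forall>x\<in>K. \<forall>z\<in>K. d x z < r \<longrightarrow> \<bar>f x - f z\<bar> \<le> (g z + e) * d x z"
  defines "m \<equiv> (LINT x|M. (f x)\<^sup>2 * W x) / (LINT x|M. W x)"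
  shows "(LINT x|M. (f x)\<^sup>2 * ln ((f x)\<^sup>2 / m) * W x) \<le> 2 / \<alpha> * (LINT x|M. (g x)\<^sup>2 * W x)"
proof -
  define A where "A = (LINT x|M. (f x)\<^sup>2 * W x)"
  define Z where "Z = (LINT x|M. W x)"
  define L where "L = (LINT x|M. (f x)\<^sup>2 * ln ((f x)\<^sup>2) * W x)"
  define E where "E = 2 / \<alpha> * (LINT x|M. (g x)\<^sup>2 * W x)"
  have A_nn: "0 \<le> A" unfolding A_def using W_nonneg by simp
  have E_nn: "0 \<le> E" unfolding E_def using W_nonneg \<alpha>_pos by simp
  have Z: "0 < Z" using Z_pos by (simp add: Z_def)
  show ?thesis
  \<comment> \<open>For \<open>A = 0\<close> also \<open>m = 0\<close>, and the conventions
    \<open>x / 0 = 0\<close> and \<open>ln 0 = 0\<close> make the left integrand vanish.\<close>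
  proof (cases "A = 0")
    case True
    then show ?thesis using E_nn unfolding m_def A_def[symmetric] E_def[symmetric] by simp
  next
    case False
    then have A: "0 < A" using A_nn by simp
    have bound: "L + \<delta> * ln \<delta> * Z - (A + \<delta> * Z) * ln ((A + \<delta> * Z) / Z) \<le> E" if "0 < \<delta>" "\<delta> < 1" for \<delta>
      unfolding L_def A_def Z_def E_def
      by (rule log_sobolev_perturbed[OF assms(1,2) C slope that])
    have "((\<lambda>\<delta>. L + \<delta> * ln \<delta> * Z - (A + \<delta> * Z) * ln ((A + \<delta> * Z) / Z)) \<longlongrightarrow>
        L + 0 * Z - (A + 0 * Z) * ln ((A + 0 * Z) / Z)) (at_right 0)"
    proof (intro tendsto_intros)
      show "((\<lambda>\<delta>::real. \<delta> * ln \<delta>) \<longlongrightarrow> 0) (at_right 0)"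
      proof -
        have "((\<lambda>\<delta>::real. - (ln (inverse \<delta>) / inverse \<delta>)) \<longlongrightarrow> - 0) (at_right 0)"
          by (intro tendsto_minus filterlim_compose[OF ln_x_over_x_tendsto_0 filterlim_inverse_at_top_right])
        moreover have "\<forall>\<^sub>F \<delta> in at_right 0. - (ln (inverse \<delta>) / inverse \<delta>) = \<delta> * ln (\<delta>::real)"
          by (auto simp: eventually_at_right_field ln_inverse divide_inverse intro!: exI[of _ 1])
        ultimately show ?thesis by (simp add: filterlim_cong)
      qed
    qed (use A Z in auto)
    then have "L + 0 * Z - (A + 0 * Z) * ln ((A + 0 * Z) / Z) \<le> E"
      by (rule tendsto_upperbound)
         (use bound in \<open>auto simp: eventually_at_right_field intro!: exI[of _ 1]\<close>)
    then have main: "L - A * ln (A / Z) \<le> E" by simp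
    have f2: "(f x)\<^sup>2 * ln ((f x)\<^sup>2 / m) * W x = (f x)\<^sup>2 * ln ((f x)\<^sup>2) * W x - ln m * ((f x)\<^sup>2 * W x)" for x
    proof (cases "f x = 0")
      case False
      moreover have "0 < m" using A Z by (simp add: m_def A_def[symmetric] Z_def[symmetric])
      ultimately show ?thesis by (simp add: ln_div algebra_simps)
    qed simp
    have "integrable M (\<lambda>x. (f x)\<^sup>2 * W x)"
      using A unfolding A_def by (metis not_integrable_integral_eq less_irrefl)
    show ?thesis
    proof (cases "integrable M (\<lambda>x. (f x)\<^sup>2 * ln ((f x)\<^sup>2) * W x)")
      case True
      then have "(LINT x|M. (f x)\<^sup>2 * ln ((f x)\<^sup>2 / m) * W x) = L - ln m * A"
        unfolding f2 L_def A_def using \<open>integrable M (\<lambda>x. (f x)\<^sup>2 * W x)\<close> by simp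
      moreover have "m = A / Z" by (simp add: m_def A_def Z_def)
      ultimately show ?thesis using main unfolding E_def[symmetric] by (simp only: mult.commute)
    next
      case False
      \<comment> \<open>Adding back a multiple of the integrable \<open>f^2 W\<close> shows that
        both integrands fail together; the left side is then 0 by convention and \<open>E\<close> is
        nonnegative.\<close>
      have "\<not> integrable M (\<lambda>x. (f x)\<^sup>2 * ln ((f x)\<^sup>2 / m) * W x)"
      proof
        assume "integrable M (\<lambda>x. (f x)\<^sup>2 * ln ((f x)\<^sup>2 / m) * W x)"
        then have "integrable M (\<lambda>x. (f x)\<^sup>2 * ln ((f x)\<^sup>2 / m) * W x + ln m * ((f x)\<^sup>2 * W x))"
          using \<open>integrable M (\<lambda>x. (f x)\<^sup>2 * W x)\<close> by simp
        then show False using False unfolding f2 by simp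
      qed
      then show ?thesis using E_nn by (simp add: not_integrable_integral_eq E_def)
    qed
  qed
qed

end


section \<open>Trigonometric polynomials\<close>

definition trig_fun :: "nat \<Rightarrow> (nat \<Rightarrow> real \<times> real) \<Rightarrow> real \<Rightarrow> real" where
  "trig_fun M c x = (\<Sum>j=1..M. fst (c j) * cos (real j * x) + snd (c j) * sin (real j * x))"

lemma borel_measurable_trig_fun [measurable]: "trig_fun M c \<in> borel_measurable borel"
  unfolding trig_fun_def by measurable

lemma trig_fun_bounded: "\<bar>trig_fun M c x\<bar> \<le> (\<Sum>j=1..M. \<bar>fst (c j)\<bar> + \<bar>snd (c j)\<bar>)"
  unfolding trig_fun_def
proof (rule order.trans[OF sum_abs sum_mono])
  fix j
  have "\<bar>fst (c j) * cos (real j * x) + snd (c j) * sin (real j * x)\<bar>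
      \<le> \<bar>fst (c j)\<bar> * \<bar>cos (real j * x)\<bar> + \<bar>snd (c j)\<bar> * \<bar>sin (real j * x)\<bar>"
    by (rule order.trans[OF abs_triangle_ineq]) (simp add: abs_mult)
  also have "\<dots> \<le> \<bar>fst (c j)\<bar> * 1 + \<bar>snd (c j)\<bar> * 1"
    by (intro add_mono mult_left_mono) auto
  finally show "\<bar>fst (c j) * cos (real j * x) + snd (c j) * sin (real j * x)\<bar> \<le> \<bar>fst (c j)\<bar> + \<bar>snd (c j)\<bar>"
    by simp
qed

lemma square_integrable_trig_fun: "square_integrable (trig_fun M c)"
  by (rule square_integrable_bounded[OF _ trig_fun_bounded]) measurable

text \<open>Replaces the combination of equivalence classes by one explicit bounded function, so
  that integrals can be computed pointwise.\<close>

lemma trig_poly_eq_abs: "trig_poly M c = abs_L2 (trig_fun M c)"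
proof (rule L2_eqI)
  have cs: "AE x in circle. rep_L2 (cos_mode j) x = cos (real j * x)"
    "AE x in circle. rep_L2 (sin_mode j) x = sin (real j * x)" for j
  proof -
    have "cos_mode j = abs_L2 (\<lambda>x. cos (real j * x))" "sin_mode j = abs_L2 (\<lambda>x. sin (real j * x))"
      by (simp_all add: cos_mode_def sin_mode_def)
    moreover have "square_integrable (\<lambda>x. cos (real j * x))" "square_integrable (\<lambda>x. sin (real j * x))"
      by (rule square_integrable_bounded[where B=1]; simp)+
    ultimately show "AE x in circle. rep_L2 (cos_mode j) x = cos (real j * x)"
      "AE x in circle. rep_L2 (sin_mode j) x = sin (real j * x)"
      by (simp_all only: rep_abs_L2)
  qed
  have "AE x in circle. rep_L2 (fst (c j) *\<^sub>R cos_mode j + snd (c j) *\<^sub>R sin_mode j) x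
      = fst (c j) * cos (real j * x) + snd (c j) * sin (real j * x)" for j
    using rep_add[of "fst (c j) *\<^sub>R cos_mode j" "snd (c j) *\<^sub>R sin_mode j"]
      rep_scaleR[of "fst (c j)" "cos_mode j"] rep_scaleR[of "snd (c j)" "sin_mode j"] cs[of j]
    by eventually_elim simp
  then have "AE x in circle. \<forall>j\<in>{1..M}. rep_L2 (fst (c j) *\<^sub>R cos_mode j + snd (c j) *\<^sub>R sin_mode j) x
      = fst (c j) * cos (real j * x) + snd (c j) * sin (real j * x)"
    by (intro AE_finite_allI) auto
  moreover have "AE x in circle. rep_L2 (trig_poly M c) x
      = (\<Sum>j=1..M. rep_L2 (fst (c j) *\<^sub>R cos_mode j + snd (c j) *\<^sub>R sin_mode j) x)"
    unfolding trig_poly_def by (rule rep_sum) simp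
  moreover have "AE x in circle. rep_L2 (abs_L2 (trig_fun M c)) x = trig_fun M c x"
    by (rule rep_abs_L2[OF square_integrable_trig_fun])
  ultimately show "AE x in circle. rep_L2 (trig_poly M c) x = rep_L2 (abs_L2 (trig_fun M c)) x"
    by eventually_elim (simp add: trig_fun_def)
qed

lemma cubic_integral_trig_poly: "cubic_integral (trig_poly M c) = (LINT x|circle. (trig_fun M c x) ^ 3)"
  unfolding trig_poly_eq_abs
  by (rule cubic_integral.abs_eq) (simp add: L2_rel_refl square_integrable_trig_fun)

text \<open>The complex Fourier coefficient of the polynomial with cosine coefficient
  \<open>a\<close> and sine coefficient \<open>b\<close> at \<open>|n|\<close>, that is
  \<open>(a - \<i> sgn(n) b) / 2\<close>; used for nonzero \<open>n\<close> only.\<close>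

definition trig_coeff :: "(nat \<Rightarrow> real \<times> real) \<Rightarrow> int \<Rightarrow> complex" where
  "trig_coeff c n = Complex (fst (c (nat \<bar>n\<bar>)) / 2) (- of_int (sgn n) * snd (c (nat \<bar>n\<bar>)) / 2)"

lemma sum_nonzero_ints:
  fixes F :: "int \<Rightarrow> 'a::comm_monoid_add"
  shows "(\<Sum>n\<in>{- int M..int M} - {0}. F n) = (\<Sum>j=1..M. F (int j) + F (- int j))"
proof -
  have eq: "{- int M..int M} - {0} = int ` {1..M} \<union> (\<lambda>j. - int j) ` {1..M}"
  proof (intro set_eqI iffI)
    fix k assume "k \<in> {- int M..int M} - {0}"
    then have "k = int (nat \<bar>k\<bar>) \<or> k = - int (nat \<bar>k\<bar>)" "nat \<bar>k\<bar> \<in> {1..M}" by auto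
    then show "k \<in> int ` {1..M} \<union> (\<lambda>j. - int j) ` {1..M}" by blast
  qed auto
  have "(\<Sum>n\<in>{- int M..int M} - {0}. F n) = (\<Sum>n\<in>int ` {1..M}. F n) + (\<Sum>n\<in>(\<lambda>j. - int j) ` {1..M}. F n)"
    unfolding eq by (rule sum.union_disjoint) auto
  also have "\<dots> = (\<Sum>j=1..M. F (int j)) + (\<Sum>j=1..M. F (- int j))"
    by (subst (1 2) sum.reindex) (auto simp: inj_on_def)
  finally show ?thesis by (simp add: sum.distrib)
qed

lemma trig_fun_complex:
  "complex_of_real (trig_fun M c x) = (\<Sum>n\<in>{- int M..int M} - {0}. trig_coeff c n * cis (of_int n * x))"
  unfolding sum_nonzero_ints trig_fun_def of_real_sum
  by (intro sum.cong refl) (auto simp: trig_coeff_def complex_eq_iff sgn_if field_simps)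

lemma cmod_trig_coeff:
  assumes "n \<noteq> 0" shows "(cmod (trig_coeff c n))\<^sup>2 = (norm (c (nat \<bar>n\<bar>)))\<^sup>2 / 4"
  using assms unfolding cmod_power2 norm_prod_def
  by (simp add: trig_coeff_def sgn_if power_divide)

text \<open>The factor 1/2 is the mean of \<open>cos^2\<close> and \<open>sin^2\<close> over the
  circle.\<close>

lemma norm_trig_poly: "(norm (trig_poly M c))\<^sup>2 = (\<Sum>j=1..M. (norm (c j))\<^sup>2) / 2"
proof -
  have "(norm (trig_poly M c))\<^sup>2 = (LINT x|circle. (cmod (complex_of_real (trig_fun M c x)))\<^sup>2)"
    unfolding trig_poly_eq_abs norm_abs_L2[OF square_integrable_trig_fun] by simp
  also have "\<dots> = (\<Sum>n\<in>{- int M..int M} - {0}. (cmod (trig_coeff c n))\<^sup>2)"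
    unfolding trig_fun_complex by (rule integral_norm_trig_sum) simp
  also have "\<dots> = (\<Sum>j=1..M. (norm (c j))\<^sup>2 / 2)"
    unfolding sum_nonzero_ints by (intro sum.cong refl) (simp add: cmod_trig_coeff)
  finally show ?thesis by (simp add: sum_divide_distrib)
qed

text \<open>The sum of \<open>|n| |u_n|^2\<close> over the frequencies of the trigonometric
  polynomial. It is also exactly the exponent of the Gaussian factors in
  \<open>gibbs_weight\<close>.\<close>

definition trig_energy :: "nat \<Rightarrow> (nat \<Rightarrow> real \<times> real) \<Rightarrow> real" where
  "trig_energy M c = (\<Sum>j=1..M. real j * (norm (c j))\<^sup>2) / 2"

lemma trig_energy_nonneg: "0 \<le> trig_energy M c"
  unfolding trig_energy_def by (intro divide_nonneg_nonneg sum_nonneg) auto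

lemma trig_fun_L4: "(LINT x|circle. (trig_fun M c x) ^ 4) \<le> 4 * (trig_energy M c)\<^sup>2"
proof -
  have "(LINT x|circle. (trig_fun M c x) ^ 4) = (LINT x|circle. (cmod (complex_of_real (trig_fun M c x))) ^ 4)"
    by (simp add: power_even_abs)
  also have "\<dots> \<le> 4 * (\<Sum>n\<in>{- int M..int M} - {0}. \<bar>of_int n\<bar> * (cmod (trig_coeff c n))\<^sup>2)\<^sup>2"
    unfolding trig_fun_complex by (rule trig_sum_L4_bound) auto
  also have "(\<Sum>n\<in>{- int M..int M} - {0}. \<bar>of_int n\<bar> * (cmod (trig_coeff c n))\<^sup>2) = trig_energy M c"
    unfolding sum_nonzero_ints trig_energy_def sum_divide_distrib
    by (intro sum.cong refl) (simp add: cmod_trig_coeff)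
  finally show ?thesis .
qed

section \<open>Interpolation and distance in the coordinate space\<close>

lemma trig_fun_diff: "trig_fun M c x - trig_fun M c' x = trig_fun M (\<lambda>j. c j - c' j) x"
  by (simp add: trig_fun_def algebra_simps flip: sum_subtractf)

lemma trig_poly_diff: "trig_poly M c - trig_poly M c' = trig_poly M (\<lambda>j. c j - c' j)"
  by (simp add: trig_poly_def scaleR_left_diff_distrib algebra_simps flip: sum_subtractf)

text \<open>The restricted abstraction keeps the result in the extensional function space underlying
  the product measure.\<close>

definition coord_comb :: "nat \<Rightarrow> real \<Rightarrow> (nat \<Rightarrow> real \<times> real) \<Rightarrow> (nat \<Rightarrow> real \<times> real) \<Rightarrow> nat \<Rightarrow> real \<times> real" where
  "coord_comb M t x y = (\<lambda>j\<in>{1..M}. t *\<^sub>R x j + (1 - t) *\<^sub>R y j)"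

text \<open>Euclidean distance of the coefficients \<open>(a_j, b_j)\<close>, which is
  \<open>sqrt 2\<close> times the \<open>L2\<close> distance of the polynomials. This is the
  distance dual to \<open>gradient_norm_sq\<close>.\<close>

definition coord_dist :: "nat \<Rightarrow> (nat \<Rightarrow> real \<times> real) \<Rightarrow> (nat \<Rightarrow> real \<times> real) \<Rightarrow> real" where
  "coord_dist M x y = sqrt (\<Sum>j=1..M. (norm (x j - y j))\<^sup>2)"

lemma coord_dist_nonneg: "0 \<le> coord_dist M x y"
  by (simp add: coord_dist_def sum_nonneg)

lemma coord_dist_sq: "(coord_dist M x y)\<^sup>2 = (\<Sum>j=1..M. (norm (x j - y j))\<^sup>2)"
  by (simp add: coord_dist_def sum_nonneg)

lemma coord_dist_comb:
  assumes "0 < t" "t < 1" shows "coord_dist M x (coord_comb M t x y) = (1 - t) * coord_dist M x y"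
proof -
  have "(norm (x j - (t *\<^sub>R x j + (1 - t) *\<^sub>R y j)))\<^sup>2 = (1 - t)\<^sup>2 * (norm (x j - y j))\<^sup>2" for j
  proof -
    have "x j - (t *\<^sub>R x j + (1 - t) *\<^sub>R y j) = (1 - t) *\<^sub>R (x j - y j)" by (simp add: algebra_simps)
    then show ?thesis using assms by (simp add: power_mult_distrib)
  qed
  then have "(\<Sum>j=1..M. (norm (x j - coord_comb M t x y j))\<^sup>2) = (1 - t)\<^sup>2 * (\<Sum>j=1..M. (norm (x j - y j))\<^sup>2)"
    by (simp add: coord_comb_def sum_distrib_left)
  then show ?thesis using assms by (simp add: coord_dist_def real_sqrt_mult)
qed

lemma trig_poly_comb: "trig_poly M (coord_comb M t x y) = t *\<^sub>R trig_poly M x + (1 - t) *\<^sub>R trig_poly M y"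
  unfolding trig_poly_def scaleR_sum_right sum.distrib[symmetric]
  by (intro sum.cong refl) (simp add: coord_comb_def scaleR_add_left scaleR_add_right)

lemma trig_fun_comb: "trig_fun M (coord_comb M t x y) z = t * trig_fun M x z + (1 - t) * trig_fun M y z"
  unfolding trig_fun_def sum_distrib_left sum.distrib[symmetric]
  by (intro sum.cong refl) (simp add: coord_comb_def algebra_simps)

lemma norm_trig_poly_diff_le: "norm (trig_poly M x - trig_poly M y) \<le> coord_dist M x y"
proof (rule power2_le_imp_le)
  have "(norm (trig_poly M x - trig_poly M y))\<^sup>2 = (coord_dist M x y)\<^sup>2 / 2"
    unfolding trig_poly_diff norm_trig_poly coord_dist_sq ..
  moreover have "0 \<le> (coord_dist M x y)\<^sup>2" by simp
  ultimately show "(norm (trig_poly M x - trig_poly M y))\<^sup>2 \<le> (coord_dist M x y)\<^sup>2" by linarith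
qed (rule coord_dist_nonneg)

text \<open>The energy is a quadratic form, so its convexity defect along a segment is exactly
  \<open>t (1-t)\<close> times its value at the difference.\<close>

lemma trig_energy_comb:
  "t * trig_energy M x + (1 - t) * trig_energy M y - trig_energy M (coord_comb M t x y)
    = t * (1 - t) * trig_energy M (\<lambda>j. x j - y j)"
proof -
  have "t * (norm (x j))\<^sup>2 + (1 - t) * (norm (y j))\<^sup>2 - (norm (coord_comb M t x y j))\<^sup>2
      = t * (1 - t) * (norm (x j - y j))\<^sup>2" if "j \<in> {1..M}" for j
    using that unfolding power2_norm_eq_inner coord_comb_def
    by (simp add: inner_simps inner_commute algebra_simps)
  then have "(\<Sum>j=1..M. real j * (t * (norm (x j))\<^sup>2 + (1 - t) * (norm (y j))\<^sup>2 - (norm (coord_comb M t x y j))\<^sup>2))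
     = (\<Sum>j=1..M. real j * (t * (1 - t) * (norm (x j - y j))\<^sup>2))"
    by (intro sum.cong refl) simp
  moreover have "(\<Sum>j=1..M. real j * (t * (norm (x j))\<^sup>2 + (1 - t) * (norm (y j))\<^sup>2 - (norm (coord_comb M t x y j))\<^sup>2))
    = t * (\<Sum>j=1..M. real j * (norm (x j))\<^sup>2) + (1 - t) * (\<Sum>j=1..M. real j * (norm (y j))\<^sup>2)
      - (\<Sum>j=1..M. real j * (norm (coord_comb M t x y j))\<^sup>2)"
    unfolding sum_distrib_left sum.distrib[symmetric] sum_subtractf[symmetric]
    by (intro sum.cong refl) (simp add: algebra_simps)
  moreover have "(\<Sum>j=1..M. real j * (t * (1 - t) * (norm (x j - y j))\<^sup>2))
    = t * (1 - t) * (\<Sum>j=1..M. real j * (norm (x j - y j))\<^sup>2)"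
    unfolding sum_distrib_left by (intro sum.cong refl) simp
  ultimately show ?thesis unfolding trig_energy_def by simp
qed

text \<open>The weights \<open>j\<close> are at least 1: this is where absence of the zero frequency
  enters the Gibbs measure.\<close>

lemma coord_dist_le_energy: "(coord_dist M x y)\<^sup>2 \<le> 2 * trig_energy M (\<lambda>j. x j - y j)"
proof -
  have "(\<Sum>j=1..M. (norm (x j - y j))\<^sup>2) \<le> (\<Sum>j=1..M. real j * (norm (x j - y j))\<^sup>2)"
  proof (rule sum_mono)
    fix j assume "j \<in> {1..M}"
    then show "(norm (x j - y j))\<^sup>2 \<le> real j * (norm (x j - y j))\<^sup>2"
      using mult_right_mono[of 1 "real j" "(norm (x j - y j))\<^sup>2"] by simp
  qed
  then show ?thesis by (simp add: coord_dist_sq trig_energy_def)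
qed

text \<open>Writing \<open>s = 1 - t\<close>, one has \<open>t f\<^sup>3 + s g\<^sup>3 - (t f + s g)\<^sup>3 = t s (f - g)\<^sup>2 ((1 + t) f + (1 + s) g)\<close>, and
  the last factor has norm at most \<open>3 \<surd>N\<close> on \<open>\<Omega>\<^sub>N\<close>.\<close>

lemma cubic_integral_comb:
  assumes t: "0 < t" "t < 1" and x: "trig_poly M x \<in> Omega N" and y: "trig_poly M y \<in> Omega N"
  shows "\<bar>t * cubic_integral (trig_poly M x) + (1 - t) * cubic_integral (trig_poly M y)
      - cubic_integral (trig_poly M (coord_comb M t x y))\<bar>
    \<le> t * (1 - t) * (6 * sqrt N * trig_energy M (\<lambda>j. x j - y j))"
proof -
  define f where "f = trig_fun M x"
  define g where "g = trig_fun M y"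
  define h where "h = trig_fun M (\<lambda>j. x j - y j)"
  define k where "k z = (1 + t) * f z + (2 - t) * g z" for z
  have [measurable]: "f \<in> borel_measurable borel" "g \<in> borel_measurable borel" "h \<in> borel_measurable borel"
    by (simp_all add: f_def g_def h_def)
  have cube: "integrable circle (\<lambda>z. (trig_fun M c z) ^ i)" for c i
  proof (rule integrable_circle_bounded)
    show "norm ((trig_fun M c z) ^ i) \<le> (\<Sum>j=1..M. \<bar>fst (c j)\<bar> + \<bar>snd (c j)\<bar>) ^ i" for z
      unfolding real_norm_def power_abs by (intro power_mono trig_fun_bounded) simp
  qed measurable
  have "t * cubic_integral (trig_poly M x) + (1 - t) * cubic_integral (trig_poly M y)
      - cubic_integral (trig_poly M (coord_comb M t x y))
    = (LINT z|circle. t * (f z) ^ 3 + (1 - t) * (g z) ^ 3 - (trig_fun M (coord_comb M t x y) z) ^ 3)"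
    unfolding cubic_integral_trig_poly f_def g_def
    by (simp only: Bochner_Integration.integral_add Bochner_Integration.integral_diff
        Bochner_Integration.integrable_add integrable_mult_right integral_mult_right_zero cube)
  also have "\<dots> = (LINT z|circle. t * (1 - t) * (k z * (h z)\<^sup>2))"
    unfolding h_def trig_fun_diff[symmetric] trig_fun_comb f_def[symmetric] g_def[symmetric] k_def
    by (intro Bochner_Integration.integral_cong refl) (simp add: power2_eq_square power3_eq_cube algebra_simps)
  also have "\<dots> = t * (1 - t) * (LINT z|circle. k z * (h z)\<^sup>2)"
    by (rule integral_mult_right_zero)
  finally have eq: "t * cubic_integral (trig_poly M x) + (1 - t) * cubic_integral (trig_poly M y)
      - cubic_integral (trig_poly M (coord_comb M t x y)) = t * (1 - t) * (LINT z|circle. k z * (h z)\<^sup>2)" .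
  have sqk: "square_integrable k"
    unfolding k_def f_def g_def by (intro square_integrable_add square_integrable_scaleR square_integrable_trig_fun)
  have "abs_L2 k = (1 + t) *\<^sub>R trig_poly M x + (2 - t) *\<^sub>R trig_poly M y"
  proof -
    have "(1 + t) *\<^sub>R trig_poly M x = abs_L2 (\<lambda>z. (1 + t) * f z)" "(2 - t) *\<^sub>R trig_poly M y = abs_L2 (\<lambda>z. (2 - t) * g z)"
      unfolding trig_poly_eq_abs f_def g_def
      by (intro scaleR_L2.abs_eq; simp add: L2_rel_refl square_integrable_trig_fun)+
    then show ?thesis
      unfolding k_def using plus_L2.abs_eq[of "\<lambda>z. (1 + t) * f z" "\<lambda>z. (2 - t) * g z"]
      by (simp add: L2_rel_refl square_integrable_scaleR square_integrable_trig_fun f_def g_def)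
  qed
  then have "norm (abs_L2 k) \<le> norm ((1 + t) *\<^sub>R trig_poly M x) + norm ((2 - t) *\<^sub>R trig_poly M y)"
    by (simp only: norm_triangle_ineq)
  also have "\<dots> = (1 + t) * norm (trig_poly M x) + (2 - t) * norm (trig_poly M y)"
    using t by simp
  also have "\<dots> \<le> (1 + t) * sqrt N + (2 - t) * sqrt N"
    using t x y by (intro add_mono mult_left_mono) (auto simp: Omega_def real_le_rsqrt)
  also have "\<dots> = 3 * sqrt N" by (simp add: algebra_simps)
  finally have nk: "norm (abs_L2 k) \<le> 3 * sqrt N" .
  have "\<bar>LINT z|circle. k z * (h z)\<^sup>2\<bar> \<le> 2 * norm (abs_L2 k) * trig_energy M (\<lambda>j. x j - y j)"
  proof (rule integral_mult_square_le[OF sqk])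
    show "square_integrable (\<lambda>z. (h z)\<^sup>2)"
      unfolding square_integrable_def using cube[of _ 4] by (simp add: h_def flip: power_mult)
    show "(LINT z|circle. (h z) ^ 4) \<le> 4 * (trig_energy M (\<lambda>j. x j - y j))\<^sup>2"
      unfolding h_def by (rule trig_fun_L4)
  qed (rule trig_energy_nonneg)
  also have "\<dots> \<le> 2 * (3 * sqrt N) * trig_energy M (\<lambda>j. x j - y j)"
    using nk by (intro mult_right_mono mult_left_mono trig_energy_nonneg) auto
  finally have "t * (1 - t) * \<bar>LINT z|circle. k z * (h z)\<^sup>2\<bar> \<le> t * (1 - t) * (6 * sqrt N * trig_energy M (\<lambda>j. x j - y j))"
    using t by (intro mult_left_mono) auto
  then show ?thesis unfolding eq using t by (simp add: abs_mult)
qed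

section \<open>The Gibbs measure\<close>

lemma Omega_convex:
  assumes "u \<in> Omega N" "v \<in> Omega N" "0 \<le> t" "t \<le> 1"
  shows "t *\<^sub>R u + (1 - t) *\<^sub>R v \<in> Omega N"
proof -
  have "0 \<le> N" using assms(1) order.trans[OF zero_le_power2] by (auto simp: Omega_def)
  have "norm (t *\<^sub>R u + (1 - t) *\<^sub>R v) \<le> t * norm u + (1 - t) * norm v"
    using assms(3,4) by (intro order.trans[OF norm_triangle_ineq]) simp
  also have "\<dots> \<le> t * sqrt N + (1 - t) * sqrt N"
    using assms by (intro add_mono mult_left_mono) (auto simp: Omega_def real_le_rsqrt)
  also have "\<dots> = sqrt N" by (simp add: algebra_simps)
  finally have "(norm (t *\<^sub>R u + (1 - t) *\<^sub>R v))\<^sup>2 \<le> (sqrt N)\<^sup>2" by (rule power_mono) simp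
  then show ?thesis using \<open>0 \<le> N\<close> by (simp add: Omega_def)
qed

lemma gibbs_weight_nonneg: "0 \<le> gibbs_weight \<beta> N M c"
  unfolding gibbs_weight_def by (intro mult_nonneg_nonneg prod_nonneg) (auto simp: divide_nonneg_nonneg)

lemma gibbs_weight_pos_iff: "0 < gibbs_weight \<beta> N M c \<longleftrightarrow> trig_poly M c \<in> Omega N"
proof -
  have "0 < (\<Prod>j=1..M. exp (- real j * ((fst (c j))\<^sup>2 + (snd (c j))\<^sup>2) / 2) / (2 * pi * real j))"
    by (intro prod_pos) auto
  then show ?thesis unfolding gibbs_weight_def by (auto simp: indicator_def zero_less_mult_iff)
qed

lemma gibbs_weight_eq:
  assumes "trig_poly M c \<in> Omega N"
  shows "gibbs_weight \<beta> N M c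
    = exp (- \<beta> * cubic_integral (trig_poly M c) - trig_energy M c) * (\<Prod>j=1..M. 1 / (2 * pi * real j))"
proof -
  have "(\<Prod>j=1..M. exp (- real j * ((fst (c j))\<^sup>2 + (snd (c j))\<^sup>2) / 2) / (2 * pi * real j))
      = (\<Prod>j=1..M. exp (- (real j * (norm (c j))\<^sup>2 / 2)) * (1 / (2 * pi * real j)))"
    by (intro prod.cong refl) (simp add: norm_prod_def)
  also have "\<dots> = exp (- trig_energy M c) * (\<Prod>j=1..M. 1 / (2 * pi * real j))"
    unfolding prod.distrib by (simp add: exp_sum[symmetric] trig_energy_def sum_negf sum_divide_distrib)
  finally have eq: "(\<Prod>j=1..M. exp (- real j * ((fst (c j))\<^sup>2 + (snd (c j))\<^sup>2) / 2) / (2 * pi * real j))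
      = exp (- trig_energy M c) * (\<Prod>j=1..M. 1 / (2 * pi * real j))" .
  have "exp (- \<beta> * cubic_integral (trig_poly M c) - trig_energy M c)
      = exp (- \<beta> * cubic_integral (trig_poly M c)) * exp (- trig_energy M c)"
    by (simp flip: exp_add)
  then show ?thesis
    unfolding gibbs_weight_def eq using assms by (simp only: indicator_simps mult_1_left mult.assoc)
qed

text \<open>The energy contributes the concavity defect \<open>t (1-t) E\<close> exactly, the cubic
  term spends at most \<open>6 |\<beta>| sqrt N\<close> of it, and the remaining
  \<open>\<alpha> E\<close> dominates \<alpha> times half the squared distance. The constant
  \<open>P\<close> cancels because \<open>P^t * P^(1-t) = P\<close>.\<close>

lemma gibbs_weight_log_concave:
  assumes t: "0 < t" "t < 1" and \<alpha>: "\<alpha> = 1 - 6 * \<bar>\<beta>\<bar> * sqrt N" "0 < \<alpha>"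
  shows "gibbs_weight \<beta> N M x powr t * gibbs_weight \<beta> N M y powr (1 - t)
      * exp (\<alpha> * t * (1 - t) / 2 * (coord_dist M x y)\<^sup>2) \<le> gibbs_weight \<beta> N M (coord_comb M t x y)"
\<comment> \<open>If one endpoint leaves the ball, its weight is 0 and so is the left side;
  otherwise convexity of \<open>Omega N\<close> keeps the combined point inside.\<close>
proof (cases "trig_poly M x \<in> Omega N \<and> trig_poly M y \<in> Omega N")
  case False
  then have "gibbs_weight \<beta> N M x = 0 \<or> gibbs_weight \<beta> N M y = 0"
    using gibbs_weight_pos_iff gibbs_weight_nonneg by (metis less_eq_real_def)
  then show ?thesis using gibbs_weight_nonneg t by auto
next
  case True
  then have x: "trig_poly M x \<in> Omega N" and y: "trig_poly M y \<in> Omega N" by auto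
  define z where "z = coord_comb M t x y"
  define E where "E = trig_energy M (\<lambda>j. x j - y j)"
  define c3 where "c3 c = cubic_integral (trig_poly M c)" for c
  have z: "trig_poly M z \<in> Omega N"
    unfolding z_def trig_poly_comb using t by (intro Omega_convex x y) auto
  define V where "V c = - \<beta> * c3 c - trig_energy M c" for c
  define P where "P = (\<Prod>j=1..M. 1 / (2 * pi * real j))"
  have P: "0 < P" unfolding P_def by (intro prod_pos) auto
  have W: "gibbs_weight \<beta> N M x = exp (V x) * P" "gibbs_weight \<beta> N M y = exp (V y) * P"
    "gibbs_weight \<beta> N M z = exp (V z) * P"
    unfolding V_def P_def c3_def by (rule gibbs_weight_eq, fact)+
  have "- \<beta> * (t * c3 x + (1 - t) * c3 y - c3 z) \<le> \<bar>\<beta>\<bar> * \<bar>t * c3 x + (1 - t) * c3 y - c3 z\<bar>"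
    by (metis abs_ge_self abs_minus_cancel abs_mult)
  also have "\<dots> \<le> \<bar>\<beta>\<bar> * (t * (1 - t) * (6 * sqrt N * E))"
    unfolding c3_def z_def E_def by (intro mult_left_mono cubic_integral_comb t x y) simp
  also have "\<dots> = t * (1 - t) * E - t * (1 - t) * (\<alpha> * E)" by (simp add: \<alpha>(1) algebra_simps)
  finally have c: "- \<beta> * (t * c3 x + (1 - t) * c3 y - c3 z) \<le> t * (1 - t) * E - t * (1 - t) * (\<alpha> * E)" .
  have "t * (1 - t) * (\<alpha> * ((coord_dist M x y)\<^sup>2 / 2)) \<le> t * (1 - t) * (\<alpha> * E)"
    using t \<alpha>(2) coord_dist_le_energy[of M x y] by (intro mult_left_mono) (auto simp: E_def)
  then have d: "\<alpha> * t * (1 - t) / 2 * (coord_dist M x y)\<^sup>2 \<le> t * (1 - t) * (\<alpha> * E)"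
    by (simp add: mult_ac)
  have "t * V x + (1 - t) * V y - V z = - \<beta> * (t * c3 x + (1 - t) * c3 y - c3 z)
      - (t * trig_energy M x + (1 - t) * trig_energy M y - trig_energy M z)"
    unfolding V_def by (simp add: algebra_simps)
  also have "t * trig_energy M x + (1 - t) * trig_energy M y - trig_energy M z = t * (1 - t) * E"
    unfolding z_def E_def by (rule trig_energy_comb)
  finally have "t * V x + (1 - t) * V y + \<alpha> * t * (1 - t) / 2 * (coord_dist M x y)\<^sup>2 \<le> V z"
    using c d by linarith
  then have "exp (t * V x + (1 - t) * V y + \<alpha> * t * (1 - t) / 2 * (coord_dist M x y)\<^sup>2) * P \<le> exp (V z) * P"
    using P by simp
  moreover have "exp (t * V x + (1 - t) * V y + \<alpha> * t * (1 - t) / 2 * (coord_dist M x y)\<^sup>2) * P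
      = gibbs_weight \<beta> N M x powr t * gibbs_weight \<beta> N M y powr (1 - t) * exp (\<alpha> * t * (1 - t) / 2 * (coord_dist M x y)\<^sup>2)"
  proof -
    have "(exp (V x) * P) powr t * (exp (V y) * P) powr (1 - t)
        = exp (t * V x) * exp ((1 - t) * V y) * (P powr t * P powr (1 - t))"
      using P by (simp add: powr_mult exp_powr_real mult_ac)
    also have "P powr t * P powr (1 - t) = P" using P by (simp add: powr_add[symmetric])
    finally show ?thesis unfolding W by (simp add: exp_add mult_ac)
  qed
  ultimately show ?thesis using W z_def by simp
qed

lemma prekopa_leindler_coordinate_measure:
  assumes t: "0 < t" "t < 1"
  shows "prekopa_leindler t (coordinate_measure M) (coord_comb M t)"
proof -
  have "prekopa_leindler t (lborel \<Otimes>\<^sub>M lborel)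
      (\<lambda>x y :: real \<times> real. (t * fst x + (1 - t) * fst y, t * snd x + (1 - t) * snd y))"
    by (intro prekopa_leindler_pair prekopa_leindler_line t lborel.sigma_finite_measure_axioms) simp
  moreover have "(\<lambda>x y :: real \<times> real. (t * fst x + (1 - t) * fst y, t * snd x + (1 - t) * snd y))
      = (\<lambda>x y. t *\<^sub>R x + (1 - t) *\<^sub>R y)"
    by (simp add: fun_eq_iff prod_eq_iff)
  ultimately have "prekopa_leindler t lborel (\<lambda>x y :: real \<times> real. t *\<^sub>R x + (1 - t) *\<^sub>R y)"
    by (simp add: lborel_prod)
  then have "prekopa_leindler t (Pi\<^sub>M {1..M} (\<lambda>_. lborel :: (real \<times> real) measure))
     (\<lambda>x y. \<lambda>i\<in>{1..M}. t *\<^sub>R x i + (1 - t) *\<^sub>R y i)"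
    by (intro prekopa_leindler_PiM lborel.sigma_finite_measure_axioms) auto
  then show ?thesis unfolding coordinate_measure_def coord_comb_def[abs_def] .
qed


section \<open>Measurability of the coordinate map and compactness of its range in the ball\<close>

lemma continuous_on_trig_poly: "continuous_on UNIV (trig_poly M)"
  unfolding trig_poly_def[abs_def]
  by (intro continuous_intros continuous_on_product_coordinates)

lemma trig_poly_cong: "(\<And>j. j \<in> {1..M} \<Longrightarrow> c j = c' j) \<Longrightarrow> trig_poly M c = trig_poly M c'"
  unfolding trig_poly_def by (intro sum.cong) auto

text \<open>Extending by 0 moves from the product over \<open>{1..M}\<close> to the product over all
  naturals, whose product sigma-algebra is the Borel one, so that continuity there suffices.\<close>

lemma borel_measurable_trig_poly [measurable]: "trig_poly M \<in> borel_measurable (coordinate_measure M)"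
proof -
  define ext where "ext c j = (if j \<in> {1..M} then c j else 0)" for c :: "nat \<Rightarrow> real \<times> real" and j
  have "ext \<in> measurable (coordinate_measure M) (Pi\<^sub>M UNIV (\<lambda>_. borel))"
  proof (rule measurable_PiM_single')
    fix j
    show "(\<lambda>c. ext c j) \<in> measurable (coordinate_measure M) borel"
      unfolding ext_def coordinate_measure_def by (cases "j \<in> {1..M}") auto
  qed auto
  then have "ext \<in> borel_measurable (coordinate_measure M)"
    by (simp cong: measurable_cong_sets add: sets_PiM_equal_borel)
  then have "(\<lambda>c. trig_poly M (ext c)) \<in> borel_measurable (coordinate_measure M)"
    using borel_measurable_continuous_onI[OF continuous_on_trig_poly] by (rule measurable_compose)
  moreover have "trig_poly M (ext c) = trig_poly M c" for c
    by (rule trig_poly_cong) (simp add: ext_def)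
  ultimately show ?thesis by simp
qed

lemma closed_Omega: "closed (Omega N)"
  unfolding Omega_def by (intro closed_Collect_le continuous_intros)

lemma borel_Omega [measurable]: "Omega N \<in> sets borel"
  using closed_Omega by simp

text \<open>The finite-dimensional slice of the ball on which the Gibbs measure lives. It supplies
  the compactness that a ball in infinite-dimensional \<open>L2\<close> lacks.\<close>

definition trig_ball :: "nat \<Rightarrow> real \<Rightarrow> L2 set" where
  "trig_ball M N = Omega N \<inter> range (trig_poly M)"

lemma norm_coordinate_le:
  assumes "trig_poly M c \<in> Omega N" "j \<in> {1..M}" shows "norm (c j) \<le> sqrt (2 * N)"
proof (rule real_le_rsqrt)
  have "(norm (c j))\<^sup>2 \<le> (\<Sum>j=1..M. (norm (c j))\<^sup>2)"
    by (rule member_le_sum) (use assms in auto)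
  also have "\<dots> \<le> 2 * N" using assms(1) norm_trig_poly[of M c] by (simp add: Omega_def)
  finally show "(norm (c j))\<^sup>2 \<le> 2 * N" .
qed

text \<open>Closed subset of the continuous image of a box that is compact by Tychonoff; coordinates
  outside \<open>{1..M}\<close> do not affect the polynomial and are set to 0.\<close>

lemma compact_trig_ball: "compact (trig_ball M N)"
proof -
  define box where "box = PiE UNIV (\<lambda>_::nat. cball (0::real \<times> real) (sqrt (2 * N)))"
  have "compactin (product_topology (\<lambda>_. euclidean) UNIV) box"
    unfolding box_def compactin_PiE by simp
  then have "compact box" by (simp add: euclidean_product_topology)
  then have "compact (trig_poly M ` box)"
    using continuous_on_trig_poly by (intro compact_continuous_image) (auto intro: continuous_on_subset)
  then have "compact (trig_poly M ` box \<inter> Omega N)"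
    by (rule compact_Int_closed[OF _ closed_Omega])
  moreover have "trig_ball M N = trig_poly M ` box \<inter> Omega N"
  proof
    show "trig_ball M N \<subseteq> trig_poly M ` box \<inter> Omega N"
    proof
      fix u assume "u \<in> trig_ball M N"
      then obtain c where c: "u = trig_poly M c" "u \<in> Omega N" by (auto simp: trig_ball_def)
      define c' where "c' j = (if j \<in> {1..M} then c j else 0)" for j
      have "0 \<le> N" using c(2) order.trans[OF zero_le_power2] by (auto simp: Omega_def)
      then have "norm (c' j) \<le> sqrt (2 * N)" for j
        using norm_coordinate_le[of M c N j] c by (simp add: c'_def)
      then have "c' \<in> box" by (auto simp: box_def)
      moreover have "u = trig_poly M c'" unfolding c by (rule trig_poly_cong) (simp add: c'_def)
      ultimately show "u \<in> trig_poly M ` box \<inter> Omega N" using c by blast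
    qed
  qed (auto simp: trig_ball_def)
  ultimately show ?thesis by simp
qed

lemma convex_trig_ball:
  assumes "u \<in> trig_ball M N" "v \<in> trig_ball M N" "0 \<le> s" "s \<le> 1"
  shows "v + s *\<^sub>R (u - v) \<in> trig_ball M N"
proof -
  have eq: "v + s *\<^sub>R (u - v) = s *\<^sub>R u + (1 - s) *\<^sub>R v" by (simp add: algebra_simps)
  have "s *\<^sub>R u + (1 - s) *\<^sub>R v \<in> Omega N"
    using assms by (intro Omega_convex) (auto simp: trig_ball_def)
  moreover have "s *\<^sub>R u + (1 - s) *\<^sub>R v \<in> range (trig_poly M)"
    using assms(1,2) by (auto simp: trig_ball_def simp flip: trig_poly_comb)
  ultimately show ?thesis by (simp add: eq trig_ball_def)
qed

section \<open>Gradients\<close>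

lemma blinfun_trig_poly:
  fixes D :: "L2 \<Rightarrow>\<^sub>L real"
  shows "D (trig_poly M c) = (\<Sum>j=1..M. inner (c j) (D (cos_mode j), D (sin_mode j)))"
  unfolding trig_poly_def
  by (simp add: blinfun.sum_right blinfun.add_right blinfun.scaleR_right inner_prod_def)

text \<open>Test \<open>D\<close> on the polynomial whose coefficients are the values of
  \<open>D\<close> itself: \<open>D\<close> then takes the value \<open>S\<close>, while the norm of
  the polynomial is \<open>sqrt (S / 2)\<close>. Consequently the series in
  \<open>gradient_norm_sq\<close> converges.\<close>

lemma gradient_partial_sum_le:
  fixes D :: "L2 \<Rightarrow>\<^sub>L real"
  shows "(\<Sum>i<n. (D (cos_mode (Suc i)))\<^sup>2 + (D (sin_mode (Suc i)))\<^sup>2) \<le> (norm D)\<^sup>2"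
proof -
  define c where "c j = (D (cos_mode j), D (sin_mode j))" for j
  define S where "S = (\<Sum>j=1..n. (norm (c j))\<^sup>2)"
  have "S = D (trig_poly n c)"
    unfolding blinfun_trig_poly S_def c_def by (simp add: power2_norm_eq_inner)
  also have "\<dots> \<le> norm D * norm (trig_poly n c)"
    using norm_blinfun[of D "trig_poly n c"] by simp
  finally have 1: "S \<le> norm D * norm (trig_poly n c)" .
  have S0: "0 \<le> S" unfolding S_def by (intro sum_nonneg) auto
  have "S\<^sup>2 \<le> (norm D * norm (trig_poly n c))\<^sup>2" using 1 S0 by (rule power_mono)
  also have "\<dots> = (norm D)\<^sup>2 * (S / 2)" by (simp add: power_mult_distrib norm_trig_poly S_def)
  also have "\<dots> \<le> (norm D)\<^sup>2 * S" using S0 by (intro mult_left_mono) auto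
  finally have "S * S \<le> (norm D)\<^sup>2 * S" by (simp add: power2_eq_square)
  then have "S \<le> (norm D)\<^sup>2" using S0 by (cases "S = 0") auto
  then show ?thesis unfolding S_def One_nat_def sum.atLeast1_atMost_eq by (simp add: c_def norm_prod_def)
qed

lemma summable_gradient:
  fixes D :: "L2 \<Rightarrow>\<^sub>L real"
  shows "summable (\<lambda>i. (D (cos_mode (Suc i)))\<^sup>2 + (D (sin_mode (Suc i)))\<^sup>2)"
  by (rule summableI_nonneg_bounded[OF _ gradient_partial_sum_le]) simp

lemma gradient_norm_sq_nonneg: "0 \<le> gradient_norm_sq D"
  unfolding gradient_norm_sq_def by (intro suminf_nonneg summable_gradient) simp

lemma gradient_norm_sq_le: "gradient_norm_sq D \<le> (norm D)\<^sup>2"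
  unfolding gradient_norm_sq_def
  by (rule suminf_le_const[OF summable_gradient gradient_partial_sum_le])

lemma blinfun_trig_poly_diff_le:
  fixes D :: "L2 \<Rightarrow>\<^sub>L real"
  shows "\<bar>D (trig_poly M x - trig_poly M y)\<bar> \<le> sqrt (gradient_norm_sq D) * coord_dist M x y"
proof -
  define p where "p j = (D (cos_mode j), D (sin_mode j))" for j
  have "\<bar>D (trig_poly M x - trig_poly M y)\<bar> \<le> (\<Sum>j=1..M. norm (x j - y j) * norm (p j))"
    unfolding trig_poly_diff blinfun_trig_poly p_def
    by (intro order.trans[OF sum_abs] sum_mono Cauchy_Schwarz_ineq2)
  also have "\<dots> \<le> sqrt ((\<Sum>j=1..M. (norm (x j - y j))\<^sup>2) * (\<Sum>j=1..M. (norm (p j))\<^sup>2))"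
    by (intro real_le_rsqrt Cauchy_Schwarz_ineq_sum)
  also have "\<dots> = coord_dist M x y * sqrt (\<Sum>j=1..M. (norm (p j))\<^sup>2)"
    by (simp add: coord_dist_def real_sqrt_mult)
  also have "\<dots> \<le> coord_dist M x y * sqrt (gradient_norm_sq D)"
  proof (intro mult_left_mono real_sqrt_le_mono coord_dist_nonneg)
    have "(\<Sum>j=1..M. (norm (p j))\<^sup>2)
        = (\<Sum>i<M. (D (cos_mode (Suc i)))\<^sup>2 + (D (sin_mode (Suc i)))\<^sup>2)"
      unfolding One_nat_def sum.atLeast1_atMost_eq by (simp add: p_def norm_prod_def)
    also have "\<dots> \<le> gradient_norm_sq D"
      unfolding gradient_norm_sq_def by (intro sum_le_suminf summable_gradient) auto
    finally show "(\<Sum>j=1..M. (norm (p j))\<^sup>2) \<le> gradient_norm_sq D" .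
  qed
  finally show ?thesis by (simp add: mult.commute)
qed

text \<open>Mean value theorem along the segment, which stays in \<open>trig_ball\<close>.
  Compactness makes \<open>F'\<close> uniformly continuous there, so one radius serves all base
  points when the derivative at the intermediate point is replaced by the one at the
  endpoint.\<close>

lemma C1_slope:
  assumes C1: "C1_on (Omega N) F F'" and e: "0 < e"
  shows "\<exists>r>0. \<forall>x z. trig_poly M x \<in> Omega N \<longrightarrow> trig_poly M z \<in> Omega N \<longrightarrow> coord_dist M x z < r \<longrightarrow>
    \<bar>F (trig_poly M x) - F (trig_poly M z)\<bar> \<le> (sqrt (gradient_norm_sq (F' (trig_poly M z))) + e) * coord_dist M x z"
proof -
  have "continuous_on (trig_ball M N) F'"
    using C1 by (auto simp: C1_on_def trig_ball_def intro: continuous_on_subset)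
  then have "uniformly_continuous_on (trig_ball M N) F'"
    by (rule compact_uniformly_continuous[OF _ compact_trig_ball])
  then obtain r where r: "0 < r" "\<And>u v. u \<in> trig_ball M N \<Longrightarrow> v \<in> trig_ball M N \<Longrightarrow> dist u v < r \<Longrightarrow> dist (F' u) (F' v) < e"
    using e unfolding uniformly_continuous_on_def by meson
  show ?thesis
  proof (intro exI[of _ r] conjI allI impI r(1))
    fix x z assume x: "trig_poly M x \<in> Omega N" and z: "trig_poly M z \<in> Omega N" and d: "coord_dist M x z < r"
    define u where "u = trig_poly M x"
    define v where "v = trig_poly M z"
    have uv: "u \<in> trig_ball M N" "v \<in> trig_ball M N" using x z by (auto simp: trig_ball_def u_def v_def)
    define p where "p s = v + s *\<^sub>R (u - v)" for s
    have pin: "p s \<in> trig_ball M N" if "s \<in> {0..1}" for s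
      unfolding p_def using that by (intro convex_trig_ball uv) auto
    then have sub: "p ` {0..1} \<subseteq> Omega N" by (auto simp: trig_ball_def)
    \<comment> \<open>\<open>F\<close> is differentiable only within \<open>Omega N\<close>, hence
      the chain rule within the image of the segment.\<close>
    have "((F \<circ> p) has_derivative (blinfun_apply (F' (p s)) \<circ> (\<lambda>h. h *\<^sub>R (u - v)))) (at s within {0..1})"
      if s: "s \<in> {0..1}" for s
    proof (rule diff_chain_within)
      show "(p has_derivative (\<lambda>h. h *\<^sub>R (u - v))) (at s within {0..1})"
        unfolding p_def by (auto intro!: derivative_eq_intros)
      have "(F has_derivative blinfun_apply (F' (p s))) (at (p s) within Omega N)"
        using C1 pin[OF s] by (auto simp: C1_on_def trig_ball_def)
      then show "(F has_derivative blinfun_apply (F' (p s))) (at (p s) within p ` {0..1})"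
        by (rule has_derivative_subset[OF _ sub])
    qed
    then obtain s where s: "s \<in> {0..1}" "(F \<circ> p) 1 - (F \<circ> p) 0 = (blinfun_apply (F' (p s)) \<circ> (\<lambda>h. h *\<^sub>R (u - v))) (1 - 0)"
      using mvt_very_simple[of 0 1 "F \<circ> p" "\<lambda>s. blinfun_apply (F' (p s)) \<circ> (\<lambda>h. h *\<^sub>R (u - v))"] by auto
    have diff: "F u - F v = F' v (u - v) + (F' (p s) - F' v) (u - v)"
      using s(2) by (simp add: p_def blinfun.diff_left)
    have uvd: "norm (u - v) \<le> coord_dist M x z" unfolding u_def v_def by (rule norm_trig_poly_diff_le)
    have "dist (p s) v \<le> norm (u - v)"
      using s(1) by (simp add: p_def dist_norm mult_left_le_one_le)
    then have "norm (F' (p s) - F' v) < e"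
      using r(2)[OF pin[OF s(1)] uv(2)] uvd d by (simp add: dist_norm)
    then have "\<bar>(F' (p s) - F' v) (u - v)\<bar> \<le> e * coord_dist M x z"
      using order.trans[OF norm_blinfun[of "F' (p s) - F' v" "u - v"] mult_mono[OF less_imp_le uvd]] e by simp
    moreover have "\<bar>F' v (u - v)\<bar> \<le> sqrt (gradient_norm_sq (F' v)) * coord_dist M x z"
      unfolding u_def v_def by (rule blinfun_trig_poly_diff_le)
    ultimately show "\<bar>F (trig_poly M x) - F (trig_poly M z)\<bar>
        \<le> (sqrt (gradient_norm_sq (F' (trig_poly M z))) + e) * coord_dist M x z"
      unfolding u_def[symmetric] v_def[symmetric] using diff by (simp add: distrib_right)
  qed
qed

section \<open>The logarithmic Sobolev inequality for the Gibbs measure\<close>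

text \<open>Push-forward and density are unfolded. The weight already contains the indicator of
  \<open>Omega N\<close>, which therefore disappears on the right; measurability is asked only of
  the cut-off function, as functionals on the ball are arbitrary outside it.\<close>

lemma integral_gibbs:
  fixes \<phi> :: "L2 \<Rightarrow> real"
  assumes \<phi>: "(\<lambda>u. indicator (Omega N) u * \<phi> u) \<in> borel_measurable borel"
    and W: "(\<lambda>c. gibbs_weight \<beta> N M c / gibbs_normaliser \<beta> N M) \<in> borel_measurable (coordinate_measure M)"
  shows "(LINT u:Omega N|gibbs \<beta> N M. \<phi> u)
    = (LINT c|coordinate_measure M. \<phi> (trig_poly M c) * gibbs_weight \<beta> N M c) / gibbs_normaliser \<beta> N M"
proof -
  have Z: "0 \<le> gibbs_normaliser \<beta> N M"
    unfolding gibbs_normaliser_def using gibbs_weight_nonneg by simp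
  have [measurable]: "trig_poly M \<in> measurable (density (coordinate_measure M)
      (\<lambda>c. ennreal (gibbs_weight \<beta> N M c / gibbs_normaliser \<beta> N M))) borel"
    by simp
  have "(LINT u:Omega N|gibbs \<beta> N M. \<phi> u) = (LINT u|gibbs \<beta> N M. indicator (Omega N) u * \<phi> u)"
    by (simp add: set_lebesgue_integral_def)
  also have "\<dots> = (LINT c|density (coordinate_measure M) (\<lambda>c. ennreal (gibbs_weight \<beta> N M c / gibbs_normaliser \<beta> N M)).
      indicator (Omega N) (trig_poly M c) * \<phi> (trig_poly M c))"
    unfolding gibbs_def by (rule integral_distr[OF _ \<phi>]) measurable
  also have "\<dots> = (LINT c|coordinate_measure M. (gibbs_weight \<beta> N M c / gibbs_normaliser \<beta> N M)
      *\<^sub>R (indicator (Omega N) (trig_poly M c) * \<phi> (trig_poly M c)))"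
    using measurable_compose[OF borel_measurable_trig_poly \<phi>]
    by (intro integral_density W AE_I2 divide_nonneg_nonneg gibbs_weight_nonneg Z) simp
  also have "\<dots> = (LINT c|coordinate_measure M. \<phi> (trig_poly M c) * gibbs_weight \<beta> N M c / gibbs_normaliser \<beta> N M)"
  proof (intro Bochner_Integration.integral_cong refl)
    fix c
    show "(gibbs_weight \<beta> N M c / gibbs_normaliser \<beta> N M) *\<^sub>R (indicator (Omega N) (trig_poly M c) * \<phi> (trig_poly M c))
        = \<phi> (trig_poly M c) * gibbs_weight \<beta> N M c / gibbs_normaliser \<beta> N M"
      by (cases "trig_poly M c \<in> Omega N") (auto simp: gibbs_weight_def)
  qed
  finally show ?thesis by simp
qed

theorem gibbs_log_sobolev:
  assumes \<alpha>: "\<alpha> = 1 - 6 * \<bar>\<beta>\<bar> * sqrt N" "0 < \<alpha>" and C1: "C1_on (Omega N) F F'"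
  shows "(LINT u:Omega N|gibbs \<beta> N M. (F u)\<^sup>2 * ln ((F u)\<^sup>2 / (LINT v:Omega N|gibbs \<beta> N M. (F v)\<^sup>2)))
    \<le> 2 / \<alpha> * (LINT u:Omega N|gibbs \<beta> N M. gradient_norm_sq (F' u))"
proof -
  define W where "W = gibbs_weight \<beta> N M"
  define Z where "Z = gibbs_normaliser \<beta> N M"
  define X where "X = coordinate_measure M"
  have ZW: "Z = (LINT c|X. W c)" by (simp add: Z_def W_def X_def gibbs_normaliser_def)
  have W0: "0 \<le> W c" for c unfolding W_def by (rule gibbs_weight_nonneg)
  have Z0: "0 \<le> Z" unfolding ZW using W0 by simp
  text \<open>Integrability comes for free: a non-integrable weight would have Bochner integral \<open>0\<close>, and
    for \<open>Z = 0\<close> the density \<open>W / Z\<close> is \<open>0\<close> by \<open>x / 0 = 0\<close>.\<close>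
  have W_int: "integrable X W" if "Z \<noteq> 0"
    using that unfolding ZW by (metis not_integrable_integral_eq)
  have W_meas: "(\<lambda>c. W c / Z) \<in> borel_measurable X"
  proof (cases "Z = 0")
    case False
    from W_int[OF this] have [measurable]: "W \<in> borel_measurable X" by auto
    show ?thesis by measurable
  qed simp
  have F_cont: "continuous_on (Omega N) F"
    using C1 by (auto simp: C1_on_def continuous_on_eq_continuous_within intro: has_derivative_continuous)
  have F_meas: "(\<lambda>u. indicator (Omega N) u * F u) \<in> borel_measurable borel"
    using borel_measurable_continuous_on_indicator[OF borel_Omega F_cont] by simp
  have D_meas: "(\<lambda>u. indicator (Omega N) u * (F' u h)) \<in> borel_measurable borel" for h
  proof -
    have "continuous_on (Omega N) (\<lambda>u. F' u h)"
      using C1 by (auto simp: C1_on_def intro!: continuous_intros)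
    from borel_measurable_continuous_on_indicator[OF borel_Omega this] show ?thesis by simp
  qed
  \<comment> \<open>The squared gradient is a series of squares of partial derivatives, each
    continuous on the ball.\<close>
  have g_meas: "(\<lambda>u. indicator (Omega N) u * gradient_norm_sq (F' u)) \<in> borel_measurable borel"
  proof -
    have "(\<lambda>u. \<Sum>i. (indicator (Omega N) u * F' u (cos_mode (Suc i)))\<^sup>2
        + (indicator (Omega N) u * F' u (sin_mode (Suc i)))\<^sup>2) \<in> borel_measurable borel"
      by (intro borel_measurable_suminf borel_measurable_add borel_measurable_power D_meas)
    moreover have "(\<Sum>i. (indicator (Omega N) u * F' u (cos_mode (Suc i)))\<^sup>2
        + (indicator (Omega N) u * F' u (sin_mode (Suc i)))\<^sup>2)
      = indicator (Omega N) u * gradient_norm_sq (F' u)" for u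
      by (cases "u \<in> Omega N") (auto simp: gradient_norm_sq_def)
    ultimately show ?thesis by simp
  qed
  define m where "m = (LINT v:Omega N|gibbs \<beta> N M. (F v)\<^sup>2)"
  \<comment> \<open>The indicators secure measurability although \<open>F\<close> and
    \<open>F'\<close> are unconstrained outside the ball; the integrals against \<open>W\<close> do
    not change, since \<open>W\<close> vanishes there.\<close>
  define f where "f c = indicator (Omega N) (trig_poly M c) * F (trig_poly M c)" for c
  define g where "g c = sqrt (indicator (Omega N) (trig_poly M c) * gradient_norm_sq (F' (trig_poly M c)))" for c
  have f_meas: "f \<in> borel_measurable X"
    unfolding f_def X_def using measurable_compose[OF borel_measurable_trig_poly F_meas] .
  have [measurable]: "g \<in> borel_measurable X"
    unfolding g_def X_def using measurable_compose[OF borel_measurable_trig_poly g_meas] by measurable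
  have supp: "trig_poly M c \<in> Omega N" if "W c \<noteq> 0" for c
    using that W0[of c] gibbs_weight_pos_iff[of \<beta> N M c] by (auto simp: W_def less_le)
  have F2: "(LINT u:Omega N|gibbs \<beta> N M. \<psi> (F u)) = (LINT c|X. \<psi> (f c) * W c) / Z"
    if [measurable]: "\<psi> \<in> borel_measurable borel" for \<psi> :: "real \<Rightarrow> real"
  proof -
    have "(\<lambda>u. indicator (Omega N) u * \<psi> (indicator (Omega N) u * F u)) \<in> borel_measurable borel"
      using F_meas by measurable
    also have "(\<lambda>u. indicator (Omega N) u * \<psi> (indicator (Omega N) u * F u)) = (\<lambda>u. indicator (Omega N) u * \<psi> (F u))"
      by (auto simp: indicator_def)
    finally have "(LINT u:Omega N|gibbs \<beta> N M. \<psi> (F u)) = (LINT c|X. \<psi> (F (trig_poly M c)) * W c) / Z"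
      using W_meas unfolding W_def Z_def X_def by (rule integral_gibbs)
    also have "(LINT c|X. \<psi> (F (trig_poly M c)) * W c) = (LINT c|X. \<psi> (f c) * W c)"
    proof (intro Bochner_Integration.integral_cong refl)
      fix c show "\<psi> (F (trig_poly M c)) * W c = \<psi> (f c) * W c"
        using supp[of c] by (cases "W c = 0") (auto simp: f_def)
    qed
    finally show ?thesis .
  qed
  have m: "m = (LINT c|X. (f c)\<^sup>2 * W c) / Z"
    unfolding m_def by (rule F2[of "\<lambda>y. y\<^sup>2"]) measurable
  have lhs: "(LINT u:Omega N|gibbs \<beta> N M. (F u)\<^sup>2 * ln ((F u)\<^sup>2 / m)) = (LINT c|X. (f c)\<^sup>2 * ln ((f c)\<^sup>2 / m) * W c) / Z"
    by (rule F2[of "\<lambda>y. y\<^sup>2 * ln (y\<^sup>2 / m)"]) measurable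
  have rhs: "(LINT u:Omega N|gibbs \<beta> N M. gradient_norm_sq (F' u)) = (LINT c|X. (g c)\<^sup>2 * W c) / Z"
  proof -
    have "(LINT u:Omega N|gibbs \<beta> N M. gradient_norm_sq (F' u)) = (LINT c|X. gradient_norm_sq (F' (trig_poly M c)) * W c) / Z"
      using g_meas W_meas unfolding W_def Z_def X_def by (rule integral_gibbs)
    also have "(LINT c|X. gradient_norm_sq (F' (trig_poly M c)) * W c) = (LINT c|X. (g c)\<^sup>2 * W c)"
    proof (intro Bochner_Integration.integral_cong refl)
      fix c show "gradient_norm_sq (F' (trig_poly M c)) * W c = (g c)\<^sup>2 * W c"
        using supp[of c] by (cases "W c = 0") (auto simp: g_def gradient_norm_sq_nonneg)
    qed
    finally show ?thesis .
  qed
  have "(LINT c|X. (f c)\<^sup>2 * ln ((f c)\<^sup>2 / m) * W c) / Z \<le> 2 / \<alpha> * ((LINT c|X. (g c)\<^sup>2 * W c) / Z)"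
  \<comment> \<open>For \<open>Z = 0\<close> both quotients are 0.\<close>
  proof (cases "Z = 0")
    case False
    then have Z: "0 < Z" using Z0 by simp
    \<comment> \<open>The diameter bound is coordinatewise: in the ball every pair
      \<open>(a_j, b_j)\<close> has norm at most \<open>sqrt (2 * N)\<close>, because the squared
      \<open>L2\<close> norm is half the sum of the squares.\<close>
    interpret strongly_log_concave_weight X "coord_comb M" "coord_dist M" W \<alpha> "sqrt (\<Sum>j=1..M. (2 * sqrt (2 * N))\<^sup>2)"
    proof
      show "prekopa_leindler t X (coord_comb M t)" if "0 < t" "t < 1" for t
        unfolding X_def by (rule prekopa_leindler_coordinate_measure[OF that])
      show "coord_comb M t x y \<in> space X" if "x \<in> space X" "y \<in> space X" for t x y
        by (auto simp: X_def coordinate_measure_def space_PiM coord_comb_def)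
      show "W x powr t * W y powr (1 - t) * exp (\<alpha> * t * (1 - t) / 2 * (coord_dist M x y)\<^sup>2) \<le> W (coord_comb M t x y)"
        if "0 < t" "t < 1" for t x y
        unfolding W_def by (rule gibbs_weight_log_concave[OF that \<alpha>])
      show "coord_dist M x y \<le> sqrt (\<Sum>j=1..M. (2 * sqrt (2 * N))\<^sup>2)" if "0 < W x" "0 < W y" for x y
        unfolding coord_dist_def
      proof (intro real_sqrt_le_mono sum_mono power_mono)
        fix j assume j: "j \<in> {1..M}"
        have "norm (x j) \<le> sqrt (2 * N)" "norm (y j) \<le> sqrt (2 * N)"
          using norm_coordinate_le[OF supp j] that by auto
        then show "norm (x j - y j) \<le> 2 * sqrt (2 * N)"
          using norm_triangle_ineq4[of "x j" "y j"] by linarith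
      qed simp
    qed (use \<alpha> W_int[OF False] W0 Z coord_dist_nonneg coord_dist_comb ZW in auto)
    have K: "trig_poly M c \<in> trig_ball M N" "trig_poly M c \<in> Omega N" if "c \<in> K" for c
      using that supp[of c] by (auto simp: K_def trig_ball_def)
    have "continuous_on (trig_ball M N) F" "continuous_on (trig_ball M N) F'"
      using F_cont C1 by (auto simp: C1_on_def trig_ball_def intro: continuous_on_subset)
    then have "bounded (F ` trig_ball M N)" "bounded (F' ` trig_ball M N)"
      by (auto intro!: compact_imp_bounded compact_continuous_image compact_trig_ball)
    then obtain B1 B2 where B1: "\<And>u. u \<in> trig_ball M N \<Longrightarrow> norm (F u) \<le> B1"
      and B2: "\<And>u. u \<in> trig_ball M N \<Longrightarrow> norm (F' u) \<le> B2"
      unfolding bounded_iff by (metis imageI)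
    have "(LINT c|X. (f c)\<^sup>2 * ln ((f c)\<^sup>2 / ((LINT c|X. (f c)\<^sup>2 * W c) / (LINT c|X. W c))) * W c)
        \<le> 2 / \<alpha> * (LINT c|X. (g c)\<^sup>2 * W c)"
    proof (rule log_sobolev[where C="max B1 B2"])
      fix c assume c: "c \<in> K"
      show "\<bar>f c\<bar> \<le> max B1 B2" using B1[OF K(1)[OF c]] K(2)[OF c] by (simp add: f_def)
      show "0 \<le> g c" by (simp add: g_def gradient_norm_sq_nonneg)
      have "g c \<le> norm (F' (trig_poly M c))"
        unfolding g_def using K(2)[OF c] gradient_norm_sq_le by (auto intro: real_le_lsqrt)
      then show "g c \<le> max B1 B2" using B2[OF K(1)[OF c]] by simp
    next
      fix e :: real assume "0 < e"
      from C1_slope[OF C1 this, of M] obtain r where r: "0 < r" "\<And>x z. trig_poly M x \<in> Omega N \<Longrightarrow> trig_poly M z \<in> Omega N \<Longrightarrow>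
        coord_dist M x z < r \<Longrightarrow> \<bar>F (trig_poly M x) - F (trig_poly M z)\<bar>
          \<le> (sqrt (gradient_norm_sq (F' (trig_poly M z))) + e) * coord_dist M x z" by blast
      show "\<exists>r>0. \<forall>x\<in>K. \<forall>z\<in>K. coord_dist M x z < r \<longrightarrow> \<bar>f x - f z\<bar> \<le> (g z + e) * coord_dist M x z"
      proof (intro exI[of _ r] conjI ballI impI r(1))
        fix x z assume "x \<in> K" "z \<in> K" "coord_dist M x z < r"
        then show "\<bar>f x - f z\<bar> \<le> (g z + e) * coord_dist M x z"
          using r(2)[of x z] K(2)[of x] K(2)[of z] by (simp add: f_def g_def)
      qed
    qed (use f_meas in measurable)
    then have "(LINT c|X. (f c)\<^sup>2 * ln ((f c)\<^sup>2 / m) * W c) \<le> 2 / \<alpha> * (LINT c|X. (g c)\<^sup>2 * W c)"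
      by (simp only: m ZW)
    from divide_right_mono[OF this Z0] show ?thesis by simp
  qed simp
  then show ?thesis unfolding m_def[symmetric] lhs rhs .
qed

theorem proposition3p2:
  shows "\<exists>\<kappa>::real. \<kappa> > 0 \<and>
    (\<forall>(\<beta>::real) (N::real). N > 0 \<and> \<bar>\<beta>\<bar> * sqrt N < 1 / \<kappa> \<longrightarrow>
       uniformly_convex_on (Omega N) (hamiltonian \<beta>) \<and>
       (\<forall>(M::nat) (F :: L2 \<Rightarrow> real) (F' :: L2 \<Rightarrow> L2 \<Rightarrow>\<^sub>L real).
          C1_on (Omega N) F F' \<longrightarrow>
          (LINT u:Omega N|gibbs \<beta> N M.
             (F u)\<^sup>2 * ln ((F u)\<^sup>2 / (LINT v:Omega N|gibbs \<beta> N M. (F v)\<^sup>2)))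
          \<le> 2 / (1 - \<kappa> * \<bar>\<beta>\<bar> * sqrt N) *
             (LINT u:Omega N|gibbs \<beta> N M. gradient_norm_sq (F' u))))"
proof (rule exI[of _ 6], intro conjI allI impI)
  fix \<beta> N :: real
  assume small: "N > 0 \<and> \<bar>\<beta>\<bar> * sqrt N < 1 / 6"
  then show "uniformly_convex_on (Omega N) (hamiltonian \<beta>)"
    by (intro hamiltonian_uniformly_convex) simp
  fix M F F'
  assume "C1_on (Omega N) F F'"
  then show "(LINT u:Omega N|gibbs \<beta> N M.
             (F u)\<^sup>2 * ln ((F u)\<^sup>2 / (LINT v:Omega N|gibbs \<beta> N M. (F v)\<^sup>2)))
          \<le> 2 / (1 - 6 * \<bar>\<beta>\<bar> * sqrt N) *
             (LINT u:Omega N|gibbs \<beta> N M. gradient_norm_sq (F' u))"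
    using small by (intro gibbs_log_sobolev) auto
qed simp

end
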